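(* (a) Let $X$ be a compact metric space, $T\colon X\to X$ continuous, and let $\mu$ be an aperiodic royal measure resulting from a GIKN sequence $(\Gamma_n)_{n\in\mathbb N}$ of $T$-periodic orbits (that is, $\mu$ is the weak$^*$ limit of the ergodic measures $\mu_n$ supported on $\Gamma_n$). Then $\mu$ is loosely Kronecker (hence ergodic and with zero entropy). (b) In particular, let $f\colon M\to M$ be a diffeomorphism of a compact smooth Riemannian manifold with a closed $f$-invariant set $\Xi\subset M$ and a continuous $Df$-invariant direction field $\mathcal E=(E_x)_{x\in\Xi}\subset T_\Xi M$ with $\dim E_x=1$ for $x\in\Xi$. Let $(\Gamma_n)_{n\in\mathbb N}$ be a sequence of $f$-periodic orbits contained in $\Xi$ such that $|\Gamma_n|$ increases to infinity as $n\to\infty$, and let $\mu_n$ be the ergodic measure supported on $\Gamma_n$. Assume: (1) there are positive real numbers $(\gamma_n)_{n=1}^\infty$ and a constant $C$ such that for each $n$ the orbit $\Gamma_{n+1}$ is a $(\gamma_n,1-C|\chi^{\mathcal E}(\mu_n)|)$-good approximation of $\Gamma_n$; (2) there is a constant $0<\alpha<1$ such that $|\chi^{\mathcal E}(\mu_{n+1})|<\alpha|\chi^{\mathcal E}(\mu_n)|$ for each $n$; (3) $\gamma_n<\dfrac{\min_{1\le i\le n}d_i}{3\cdot 2^n}$ for each $n$, where $d_i$ is the minimal distance between different points of $\Gamma_i$. Then the resulting royal measure $\mu$, i.e. the weak$^*$ limit of $(\mu_n)_{n\in\mathbb N}$, is either a nonhyperbolic periodic measure or a nonhyperbolic loosely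 Kronecker measure (hence $\mu$ is ergodic and has zero entropy). (c) In all cases above, \[\operatorname{supp}\mu=\bigcap_{k=1}^\infty\overline{\bigcup_{n\ge k}\Gamma_n}.\]
   Context: Let $(X,\rho)$ be a compact metric space and $T\colon X\to X$ continuous. A $T$-periodic orbit is a finite set $\Gamma=\{x,T(x),\dots,T^{p-1}(x)\}$ with $T^p(x)=x$; the ergodic measure supported on $\Gamma$ is the uniform measure on $\Gamma$; such measures are called periodic. An invariant measure is aperiodic if the set of periodic points has measure zero (for an ergodic measure: if it is not periodic). Good approximation: a $T$-periodic orbit $\Gamma$ is a $(\gamma,\kappa)$-good approximation of a $T$-periodic orbit $\Lambda$ if there are a subset $\Delta\subset\Gamma$ with $|\Delta|/|\Gamma|\ge\kappa$ and a constant-to-one surjection $\psi\colon\Delta\to\Lambda$ (all fibres have the same cardinality) such that $\rho(T^j(y),T^j(\psi(y)))<\gamma$ for every $y\in\Delta$ and $0\le j<|\Lambda|$. GIKN sequence: a sequence $(\Gamma_n)_{n\in\mathbb N}$ of $T$-periodic orbits with $|\Gamma_n|\nearrow\infty$ for which there are positive real sequences $(\gamma_n)$, $(\kappa_n)$ with: for each $n\ge 1$, $\Gamma_{n+1}$ is a $(\gamma_n,\kappa_n)$-good approximation of $\Gamma_n$; $\sum_{n}\gamma_n<\infty$; $\prod_{n}\kappa_n>0$. A measure is royal if it is the weak$^*$ limit of the ergodic measures $\mu_n$ supported on the orbits $\Gamma_n$ of a GIKN sequence. Edit distance: for words $u=u_0\dots u_{n-1}$, $w=w_0\dots w_{n-1}$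 over a finite alphabet, $\bar f_n(u,w)=1-k/n$, where $k$ is the largest $\ell$ such that $u_{i_s}=w_{j_s}$ ($s=1,\dots,\ell$) for some $0\le i_1<\dots<i_\ell<n$ and $0\le j_1<\dots<j_\ell<n$. Loosely Kronecker: an ergodic measure-preserving system $(X,\mathscr X,\mu,T)$ (or the measure $\mu$) is loosely Kronecker if it has zero Kolmogorov–Sinai entropy and for every finite Borel partition $\mathcal P$ of $X$ and every $\varepsilon>0$ there are $n>0$ and a set $A_n$ of atoms of $\mathcal P^n=\bigvee_{j=0}^{n-1}T^{-j}(\mathcal P)$ whose union has $\mu$-measure greater than $1-\varepsilon$ and such that $\bar f_n(u,w)<\varepsilon$ for all $u,w\in A_n$; here an atom of $\mathcal P^n$ is identified with the word of length $n$ over $\{0,\dots,|\mathcal P|-1\}$ listing the indices of the elements of $\mathcal P$ successively visited. Lyapunov exponents: for an ergodic $f$-invariant measure $\nu$ with $\operatorname{supp}\nu\subset\Xi$, $\chi^{\mathcal E}(\nu)$ is the Lyapunov exponent of $\nu$ along $\mathcal E$: for $\nu$-a.e. $x$ and nonzero $v\in E_x$, $\lim_{n\to\infty}\frac1n\log\|Df^n_x(v)\|=\chi^{\mathcal E}(\nu)$. An ergodic measure is nonhyperbolic if at least one of its Lyapunov exponents is zero. In (b), good approximations are taken for $T=f$ and $X=M$ with its Riemannian distance. *)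

theory Defs
  imports "HOL-Probability.Probability"
begin

definition periodic_orbit :: "('a \<Rightarrow> 'a) \<Rightarrow> 'a set \<Rightarrow> bool" where
  "periodic_orbit T \<Gamma> \<longleftrightarrow>
     (\<exists>x p. p > 0 \<and> (T ^^ p) x = x \<and> \<Gamma> = (\<lambda>j. (T ^^ j) x) ` {..<p})"

text \<open>The uniform measure on a finite set, regarded as a Borel measure on the whole space
  (the library's uniform counting measure lives on the finite set itself).\<close>

definition orbit_measure :: "'a::topological_space set \<Rightarrow> 'a measure" where
  "orbit_measure \<Gamma> = distr (uniform_count_measure \<Gamma>) borel (\<lambda>x. x)"

definition borel_probability :: "'a::topological_space measure \<Rightarrow> bool" where
  "borel_probability \<mu> \<longleftrightarrow> prob_space \<mu> \<and> sets \<mu> = sets borel"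

definition ergodic_measure :: "('a::topological_space \<Rightarrow> 'a) \<Rightarrow> 'a measure \<Rightarrow> bool" where
  "ergodic_measure T \<mu> \<longleftrightarrow>
     borel_probability \<mu> \<and> T \<in> measurable \<mu> \<mu> \<and> distr \<mu> \<mu> T = \<mu> \<and>
     (\<forall>A\<in>sets \<mu>. T -` A = A \<longrightarrow> measure \<mu> A = 0 \<or> measure \<mu> A = 1)"

definition periodic_measure :: "('a::topological_space \<Rightarrow> 'a) \<Rightarrow> 'a measure \<Rightarrow> bool" where
  "periodic_measure T \<mu> \<longleftrightarrow> (\<exists>\<Gamma>. periodic_orbit T \<Gamma> \<and> \<mu> = orbit_measure \<Gamma>)"

definition aperiodic_measure :: "('a::topological_space \<Rightarrow> 'a) \<Rightarrow> 'a measure \<Rightarrow> bool" where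
  "aperiodic_measure T \<mu> \<longleftrightarrow> {x. \<exists>p>0. (T ^^ p) x = x} \<in> null_sets \<mu>"

definition measure_support :: "'a::topological_space measure \<Rightarrow> 'a set" where
  "measure_support \<mu> = {x. \<forall>U. open U \<and> x \<in> U \<longrightarrow> emeasure \<mu> U > 0}"

text \<open>Intended for compact spaces only, where every continuous function is bounded.\<close>

definition weak_star_limit ::
    "(nat \<Rightarrow> 'a::topological_space measure) \<Rightarrow> 'a measure \<Rightarrow> bool" where
  "weak_star_limit M \<mu> \<longleftrightarrow> borel_probability \<mu> \<and>
     (\<forall>\<phi>::'a \<Rightarrow> real. continuous_on UNIV \<phi> \<longrightarrow>
        (\<lambda>n. integral\<^sup>L (M n) \<phi>) \<longlonglongrightarrow> integral\<^sup>L \<mu> \<phi>)"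

definition good_approximation ::
    "('a::metric_space \<Rightarrow> 'a) \<Rightarrow> real \<Rightarrow> real \<Rightarrow> 'a set \<Rightarrow> 'a set \<Rightarrow> bool" where
  "good_approximation T \<gamma> \<kappa> \<Gamma> \<Lambda> \<longleftrightarrow>
     periodic_orbit T \<Gamma> \<and> periodic_orbit T \<Lambda> \<and>
     (\<exists>\<Delta> \<psi>. \<Delta> \<subseteq> \<Gamma> \<and> real (card \<Delta>) / real (card \<Gamma>) \<ge> \<kappa> \<and>
        \<psi> ` \<Delta> = \<Lambda> \<and> (\<exists>k. \<forall>z\<in>\<Lambda>. card {y\<in>\<Delta>. \<psi> y = z} = k) \<and>
        (\<forall>y\<in>\<Delta>. \<forall>j<card \<Lambda>. dist ((T ^^ j) y) ((T ^^ j) (\<psi> y)) < \<gamma>))"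

text \<open>Sequences are indexed by the positive integers: the value at index 0 is never used.\<close>

definition orbit_sequence :: "('a \<Rightarrow> 'a) \<Rightarrow> (nat \<Rightarrow> 'a set) \<Rightarrow> bool" where
  "orbit_sequence T \<Gamma> \<longleftrightarrow>
     (\<forall>n\<ge>1. periodic_orbit T (\<Gamma> n)) \<and>
     (\<forall>n\<ge>1. card (\<Gamma> n) \<le> card (\<Gamma> (Suc n))) \<and>
     filterlim (\<lambda>n. card (\<Gamma> n)) at_top sequentially"

definition gikn_sequence :: "('a::metric_space \<Rightarrow> 'a) \<Rightarrow> (nat \<Rightarrow> 'a set) \<Rightarrow> bool" where
  "gikn_sequence T \<Gamma> \<longleftrightarrow> orbit_sequence T \<Gamma> \<and>
     (\<exists>\<gamma> \<kappa>. (\<forall>n\<ge>1. \<gamma> n > 0 \<and> \<kappa> n > 0 \<and>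
                 good_approximation T (\<gamma> n) (\<kappa> n) (\<Gamma> (Suc n)) (\<Gamma> n)) \<and>
        summable (\<lambda>n. \<gamma> (Suc n)) \<and>
        (\<exists>P>0. (\<lambda>N. \<Prod>n=1..N. \<kappa> n) \<longlonglongrightarrow> P))"

definition royal_measure_of ::
    "('a::metric_space \<Rightarrow> 'a) \<Rightarrow> (nat \<Rightarrow> 'a set) \<Rightarrow> 'a measure \<Rightarrow> bool" where
  "royal_measure_of T \<Gamma> \<mu> \<longleftrightarrow>
     gikn_sequence T \<Gamma> \<and> weak_star_limit (\<lambda>n. orbit_measure (\<Gamma> n)) \<mu>"

text \<open>Extended real valued, so that a one-point set gets the value \<open>\<infinity>\<close>.\<close>

definition min_distance :: "'a::metric_space set \<Rightarrow> ereal" where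
  "min_distance \<Gamma> = Inf {ereal (dist x y) | x y. x \<in> \<Gamma> \<and> y \<in> \<Gamma> \<and> x \<noteq> y}"

definition finite_borel_partition :: "'a::topological_space set set \<Rightarrow> bool" where
  "finite_borel_partition P \<longleftrightarrow> finite P \<and> partition_on UNIV P \<and> P \<subseteq> sets borel"

text \<open>The alphabet is the partition itself. Since its cells are disjoint, the map \<open>cylinder T\<close> is
  a bijection between \<open>partition_words T P n\<close> and the atoms of \<open>iterated_partition T P n\<close>.\<close>

definition cylinder :: "('a \<Rightarrow> 'a) \<Rightarrow> 'a set list \<Rightarrow> 'a set" where
  "cylinder T w = (\<Inter>j<length w. (T ^^ j) -` (w ! j))"

definition partition_words :: "('a \<Rightarrow> 'a) \<Rightarrow> 'a set set \<Rightarrow> nat \<Rightarrow> 'a set list set" where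
  "partition_words T P n = {w. length w = n \<and> set w \<subseteq> P \<and> cylinder T w \<noteq> {}}"

definition iterated_partition :: "('a \<Rightarrow> 'a) \<Rightarrow> 'a set set \<Rightarrow> nat \<Rightarrow> 'a set set" where
  "iterated_partition T P n = cylinder T ` partition_words T P n"

text \<open>Here \<open>ln 0 = 0\<close>, so null cells contribute 0.\<close>

definition partition_entropy :: "'a measure \<Rightarrow> 'a set set \<Rightarrow> real" where
  "partition_entropy \<mu> P = - (\<Sum>A\<in>P. measure \<mu> A * ln (measure \<mu> A))"

definition ks_entropy :: "('a::topological_space \<Rightarrow> 'a) \<Rightarrow> 'a measure \<Rightarrow> ereal" where
  "ks_entropy T \<mu> =
     (SUP P\<in>Collect finite_borel_partition.
        ereal (lim (\<lambda>n. partition_entropy \<mu> (iterated_partition T P n) / real n)))"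

definition fbar :: "'s list \<Rightarrow> 's list \<Rightarrow> real" where
  "fbar u w =
     1 - real (Max {l. \<exists>i j. strict_mono_on {..<l} i \<and> strict_mono_on {..<l} j \<and>
                     (\<forall>s<l. i s < length u \<and> j s < length w \<and> u ! i s = w ! j s)})
         / real (length u)"

definition loosely_kronecker :: "('a::topological_space \<Rightarrow> 'a) \<Rightarrow> 'a measure \<Rightarrow> bool" where
  "loosely_kronecker T \<mu> \<longleftrightarrow> ergodic_measure T \<mu> \<and> ks_entropy T \<mu> = 0 \<and>
     (\<forall>P \<epsilon>. finite_borel_partition P \<and> \<epsilon> > 0 \<longrightarrow>
        (\<exists>n>0. \<exists>W\<subseteq>partition_words T P n.
           measure \<mu> (\<Union>w\<in>W. cylinder T w) > 1 - \<epsilon> \<and>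
           (\<forall>u\<in>W. \<forall>w\<in>W. fbar u w < \<epsilon>)))"

text \<open>Functions of class \<open>C\<^sup>k\<close> on an open subset \<open>S\<close> of a Euclidean space.\<close>

primrec Ck_on :: "nat \<Rightarrow> ('e::euclidean_space \<Rightarrow> 'b::real_normed_vector) \<Rightarrow> 'e set \<Rightarrow> bool" where
  "Ck_on 0 f S \<longleftrightarrow> continuous_on S f"
| "Ck_on (Suc k) f S \<longleftrightarrow> (\<forall>x\<in>S. f differentiable (at x)) \<and>
     (\<forall>v. Ck_on k (\<lambda>x. frechet_derivative f (at x) v) S)"

definition smooth_on :: "'e set \<Rightarrow> ('e::euclidean_space \<Rightarrow> 'b::real_normed_vector) \<Rightarrow> bool" where
  "smooth_on S f \<longleftrightarrow> (\<forall>k. Ck_on k f S)"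

text \<open>A chart is a pair of a domain and a coordinate map, the latter only relevant on the domain.\<close>

type_synonym ('m, 'e) chart = "'m set \<times> ('m \<Rightarrow> 'e)"

definition chart_inv :: "('m, 'e) chart \<Rightarrow> 'e \<Rightarrow> 'm" where
  "chart_inv c = inv_into (fst c) (snd c)"

definition is_chart :: "('m::topological_space, 'e::euclidean_space) chart \<Rightarrow> bool" where
  "is_chart c \<longleftrightarrow> open (fst c) \<and> open (snd c ` fst c) \<and>
     homeomorphism (fst c) (snd c ` fst c) (snd c) (chart_inv c)"

definition smooth_atlas :: "('m::topological_space, 'e::euclidean_space) chart set \<Rightarrow> bool" where
  "smooth_atlas \<A> \<longleftrightarrow> (\<forall>c\<in>\<A>. is_chart c) \<and> (\<Union>c\<in>\<A>. fst c) = UNIV \<and>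
     (\<forall>c\<in>\<A>. \<forall>d\<in>\<A>. smooth_on (snd c ` (fst c \<inter> fst d)) (snd d \<circ> chart_inv c))"

definition charts_at :: "('m, 'e) chart set \<Rightarrow> 'm \<Rightarrow> ('m, 'e) chart set" where
  "charts_at \<A> x = {c\<in>\<A>. x \<in> fst c}"

text \<open>A tangent vector at \<open>x\<close> is the family of its coordinate vectors in all charts at \<open>x\<close>
  (extended by 0 to everything else), which transform by the derivatives of the transition maps.\<close>

type_synonym ('m, 'e) tvec = "('m, 'e) chart \<Rightarrow> 'e"

definition tangent_space ::
    "('m, 'e::euclidean_space) chart set \<Rightarrow> 'm \<Rightarrow> ('m, 'e) tvec set" where
  "tangent_space \<A> x =
     {v. (\<forall>c. c \<notin> charts_at \<A> x \<longrightarrow> v c = 0) \<and>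
         (\<forall>c\<in>charts_at \<A> x. \<forall>d\<in>charts_at \<A> x.
            v d = frechet_derivative (snd d \<circ> chart_inv c) (at (snd c x)) (v c))}"

definition tvec_zero :: "('m, 'e::euclidean_space) tvec" where
  "tvec_zero = (\<lambda>c. 0)"

text \<open>The tangent vector at \<open>x\<close> that has coordinates \<open>u\<close> in the chart \<open>c\<close>.\<close>

definition tvec_of ::
    "('m, 'e::euclidean_space) chart set \<Rightarrow> 'm \<Rightarrow> ('m, 'e) chart \<Rightarrow> 'e \<Rightarrow> ('m, 'e) tvec" where
  "tvec_of \<A> x c u =
     (\<lambda>d. if d \<in> charts_at \<A> x
          then frechet_derivative (snd d \<circ> chart_inv c) (at (snd c x)) u else 0)"

definition tvec_line :: "('m, 'e::euclidean_space) tvec \<Rightarrow> ('m, 'e) tvec set" where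
  "tvec_line v = range (\<lambda>t. (\<lambda>c. t *\<^sub>R v c))"

definition C1_map ::
    "('m::topological_space, 'e::euclidean_space) chart set \<Rightarrow> ('m \<Rightarrow> 'm) \<Rightarrow> bool" where
  "C1_map \<A> f \<longleftrightarrow> continuous_on UNIV f \<and>
     (\<forall>c\<in>\<A>. \<forall>d\<in>\<A>. Ck_on 1 (snd d \<circ> f \<circ> chart_inv c) (snd c ` (fst c \<inter> f -` fst d)))"

definition C1_diffeomorphism ::
    "('m::topological_space, 'e::euclidean_space) chart set \<Rightarrow> ('m \<Rightarrow> 'm) \<Rightarrow> bool" where
  "C1_diffeomorphism \<A> f \<longleftrightarrow> bij f \<and> C1_map \<A> f \<and> C1_map \<A> (inv f)"

text \<open>\<open>Df\<^sub>x(v)\<close>; for a tangent vector \<open>v\<close> the result does not depend on the chart \<open>c\<close> chosen.\<close>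

definition tangent_map ::
    "('m, 'e::euclidean_space) chart set \<Rightarrow> ('m \<Rightarrow> 'm) \<Rightarrow> 'm \<Rightarrow> ('m, 'e) tvec \<Rightarrow> ('m, 'e) tvec" where
  "tangent_map \<A> f x v =
     (let c = (SOME c. c \<in> charts_at \<A> x)
      in (\<lambda>d. if d \<in> charts_at \<A> (f x)
              then frechet_derivative (snd d \<circ> f \<circ> chart_inv c) (at (snd c x)) (v c) else 0))"

type_synonym ('m, 'e) metric_tensor = "'m \<Rightarrow> ('m, 'e) tvec \<Rightarrow> ('m, 'e) tvec \<Rightarrow> real"

definition riemannian_metric ::
    "('m, 'e::euclidean_space) chart set \<Rightarrow> ('m, 'e) metric_tensor \<Rightarrow> bool" where
  "riemannian_metric \<A> g \<longleftrightarrow>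
     (\<forall>c\<in>\<A>. \<forall>x\<in>fst c.
        bilinear (\<lambda>u w. g x (tvec_of \<A> x c u) (tvec_of \<A> x c w)) \<and>
        (\<forall>u w. g x (tvec_of \<A> x c u) (tvec_of \<A> x c w) = g x (tvec_of \<A> x c w) (tvec_of \<A> x c u)) \<and>
        (\<forall>u. u \<noteq> 0 \<longrightarrow> g x (tvec_of \<A> x c u) (tvec_of \<A> x c u) > 0)) \<and>
     (\<forall>c\<in>\<A>. \<forall>u w. smooth_on (snd c ` fst c)
        (\<lambda>y. g (chart_inv c y) (tvec_of \<A> (chart_inv c y) c u) (tvec_of \<A> (chart_inv c y) c w)))"

definition tvec_norm :: "('m, 'e) metric_tensor \<Rightarrow> 'm \<Rightarrow> ('m, 'e) tvec \<Rightarrow> real" where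
  "tvec_norm g x v = sqrt (g x v v)"

definition velocity ::
    "('m, 'e::euclidean_space) chart set \<Rightarrow> (real \<Rightarrow> 'm) \<Rightarrow> real \<Rightarrow> ('m, 'e) tvec" where
  "velocity \<A> p t =
     (\<lambda>c. if c \<in> charts_at \<A> (p t) then vector_derivative (snd c \<circ> p) (at t) else 0)"

text \<open>As for the library's piecewise \<open>C\<^sup>1\<close> functions, the derivative may be unbounded near
  the finitely many exceptional parameters. The length of such a curve is a possibly infinite
  Lebesgue integral, so this does not affect the infimum of the lengths.\<close>

definition piecewise_C1_curve ::
    "('m::topological_space, 'e::euclidean_space) chart set \<Rightarrow> (real \<Rightarrow> 'm) \<Rightarrow> bool" where
  "piecewise_C1_curve \<A> p \<longleftrightarrow> continuous_on {0..1} p \<and>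
     (\<exists>F. finite F \<and>
        (\<forall>c\<in>\<A>. (snd c \<circ> p) C1_differentiable_on {t \<in> {0<..<1} - F. p t \<in> fst c}))"

definition curve_length ::
    "('m, 'e::euclidean_space) chart set \<Rightarrow> ('m, 'e) metric_tensor \<Rightarrow> (real \<Rightarrow> 'm) \<Rightarrow> ennreal" where
  "curve_length \<A> g p =
     (\<integral>\<^sup>+ t \<in> {0<..<1}. ennreal (tvec_norm g (p t) (velocity \<A> p t)) \<partial>lborel)"

definition riemannian_distance ::
    "('m::topological_space, 'e::euclidean_space) chart set \<Rightarrow> ('m, 'e) metric_tensor \<Rightarrow>
     'm \<Rightarrow> 'm \<Rightarrow> ennreal" where
  "riemannian_distance \<A> g x y =
     (INF p \<in> {p. piecewise_C1_curve \<A> p \<and> p 0 = x \<and> p 1 = y}. curve_length \<A> g p)"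

text \<open>The manifold is a metric space type whose metric is the Riemannian distance (which induces
  the manifold topology). Connectedness is not required: the Riemannian distance of points in
  different components is infinite, and their distance in the metric space is then arbitrary.\<close>

definition riemannian_manifold ::
    "('m::metric_space, 'e::euclidean_space) chart set \<Rightarrow> ('m, 'e) metric_tensor \<Rightarrow> bool" where
  "riemannian_manifold \<A> g \<longleftrightarrow> smooth_atlas \<A> \<and> riemannian_metric \<A> g \<and>
     (\<forall>x y. riemannian_distance \<A> g x y \<noteq> \<infinity> \<longrightarrow>
        ennreal (dist x y) = riemannian_distance \<A> g x y)"

text \<open>A line field on \<open>\<Xi>\<close> is continuous if locally it is spanned by a nonvanishing vector field
  whose coordinate vector \<open>u\<close> in some chart \<open>c\<close> is continuous.\<close>

definition continuous_line_field ::
    "('m::topological_space, 'e::euclidean_space) chart set \<Rightarrow> 'm set \<Rightarrow>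
     ('m \<Rightarrow> ('m, 'e) tvec set) \<Rightarrow> bool" where
  "continuous_line_field \<A> \<Xi> E \<longleftrightarrow>
     (\<forall>x\<in>\<Xi>. \<exists>v\<in>tangent_space \<A> x. v \<noteq> tvec_zero \<and> E x = tvec_line v) \<and>
     (\<forall>x\<in>\<Xi>. \<exists>c\<in>charts_at \<A> x. \<exists>U u. open U \<and> x \<in> U \<and> U \<subseteq> fst c \<and>
        continuous_on (\<Xi> \<inter> U) u \<and>
        (\<forall>y\<in>\<Xi> \<inter> U. u y \<noteq> 0 \<and> E y = tvec_line (tvec_of \<A> y c (u y))))"

definition invariant_line_field ::
    "('m, 'e::euclidean_space) chart set \<Rightarrow> ('m \<Rightarrow> 'm) \<Rightarrow> 'm set \<Rightarrow>
     ('m \<Rightarrow> ('m, 'e) tvec set) \<Rightarrow> bool" where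
  "invariant_line_field \<A> f \<Xi> E \<longleftrightarrow> (\<forall>x\<in>\<Xi>. tangent_map \<A> f x ` E x = E (f x))"

definition has_exponent_at ::
    "('m, 'e::euclidean_space) chart set \<Rightarrow> ('m, 'e) metric_tensor \<Rightarrow> ('m \<Rightarrow> 'm) \<Rightarrow>
     'm \<Rightarrow> ('m, 'e) tvec \<Rightarrow> real \<Rightarrow> bool" where
  "has_exponent_at \<A> g f x v L \<longleftrightarrow>
     (\<lambda>n. ln (tvec_norm g ((f ^^ n) x) (tangent_map \<A> (f ^^ n) x v)) / real n) \<longlonglongrightarrow> L"

definition line_exponent ::
    "('m, 'e::euclidean_space) chart set \<Rightarrow> ('m, 'e) metric_tensor \<Rightarrow> ('m \<Rightarrow> 'm) \<Rightarrow>
     ('m \<Rightarrow> ('m, 'e) tvec set) \<Rightarrow> 'm measure \<Rightarrow> real" where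
  "line_exponent \<A> g f E \<nu> =
     (THE L. AE x in \<nu>. \<forall>v\<in>E x. v \<noteq> tvec_zero \<longrightarrow> has_exponent_at \<A> g f x v L)"

definition lyapunov_exponent ::
    "('m, 'e::euclidean_space) chart set \<Rightarrow> ('m, 'e) metric_tensor \<Rightarrow> ('m \<Rightarrow> 'm) \<Rightarrow>
     'm measure \<Rightarrow> real \<Rightarrow> bool" where
  "lyapunov_exponent \<A> g f \<nu> L \<longleftrightarrow>
     (AE x in \<nu>. \<exists>v\<in>tangent_space \<A> x. v \<noteq> tvec_zero \<and> has_exponent_at \<A> g f x v L)"

definition nonhyperbolic_measure ::
    "('m::topological_space, 'e::euclidean_space) chart set \<Rightarrow> ('m, 'e) metric_tensor \<Rightarrow>
     ('m \<Rightarrow> 'm) \<Rightarrow> 'm measure \<Rightarrow> bool" where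
  "nonhyperbolic_measure \<A> g f \<nu> \<longleftrightarrow> ergodic_measure f \<nu> \<and> lyapunov_exponent \<A> g f \<nu> 0"

end

theory Submission
  imports Defs
begin

text \<open>
  A long periodic orbit \<open>\<Gamma>\<^sub>N\<close> of a GIKN sequence is shadowed, for a whole period \<open>p\<close> and up to a small
  error, by all later orbits on a set of proportion close to one; the set of shadowing points is
  closed, so this passes to the limit measure \<open>\<mu>\<close>. Averages over one period are therefore nearly
  constant, which gives ergodicity, and names of length \<open>p\<close> are determined by a phase and few
  corrections, which gives zero entropy.

  For the loosely Kronecker property one needs coherence over many periods. A pair \<open>(t, s)\<close> is bad if
  the shift by \<open>s\<close> moves \<open>\<Gamma>\<^sub>N\<close> only slightly except at phase \<open>t\<close>, where it jumps. Since shifts commute,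
  at most two phases are bad. Hence \<open>T\<^sup>p x\<close> is close to \<open>x\<close> as soon as \<open>x\<close> and \<open>T x\<close> both shadow
  \<open>\<Gamma>\<^sub>N\<close> and \<open>x\<close> avoids two small balls, and the latter have small measure when \<open>\<mu>\<close> has no atom. Names of
  length \<open>M p\<close> are then almost \<open>p\<close>-periodic, and differ from each other essentially by a phase, which
  costs only \<open>1 / M\<close> in edit distance. An atom of the ergodic measure \<open>\<mu>\<close> makes \<open>\<mu>\<close> periodic.

  In the differentiable case the logarithmic expansion along the line field is a continuous function
  whose integrals are the exponents, so its integral over \<open>\<mu>\<close> is zero and Birkhoff's theorem applies.
\<close>

section \<open>Periodic orbits and good approximations\<close>

text \<open>Shadowing controls a point for one period only, and in (a) nothing separates the points
  of \<open>\<Gamma> N\<close> from each other: the phase of a shadowing point is not unique, and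
  consecutive windows may use unrelated phases. This is why the near return of \<open>x\<close>
  under \<open>T ^^ p\<close> is proved directly instead of following phases. The constants are then
  fixed in a definite order: the number \<open>M\<close> of periods from \<open>\<epsilon>\<close>,
  the tolerated frequency of bad times from \<open>M\<close>, the shadowing error from
  \<open>M\<close> and the partition, and the orbit last. Errors may therefore grow with
  \<open>M\<close>, but not with the period.

  Weak convergence bounds masses from below on closed sets only, so the sets to be estimated in the
  limit are defined by weak inequalities.

  In (b) the limit also has to exist. It is built as the law of an almost sure limit of coupled
  uniform points, one for each orbit. The contraction of the exponents makes the exceptional
  proportions summable, as Borel-Cantelli requires.\<close>

lemma
  assumes "periodic_orbit T \<Gamma>"
  shows periodic_orbit_finite: "finite \<Gamma>"
    and periodic_orbit_card_pos: "card \<Gamma> > 0"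
    and periodic_orbit_image: "T ` \<Gamma> = \<Gamma>"
proof -
  obtain x p where p: "p > 0" "(T ^^ p) x = x" "\<Gamma> = (\<lambda>j. (T ^^ j) x) ` {..<p}"
    using assms unfolding periodic_orbit_def by blast
  show fin: "finite \<Gamma>" using p by simp
  show "card \<Gamma> > 0" using p fin by (auto simp: card_gt_0_iff)
  have "T ((T ^^ j) x) \<in> \<Gamma>" if "j < p" for j
  proof (cases "Suc j = p")
    case True
    then have "T ((T ^^ j) x) = (T ^^ 0) x" using p(2) by auto
    then show ?thesis using p by blast
  next
    case False
    then have "Suc j < p" "T ((T ^^ j) x) = (T ^^ Suc j) x" using that by auto
    then show ?thesis using p(3) by blast
  qed
  then have 1: "T ` \<Gamma> \<subseteq> \<Gamma>" using p(3) by auto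
  have "(T ^^ j) x \<in> T ` \<Gamma>" if "j < p" for j
  proof (cases j)
    case 0
    have "(T ^^ j) x = T ((T ^^ (p - 1)) x)" using p(1,2) 0
      by (metis Suc_diff_1 comp_apply funpow.simps(2) funpow_0)
    then show ?thesis using p by auto
  next
    case (Suc i)
    then show ?thesis using p that by auto
  qed
  then have 2: "\<Gamma> \<subseteq> T ` \<Gamma>" using p(3) by auto
  show "T ` \<Gamma> = \<Gamma>" using 1 2 by blast
qed

lemma periodic_orbit_bij_betw: "periodic_orbit T \<Gamma> \<Longrightarrow> bij_betw T \<Gamma> \<Gamma>"
  by (simp add: bij_betw_def eq_card_imp_inj_on periodic_orbit_finite periodic_orbit_image)

lemma periodic_orbit_funpow_bij_betw: "periodic_orbit T \<Gamma> \<Longrightarrow> bij_betw (T ^^ n) \<Gamma> \<Gamma>"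
  by (simp add: bij_betw_funpow periodic_orbit_bij_betw)

lemma periodic_orbit_funpow_mem: "periodic_orbit T \<Gamma> \<Longrightarrow> z \<in> \<Gamma> \<Longrightarrow> (T ^^ n) z \<in> \<Gamma>"
  using periodic_orbit_funpow_bij_betw bij_betwE by metis

lemma
  assumes "periodic_orbit T \<Gamma>" "z \<in> \<Gamma>"
  shows periodic_orbit_period: "(T ^^ card \<Gamma>) z = z"
    and periodic_orbit_eq: "\<Gamma> = (\<lambda>j. (T ^^ j) z) ` {..<card \<Gamma>}"
    and periodic_orbit_inj: "inj_on (\<lambda>j. (T ^^ j) z) {..<card \<Gamma>}"
proof -
  obtain x p where p: "p > 0" "(T ^^ p) x = x" "\<Gamma> = (\<lambda>j. (T ^^ j) x) ` {..<p}"
    using assms unfolding periodic_orbit_def by blast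
  obtain i where i: "i < p" "z = (T ^^ i) x" using p assms by auto
  have zp: "(T ^^ p) z = z"
    unfolding i(2) using p(2) by (metis add.commute comp_apply funpow_add)
  \<comment> \<open>The defining \<open>p\<close> may be a multiple of the minimal period. The least
    period of \<open>z\<close> enumerates the orbit without repetition, so it is the
    cardinality.\<close>
  define q where "q = (LEAST n. n > 0 \<and> (T ^^ n) z = z)"
  have q: "q > 0 \<and> (T ^^ q) z = z"
    unfolding q_def by (rule LeastI[of _ p]) (use zp p in auto)
  have qmin: "q \<le> n" if "n > 0" "(T ^^ n) z = z" for n
    unfolding q_def by (rule Least_le) (use that in auto)
  have modq: "(T ^^ n) z = (T ^^ (n mod q)) z" for n
    using q by (simp add: funpow_mod_eq)
  have sub: "\<Gamma> \<subseteq> (\<lambda>j. (T ^^ j) z) ` {..<q}"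
  proof
    fix y assume "y \<in> \<Gamma>"
    then obtain j where j: "j < p" "y = (T ^^ j) x" using p by auto
    \<comment> \<open>One extra period keeps the exponent \<open>j + p - i\<close> from being
      truncated.\<close>
    have "y = (T ^^ (j + p)) x" using j p by (simp add: funpow_add)
    also have "j + p = (j + p - i) + i" using i by auto
    finally have "y = (T ^^ (j + p - i)) z" by (simp add: funpow_add i(2))
    then have "y = (T ^^ ((j + p - i) mod q)) z" using modq by metis
    then show "y \<in> (\<lambda>j. (T ^^ j) z) ` {..<q}" using q by auto
  qed
  moreover have "(\<lambda>j. (T ^^ j) z) ` {..<q} \<subseteq> \<Gamma>"
    using periodic_orbit_funpow_mem[OF assms] by auto
  ultimately have eq: "\<Gamma> = (\<lambda>j. (T ^^ j) z) ` {..<q}" by auto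
  have inj: "inj_on (\<lambda>j. (T ^^ j) z) {..<q}"
  proof -
    have "a = b" if "a \<le> b" "b < q" "(T ^^ a) z = (T ^^ b) z" for a b
    proof (rule ccontr)
      assume "a \<noteq> b"
      have "(T ^^ (q - b + a)) z = (T ^^ (q - b + b)) z"
        using that(3) by (simp only: funpow_add comp_apply)
      also have "\<dots> = z" using q that by simp
      finally have "q \<le> q - b + a" using that \<open>a \<noteq> b\<close> by (intro qmin) auto
      then show False using that \<open>a \<noteq> b\<close> by auto
    qed
    then show ?thesis unfolding inj_on_def
      by (metis lessThan_iff nle_le)
  qed
  have "card \<Gamma> = q" using eq inj by (simp add: card_image)
  then show "(T ^^ card \<Gamma>) z = z" "\<Gamma> = (\<lambda>j. (T ^^ j) z) ` {..<card \<Gamma>}"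
    "inj_on (\<lambda>j. (T ^^ j) z) {..<card \<Gamma>}" using q eq inj by auto
qed

lemma sum_periodic_orbit:
  assumes "periodic_orbit T \<Gamma>" "z \<in> \<Gamma>"
  shows "(\<Sum>j<card \<Gamma>. f ((T ^^ j) z)) = sum f \<Gamma>"
  using sum.reindex[OF periodic_orbit_inj[OF assms], of f] periodic_orbit_eq[OF assms]
  by (simp add: o_def)

lemma
  fixes \<Gamma> :: "'a::topological_space set"
  assumes "finite \<Gamma>" "\<Gamma> \<noteq> {}"
  shows borel_probability_orbit_measure: "borel_probability (orbit_measure \<Gamma>)"
    and measure_orbit_measure: "A \<in> sets borel \<Longrightarrow> measure (orbit_measure \<Gamma>) A = card (\<Gamma> \<inter> A) / card \<Gamma>"
    and integral_orbit_measure: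
      "\<phi> \<in> borel_measurable borel \<Longrightarrow> integral\<^sup>L (orbit_measure \<Gamma>) (\<phi> :: 'a \<Rightarrow> real) = sum \<phi> \<Gamma> / card \<Gamma>"
    and AE_orbit_measure_iff: "{x. P x} \<in> sets borel \<Longrightarrow> (AE x in orbit_measure \<Gamma>. P x) \<longleftrightarrow> (\<forall>x\<in>\<Gamma>. P x)"
proof -
  have m: "(\<lambda>x. x) \<in> measurable (uniform_count_measure \<Gamma>) borel"
    by (simp add: measurable_def)
  interpret P: prob_space "uniform_count_measure \<Gamma>"
    using assms by (rule prob_space_uniform_count_measure)
  show "borel_probability (orbit_measure \<Gamma>)"
    unfolding borel_probability_def orbit_measure_def using P.prob_space_distr[OF m] by simp
  show "measure (orbit_measure \<Gamma>) A = card (\<Gamma> \<inter> A) / card \<Gamma>" if "A \<in> sets borel"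
  proof -
    have "measure (orbit_measure \<Gamma>) A = measure (uniform_count_measure \<Gamma>) (A \<inter> \<Gamma>)"
      unfolding orbit_measure_def using that m by (subst measure_distr) (auto simp: space_uniform_count_measure)
    then show ?thesis using assms
      by (subst (asm) measure_uniform_count_measure) (auto simp: Int_commute)
  qed
  show "integral\<^sup>L (orbit_measure \<Gamma>) \<phi> = sum \<phi> \<Gamma> / card \<Gamma>" if "\<phi> \<in> borel_measurable borel"
  proof -
    have "integral\<^sup>L (orbit_measure \<Gamma>) \<phi> = integral\<^sup>L (uniform_count_measure \<Gamma>) \<phi>"
      unfolding orbit_measure_def using that m by (subst integral_distr) auto
    also have "\<dots> = sum \<phi> \<Gamma> / card \<Gamma>"
      unfolding uniform_count_measure_def using assms
      by (subst lebesgue_integral_point_measure_finite) (auto simp: sum_divide_distrib)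
    finally show ?thesis .
  qed
  show "(AE x in orbit_measure \<Gamma>. P x) \<longleftrightarrow> (\<forall>x\<in>\<Gamma>. P x)" if "{x. P x} \<in> sets borel"
  proof -
    have "(AE x in orbit_measure \<Gamma>. P x) \<longleftrightarrow> (AE x in uniform_count_measure \<Gamma>. P x)"
      unfolding orbit_measure_def using that m by (subst AE_distr_iff) auto
    also have "\<dots> \<longleftrightarrow> (\<forall>x\<in>\<Gamma>. P x)"
      unfolding uniform_count_measure_def AE_point_measure using assms by (auto simp: card_gt_0_iff)
    finally show ?thesis .
  qed
qed

section \<open>Good approximations: composition and tails of a GIKN sequence\<close>

lemma good_approximation_mono:
  assumes "good_approximation T \<gamma> \<kappa> \<Gamma> \<Lambda>" "\<gamma> \<le> \<gamma>'" "\<kappa>' \<le> \<kappa>"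
  shows "good_approximation T \<gamma>' \<kappa>' \<Gamma> \<Lambda>"
proof -
  from assms(1) obtain \<Delta> \<psi> where *: "\<Delta> \<subseteq> \<Gamma>" "card \<Delta> / card \<Gamma> \<ge> \<kappa>" "\<psi> ` \<Delta> = \<Lambda>"
    "\<exists>k. \<forall>z\<in>\<Lambda>. card {y\<in>\<Delta>. \<psi> y = z} = k"
    "\<forall>y\<in>\<Delta>. \<forall>j<card \<Lambda>. dist ((T ^^ j) y) ((T ^^ j) (\<psi> y)) < \<gamma>"
    unfolding good_approximation_def by auto
  have "card \<Delta> / card \<Gamma> \<ge> \<kappa>'" using * assms by auto
  moreover have "\<forall>y\<in>\<Delta>. \<forall>j<card \<Lambda>. dist ((T ^^ j) y) ((T ^^ j) (\<psi> y)) < \<gamma>'"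
    using * assms by (meson order.strict_trans2)
  ultimately show ?thesis using assms(1) * unfolding good_approximation_def by blast
qed

lemma good_approximationE:
  assumes "good_approximation T \<gamma> \<kappa> \<Gamma> \<Lambda>"
  obtains \<Delta> \<psi> k where "\<Delta> \<subseteq> \<Gamma>" "\<kappa> * real (card \<Gamma>) \<le> card \<Delta>" "\<psi> ` \<Delta> = \<Lambda>"
    "\<And>z. z \<in> \<Lambda> \<Longrightarrow> card {y\<in>\<Delta>. \<psi> y = z} = k" "card \<Delta> = k * card \<Lambda>" "k > 0"
    "\<And>y j. y \<in> \<Delta> \<Longrightarrow> j < card \<Lambda> \<Longrightarrow> dist ((T ^^ j) y) ((T ^^ j) (\<psi> y)) < \<gamma>"
proof -
  from assms obtain \<Delta> \<psi> where 0: "\<Delta> \<subseteq> \<Gamma>" "card \<Delta> / card \<Gamma> \<ge> \<kappa>" "\<psi> ` \<Delta> = \<Lambda>"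
    "\<exists>k. \<forall>z\<in>\<Lambda>. card {y\<in>\<Delta>. \<psi> y = z} = k"
    "\<forall>y\<in>\<Delta>. \<forall>j<card \<Lambda>. dist ((T ^^ j) y) ((T ^^ j) (\<psi> y)) < \<gamma>"
    unfolding good_approximation_def by auto
  then obtain k where k: "\<forall>z\<in>\<Lambda>. card {y\<in>\<Delta>. \<psi> y = z} = k" by auto
  note * = 0(1-3) bspec[OF k] 0(5)[rule_format]
  have per: "periodic_orbit T \<Gamma>" "periodic_orbit T \<Lambda>"
    using assms unfolding good_approximation_def by auto
  have c: "card \<Gamma> > 0" "card \<Lambda> > 0" "finite \<Gamma>" "finite \<Lambda>"
    using per periodic_orbit_card_pos periodic_orbit_finite by metis+
  have fin: "finite \<Delta>" using c * finite_subset by metis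
  have "card \<Delta> = card (\<Union>z\<in>\<Lambda>. {y\<in>\<Delta>. \<psi> y = z})"
    by (rule arg_cong[where f=card]) (use * in auto)
  also have "\<dots> = (\<Sum>z\<in>\<Lambda>. card {y\<in>\<Delta>. \<psi> y = z})"
    using c fin by (intro card_UN_disjoint) auto
  also have "\<dots> = k * card \<Lambda>" using * by simp
  finally have ck: "card \<Delta> = k * card \<Lambda>" .
  have "\<Delta> \<noteq> {}" using * c by auto
  then have "card \<Delta> > 0" using fin by (simp add: card_gt_0_iff)
  then have "k > 0" using ck by (metis mult_is_0 neq0_conv)
  moreover have "\<kappa> * real (card \<Gamma>) \<le> card \<Delta>" using *(2) c by (simp add: pos_le_divide_eq)
  ultimately show thesis using that * ck by blast
qed

lemma good_approximationI:
  assumes "periodic_orbit T \<Gamma>" "periodic_orbit T \<Lambda>" "\<Delta> \<subseteq> \<Gamma>" "\<kappa> * real (card \<Gamma>) \<le> card \<Delta>" "\<psi> ` \<Delta> = \<Lambda>"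
    "\<And>z. z \<in> \<Lambda> \<Longrightarrow> card {y\<in>\<Delta>. \<psi> y = z} = k"
    "\<And>y j. y \<in> \<Delta> \<Longrightarrow> j < card \<Lambda> \<Longrightarrow> dist ((T ^^ j) y) ((T ^^ j) (\<psi> y)) < \<gamma>"
  shows "good_approximation T \<gamma> \<kappa> \<Gamma> \<Lambda>"
proof -
  have "card \<Gamma> > 0" using assms periodic_orbit_card_pos by metis
  then have "\<kappa> \<le> card \<Delta> / card \<Gamma>" using assms by (simp add: pos_le_divide_eq)
  moreover have "\<exists>k. \<forall>z\<in>\<Lambda>. card {y\<in>\<Delta>. \<psi> y = z} = k" using assms(6) by blast
  moreover have "\<forall>y\<in>\<Delta>. \<forall>j<card \<Lambda>. dist ((T ^^ j) y) ((T ^^ j) (\<psi> y)) < \<gamma>" using assms(7) by blast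
  ultimately show ?thesis unfolding good_approximation_def using assms(1-3,5) by auto
qed

text \<open>Compose the two surjections on the points of \<open>\<Delta>\<^sub>1\<close> that land
  in \<open>\<Delta>\<^sub>2\<close>. Constant fibres make the proportions multiply, and
  \<open>card \<Gamma> \<le> card \<Gamma>'\<close> makes the first shadowing last for a whole
  period of \<open>\<Gamma>\<close>.\<close>

lemma good_approximation_trans:
  assumes 1: "good_approximation T \<gamma>\<^sub>1 \<kappa>\<^sub>1 \<Gamma>'' \<Gamma>'" and 2: "good_approximation T \<gamma>\<^sub>2 \<kappa>\<^sub>2 \<Gamma>' \<Gamma>"
    and le: "card \<Gamma> \<le> card \<Gamma>'" and nonneg: "\<kappa>\<^sub>1 \<ge> 0"
  shows "good_approximation T (\<gamma>\<^sub>1 + \<gamma>\<^sub>2) (\<kappa>\<^sub>1 * \<kappa>\<^sub>2) \<Gamma>'' \<Gamma>"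
proof -
  have per: "periodic_orbit T \<Gamma>''" "periodic_orbit T \<Gamma>'" "periodic_orbit T \<Gamma>"
    using 1 2 unfolding good_approximation_def by auto
  have c': "card \<Gamma>' > 0" "finite \<Gamma>''" "finite \<Gamma>'"
    using per periodic_orbit_card_pos periodic_orbit_finite by metis+
  obtain \<Delta>\<^sub>1 \<psi>\<^sub>1 k\<^sub>1 where a: "\<Delta>\<^sub>1 \<subseteq> \<Gamma>''" "\<kappa>\<^sub>1 * card \<Gamma>'' \<le> card \<Delta>\<^sub>1" "\<psi>\<^sub>1 ` \<Delta>\<^sub>1 = \<Gamma>'"
    "\<And>z. z \<in> \<Gamma>' \<Longrightarrow> card {y\<in>\<Delta>\<^sub>1. \<psi>\<^sub>1 y = z} = k\<^sub>1" "card \<Delta>\<^sub>1 = k\<^sub>1 * card \<Gamma>'" "k\<^sub>1 > 0"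
    "\<And>y j. y \<in> \<Delta>\<^sub>1 \<Longrightarrow> j < card \<Gamma>' \<Longrightarrow> dist ((T ^^ j) y) ((T ^^ j) (\<psi>\<^sub>1 y)) < \<gamma>\<^sub>1"
    using good_approximationE[OF 1] by blast
  obtain \<Delta>\<^sub>2 \<psi>\<^sub>2 k\<^sub>2 where b: "\<Delta>\<^sub>2 \<subseteq> \<Gamma>'" "\<kappa>\<^sub>2 * card \<Gamma>' \<le> card \<Delta>\<^sub>2" "\<psi>\<^sub>2 ` \<Delta>\<^sub>2 = \<Gamma>"
    "\<And>z. z \<in> \<Gamma> \<Longrightarrow> card {y\<in>\<Delta>\<^sub>2. \<psi>\<^sub>2 y = z} = k\<^sub>2" "card \<Delta>\<^sub>2 = k\<^sub>2 * card \<Gamma>" "k\<^sub>2 > 0"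
    "\<And>y j. y \<in> \<Delta>\<^sub>2 \<Longrightarrow> j < card \<Gamma> \<Longrightarrow> dist ((T ^^ j) y) ((T ^^ j) (\<psi>\<^sub>2 y)) < \<gamma>\<^sub>2"
    using good_approximationE[OF 2] by blast
  define \<Delta> where "\<Delta> = {y\<in>\<Delta>\<^sub>1. \<psi>\<^sub>1 y \<in> \<Delta>\<^sub>2}"
  have fin: "finite \<Delta>\<^sub>1" "finite \<Delta>\<^sub>2" using a b c' finite_subset by metis+
  have fib: "card {y\<in>\<Delta>\<^sub>1. \<psi>\<^sub>1 y \<in> B} = k\<^sub>1 * card B" if "B \<subseteq> \<Delta>\<^sub>2" for B
  proof -
    have finB: "finite B" using that fin finite_subset by metis
    have "{y\<in>\<Delta>\<^sub>1. \<psi>\<^sub>1 y \<in> B} = (\<Union>z\<in>B. {y\<in>\<Delta>\<^sub>1. \<psi>\<^sub>1 y = z})" by auto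
    then have "card {y\<in>\<Delta>\<^sub>1. \<psi>\<^sub>1 y \<in> B} = (\<Sum>z\<in>B. card {y\<in>\<Delta>\<^sub>1. \<psi>\<^sub>1 y = z})"
      using finB fin by (simp only:) (intro card_UN_disjoint, auto)
    also have "\<dots> = (\<Sum>z\<in>B. k\<^sub>1)" using that b a by (intro sum.cong) auto
    finally show ?thesis by simp
  qed
  show ?thesis
  proof (rule good_approximationI[where \<Delta>=\<Delta> and \<psi>="\<psi>\<^sub>2 \<circ> \<psi>\<^sub>1" and k="k\<^sub>1 * k\<^sub>2"])
    show "\<Delta> \<subseteq> \<Gamma>''" using a unfolding \<Delta>_def by auto
    have cD: "card \<Delta> = k\<^sub>1 * card \<Delta>\<^sub>2" unfolding \<Delta>_def by (rule fib) simp
    have "\<kappa>\<^sub>1 * \<kappa>\<^sub>2 * card \<Gamma>'' * card \<Gamma>' = (\<kappa>\<^sub>1 * card \<Gamma>'') * (\<kappa>\<^sub>2 * card \<Gamma>')" by simp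
    also have "\<dots> \<le> (\<kappa>\<^sub>1 * card \<Gamma>'') * card \<Delta>\<^sub>2" using b(2) nonneg by (intro mult_left_mono) auto
    also have "\<dots> \<le> real (card \<Delta>\<^sub>1) * real (card \<Delta>\<^sub>2)" using a(2) by (intro mult_right_mono) auto
    also have "\<dots> = real (card \<Delta>) * card \<Gamma>'" using a(5) cD by simp
    finally show "\<kappa>\<^sub>1 * \<kappa>\<^sub>2 * card \<Gamma>'' \<le> card \<Delta>" using c' by simp
    have "\<psi>\<^sub>1 ` \<Delta> = \<Delta>\<^sub>2" unfolding \<Delta>_def using a(3) b(1) by auto
    then show "(\<psi>\<^sub>2 \<circ> \<psi>\<^sub>1) ` \<Delta> = \<Gamma>" using b(3) by (metis image_comp)
    show "card {y\<in>\<Delta>. (\<psi>\<^sub>2 \<circ> \<psi>\<^sub>1) y = z} = k\<^sub>1 * k\<^sub>2" if "z \<in> \<Gamma>" for z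
    proof -
      have "{y\<in>\<Delta>. (\<psi>\<^sub>2 \<circ> \<psi>\<^sub>1) y = z} = {y\<in>\<Delta>\<^sub>1. \<psi>\<^sub>1 y \<in> {w\<in>\<Delta>\<^sub>2. \<psi>\<^sub>2 w = z}}"
        unfolding \<Delta>_def by auto
      then show ?thesis using fib[of "{w\<in>\<Delta>\<^sub>2. \<psi>\<^sub>2 w = z}"] b(4)[OF that] by auto
    qed
    fix y j assume y: "y \<in> \<Delta>" "j < card \<Gamma>"
    then have "dist ((T ^^ j) y) ((T ^^ j) (\<psi>\<^sub>1 y)) < \<gamma>\<^sub>1" "dist ((T ^^ j) (\<psi>\<^sub>1 y)) ((T ^^ j) (\<psi>\<^sub>2 (\<psi>\<^sub>1 y))) < \<gamma>\<^sub>2"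
      using a(7) b(7) le unfolding \<Delta>_def by auto
    then show "dist ((T ^^ j) y) ((T ^^ j) ((\<psi>\<^sub>2 \<circ> \<psi>\<^sub>1) y)) < \<gamma>\<^sub>1 + \<gamma>\<^sub>2"
      by (metis add_strict_mono comp_apply dist_triangle order.strict_trans1)
  qed (use per in auto)
qed

lemma good_approximation_le_1:
  assumes "good_approximation T \<gamma> \<kappa> \<Gamma> \<Lambda>"
  shows "\<kappa> \<le> 1"
proof -
  have per: "periodic_orbit T \<Gamma>" using assms unfolding good_approximation_def by auto
  have c: "card \<Gamma> > 0" "finite \<Gamma>" using per periodic_orbit_card_pos periodic_orbit_finite by metis+
  obtain \<Delta> where "\<Delta> \<subseteq> \<Gamma>" "\<kappa> * real (card \<Gamma>) \<le> card \<Delta>" using good_approximationE[OF assms] by metis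
  moreover have "card \<Delta> \<le> card \<Gamma>" using card_mono[OF c(2)] calculation by auto
  ultimately have "\<kappa> * real (card \<Gamma>) \<le> 1 * real (card \<Gamma>)" by linarith
  then show ?thesis using c by (simp add: mult_le_cancel_right)
qed

lemma orbit_sequence_card_mono:
  assumes "orbit_sequence T \<Gamma>" "1 \<le> m" "m \<le> n"
  shows "card (\<Gamma> m) \<le> card (\<Gamma> n)"
  using assms(3)
proof (induction n rule: dec_induct)
  case (step n)
  then show ?case using assms unfolding orbit_sequence_def by (meson le_trans)
qed simp

lemma good_approximation_chain:
  assumes orb: "orbit_sequence T \<Gamma>"
    and ga: "\<And>n. n \<ge> 1 \<Longrightarrow> \<kappa> n > 0 \<and> good_approximation T (\<gamma> n) (\<kappa> n) (\<Gamma> (Suc n)) (\<Gamma> n)"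
    and "1 \<le> N" "N < m"
  shows "good_approximation T (\<Sum>n=N..<m. \<gamma> n) (\<Prod>n=N..<m. \<kappa> n) (\<Gamma> m) (\<Gamma> N)"
proof -
  have "Suc N \<le> m" using assms by auto
  then show ?thesis
  proof (induction m rule: dec_induct)
    case base
    then show ?case using ga[of N] assms by simp
  next
    case (step m)
    have "good_approximation T (\<gamma> m + (\<Sum>n=N..<m. \<gamma> n)) (\<kappa> m * (\<Prod>n=N..<m. \<kappa> n)) (\<Gamma> (Suc m)) (\<Gamma> N)"
      using step ga[of m] assms(3) orbit_sequence_card_mono[OF orb, of N m]
      by (intro good_approximation_trans[where \<Gamma>'="\<Gamma> m"]) (auto simp: less_imp_le)
    moreover have "{N..<Suc m} = insert m {N..<m}" using step by auto
    ultimately show ?case by simp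
  qed
qed

text \<open>A product over \<open>{N..<m}\<close> is a quotient of partial products, hence at least
  \<open>P / a (N - 1)\<close>; since \<open>P > 0\<close>, this tends to 1. The locale of limit
  measures below assumes the GIKN condition in exactly this uniform form.\<close>

lemma gikn_sequence_tail:
  assumes "gikn_sequence T \<Gamma>" "\<epsilon> > 0"
  shows "\<exists>N0\<ge>1. \<forall>N\<ge>N0. \<forall>m>N. good_approximation T \<epsilon> (1 - \<epsilon>) (\<Gamma> m) (\<Gamma> N)"
proof -
  from assms(1) obtain \<gamma> \<kappa> P where orb: "orbit_sequence T \<Gamma>"
    and ga: "\<And>n. n \<ge> 1 \<Longrightarrow> \<gamma> n > 0 \<and> \<kappa> n > 0 \<and> good_approximation T (\<gamma> n) (\<kappa> n) (\<Gamma> (Suc n)) (\<Gamma> n)"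
    and sm: "summable (\<lambda>n. \<gamma> (Suc n))" and P: "P > 0" "(\<lambda>N. \<Prod>n=1..N. \<kappa> n) \<longlonglongrightarrow> P"
    unfolding gikn_sequence_def by blast
  define a where "a N = (\<Prod>n=1..N. \<kappa> n)" for N
  have apos: "a N > 0" for N unfolding a_def using ga by (intro prod_pos) auto
  have k1: "\<kappa> n \<le> 1" if "n \<ge> 1" for n using ga[OF that] good_approximation_le_1 by blast
  have "decseq a"
    unfolding decseq_Suc_iff
  proof
    fix n
    have "a (Suc n) = a n * \<kappa> (Suc n)" unfolding a_def by simp
    then show "a (Suc n) \<le> a n" using apos[of n] k1[of "Suc n"] by (simp add: mult_left_le)
  qed
  then have aP: "a N \<ge> P" for N using decseq_ge P(2) unfolding a_def by blast
  have "(\<lambda>N. P / a N) \<longlonglongrightarrow> P / P" using P unfolding a_def by (intro tendsto_intros) auto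
  then have "eventually (\<lambda>N. P / a N > 1 - \<epsilon>) sequentially"
    using P assms by (intro order_tendstoD(1)[where y="P / P"]) auto
  moreover have "eventually (\<lambda>N. (\<Sum>n. \<gamma> (Suc (n + N))) < \<epsilon>) sequentially"
    using suminf_exist_split[OF assms(2) sm] ga unfolding eventually_sequentially
    by (auto simp: suminf_nonneg less_imp_le abs_less_iff)
  ultimately have "eventually (\<lambda>N. P / a N > 1 - \<epsilon> \<and> (\<Sum>n. \<gamma> (Suc (n + N))) < \<epsilon>) sequentially"
    by (rule eventually_conj)
  then obtain N0 where N0: "\<And>N. N \<ge> N0 \<Longrightarrow> P / a N > 1 - \<epsilon> \<and> (\<Sum>n. \<gamma> (Suc (n + N))) < \<epsilon>"
    unfolding eventually_sequentially by blast
  show ?thesis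
  proof (intro exI[of _ "Suc N0"] conjI allI impI)
    fix N m assume N: "N \<ge> Suc N0" "N < m"
    \<comment> \<open>The series is indexed by \<open>Suc n\<close>, so its tail from
      \<open>\<gamma> N\<close> on is the one shifted by \<open>N - 1\<close>.\<close>
    have N1: "N = Suc (N - 1)" "N - 1 \<ge> N0" using N by auto
    have "(\<Sum>n=N..<m. \<gamma> n) = (\<Sum>n<m-N. \<gamma> (Suc (n + (N - 1))))"
      using N by (intro sum.reindex_bij_witness[of _ "\<lambda>n. n + N" "\<lambda>n. n - N"]) auto
    also have "\<dots> \<le> (\<Sum>n. \<gamma> (Suc (n + (N - 1))))"
      using ga sm summable_ignore_initial_segment[OF sm, of "N - 1"]
      by (intro sum_le_suminf) (auto simp: less_imp_le)
    also have "\<dots> < \<epsilon>" using N0[OF N1(2)] by simp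
    finally have 1: "(\<Sum>n=N..<m. \<gamma> n) \<le> \<epsilon>" by simp
    have "{1..m-1} = {1..N-1} \<union> {N..<m}" using N by auto
    then have "a (m - 1) = a (N - 1) * (\<Prod>n=N..<m. \<kappa> n)"
      unfolding a_def by (simp only:) (subst prod.union_disjoint, auto)
    then have "(\<Prod>n=N..<m. \<kappa> n) = a (m - 1) / a (N - 1)" using apos[of "N - 1"] by simp
    also have "\<dots> \<ge> P / a (N - 1)" using aP apos[of "N-1"] by (intro divide_right_mono) (auto simp: less_imp_le)
    finally have 2: "(\<Prod>n=N..<m. \<kappa> n) \<ge> 1 - \<epsilon>" using N0[OF N1(2)] by linarith
    show "good_approximation T \<epsilon> (1 - \<epsilon>) (\<Gamma> m) (\<Gamma> N)"
      using good_approximation_chain[OF orb, of \<kappa> \<gamma> N m] ga N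
      by (intro good_approximation_mono[OF _ 1 2]) auto
  qed auto
qed

section \<open>Weak limits and ergodicity\<close>

lemma borel_probabilityD:
  assumes "borel_probability \<mu>"
  shows "prob_space \<mu>" "sets \<mu> = sets borel" "space \<mu> = UNIV" "measurable \<mu> N = measurable borel N"
    "measurable N \<mu> = measurable N borel"
  using assms unfolding borel_probability_def by (auto dest: sets_eq_imp_space_eq cong: measurable_cong_sets)

section \<open>Testing closed sets by continuous functions\<close>

lemma integrable_continuous_compact:
  fixes \<phi> :: "'a::topological_space \<Rightarrow> real"
  assumes "borel_probability \<mu>" "compact (UNIV::'a set)" "continuous_on UNIV \<phi>"
  shows "integrable \<mu> \<phi>"
proof -
  interpret prob_space \<mu> using assms borel_probabilityD by blast
  have "bounded (range \<phi>)" using assms compact_continuous_image compact_imp_bounded by blast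
  then obtain B where "\<And>x. \<bar>\<phi> x\<bar> \<le> B" unfolding bounded_real by auto
  then show ?thesis using assms
    by (intro integrable_const_bound[where B=B])
      (auto simp: borel_probabilityD[OF assms(1)] borel_measurable_continuous_onI)
qed

text \<open>Continuous functions that decrease to the indicator of a closed set, accessible to weak
  convergence. Since \<open>infdist\<close> to the empty set is 0, they are constantly 1 there,
  which is why the empty set is treated apart.\<close>

definition closed_bump :: "'a::metric_space set \<Rightarrow> nat \<Rightarrow> 'a \<Rightarrow> real" where
  "closed_bump F k x = max 0 (1 - real k * infdist x F)"

lemma closed_bump_continuous: "continuous_on UNIV (closed_bump F k)"
  unfolding closed_bump_def by (intro continuous_intros)

lemma closed_bump_bounds: "0 \<le> closed_bump F k x" "closed_bump F k x \<le> 1"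
  unfolding closed_bump_def by (auto simp: infdist_nonneg)

lemma closed_bump_ge_indicator: "indicator F x \<le> closed_bump F k x"
  unfolding closed_bump_def by (auto simp: indicator_def)

lemma closed_bump_tendsto:
  assumes "closed F" "F \<noteq> {}"
  shows "(\<lambda>k. closed_bump F k x) \<longlonglongrightarrow> indicator F x"
proof (cases "x \<in> F")
  case True
  then show ?thesis unfolding closed_bump_def by simp
next
  case False
  then have d: "infdist x F > 0" using assms
    by (metis in_closed_iff_infdist_zero infdist_nonneg order_le_less)
  obtain K :: nat where K: "1 / infdist x F < real K" using reals_Archimedean2 by blast
  have "closed_bump F k x = 0" if "k \<ge> K" for k
  proof -
    have "1 / infdist x F \<le> real k" using K that by linarith
    then show ?thesis using d unfolding closed_bump_def by (simp add: field_simps)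
  qed
  then have "eventually (\<lambda>k. closed_bump F k x = indicator F x) sequentially"
    using False unfolding eventually_sequentially by auto
  then show ?thesis by (rule tendsto_eventually)
qed

lemma integral_closed_bump_tendsto:
  fixes F :: "'a::metric_space set"
  assumes "borel_probability \<mu>" "closed F" "F \<noteq> {}" "A \<in> sets borel"
  shows "(\<lambda>k. \<integral>x. indicator A x * closed_bump F k x \<partial>\<mu>) \<longlonglongrightarrow> measure \<mu> (A \<inter> F)"
proof -
  interpret prob_space \<mu> using assms borel_probabilityD by blast
  note [simp] = borel_probabilityD[OF assms(1)]
  have m: "closed_bump F k \<in> borel_measurable borel" for k
    by (intro borel_measurable_continuous_onI closed_bump_continuous)
  have F: "F \<in> sets borel" using assms by auto
  have "(\<lambda>k. \<integral>x. indicator A x * closed_bump F k x \<partial>\<mu>) \<longlonglongrightarrow> (\<integral>x. indicator A x * indicator F x \<partial>\<mu>)"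
  proof (rule integral_dominated_convergence[where w="\<lambda>_. 1"])
    show "AE x in \<mu>. (\<lambda>k. indicator A x * closed_bump F k x) \<longlonglongrightarrow> indicator A x * indicator F x"
      using closed_bump_tendsto assms by (intro AE_I2 tendsto_intros) blast+
    show "AE x in \<mu>. norm (indicator A x * closed_bump F k x) \<le> 1" for k
      using closed_bump_bounds[of F k] by (intro AE_I2) (auto simp: indicator_def)
  qed (use m assms F in auto)
  also have "(\<integral>x. indicator A x * indicator F x \<partial>\<mu>) = (\<integral>x. (indicator (A \<inter> F) x :: real) \<partial>\<mu>)"
    by (rule arg_cong[where f="integral\<^sup>L \<mu>"]) (auto simp: fun_eq_iff indicator_def)
  also have "\<dots> = measure \<mu> (A \<inter> F)" using assms F by simp
  finally show ?thesis .
qed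

lemma sigma_sets_closed: "sigma_sets UNIV {F. closed F} = sets borel"
  unfolding borel_eq_closed by (simp add: sets_measure_of)

lemma Int_stable_closed: "Int_stable {F. closed F}"
  unfolding Int_stable_def by auto

lemma borel_probability_eqI:
  fixes \<mu> \<nu> :: "'a::metric_space measure"
  assumes "borel_probability \<mu>" "borel_probability \<nu>"
    and eq: "\<And>\<phi>::'a \<Rightarrow> real. continuous_on UNIV \<phi> \<Longrightarrow> integral\<^sup>L \<mu> \<phi> = integral\<^sup>L \<nu> \<phi>"
  shows "\<mu> = \<nu>"
proof -
  interpret M: prob_space \<mu> using assms borel_probabilityD by blast
  interpret N: prob_space \<nu> using assms borel_probabilityD by blast
  have cl: "measure \<mu> F = measure \<nu> F" if "closed F" for F
  proof (cases "F = {}")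
    case False
    have "(\<lambda>k. integral\<^sup>L \<mu> (closed_bump F k)) \<longlonglongrightarrow> measure \<mu> F"
      "(\<lambda>k. integral\<^sup>L \<nu> (closed_bump F k)) \<longlonglongrightarrow> measure \<nu> F"
      using integral_closed_bump_tendsto[OF _ that False, of _ UNIV] assms by auto
    then show ?thesis unfolding eq[OF closed_bump_continuous] by (rule LIMSEQ_unique)
  qed simp
  show ?thesis
    by (rule measure_eqI_generator_eq[OF Int_stable_closed, where \<Omega>=UNIV and A="\<lambda>_. UNIV"])
      (use cl sigma_sets_closed borel_probabilityD[OF assms(1)] borel_probabilityD[OF assms(2)]
       in \<open>auto simp: M.emeasure_eq_measure N.emeasure_eq_measure\<close>)
qed

text \<open>Closed sets form a generator stable under intersection, so independence from them
  extends to all Borel sets. It will be applied with \<open>B = A\<close>, where it forces the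
  measure of \<open>A\<close> to be its own square.\<close>

lemma measure_Int_eq_mult_borel:
  assumes "borel_probability \<mu>" "A \<in> sets borel" "B \<in> sets borel"
    and cl: "\<And>F. closed F \<Longrightarrow> measure \<mu> (A \<inter> F) = measure \<mu> A * measure \<mu> F"
  shows "measure \<mu> (A \<inter> B) = measure \<mu> A * measure \<mu> B"
proof -
  interpret prob_space \<mu> using assms borel_probabilityD by blast
  note [simp] = borel_probabilityD[OF assms(1)]
  have B: "B \<in> sigma_sets UNIV {F. closed F}" using assms sigma_sets_closed by auto
  have sub: "{F. closed F} \<subseteq> Pow (UNIV::'a set)" by simp
  show ?thesis
  proof (induction rule: sigma_sets_induct_disjoint[OF Int_stable_closed sub B, case_names basic empty compl union])
    case (compl B)
    then have B: "B \<in> sets borel" using sigma_sets_closed by auto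
    have "A \<inter> (UNIV - B) = A - A \<inter> B" by auto
    then have "measure \<mu> (A \<inter> (UNIV - B)) = measure \<mu> A - measure \<mu> (A \<inter> B)"
      using B assms by (simp add: finite_measure_Diff)
    moreover have "measure \<mu> (UNIV - B) = 1 - measure \<mu> B" using B prob_compl[of B] by simp
    ultimately show ?case unfolding compl(2) by (simp only: right_diff_distrib mult_1_right)
  next
    case (union B)
    then have B: "range B \<subseteq> sets borel" using sigma_sets_closed by auto
    have "(\<lambda>i. measure \<mu> (A \<inter> B i)) sums measure \<mu> (\<Union>i. A \<inter> B i)"
      using B assms(2) union(1) by (intro finite_measure_UNION) (fastforce simp: disjoint_family_on_def)+
    moreover have "(\<lambda>i. measure \<mu> A * measure \<mu> (B i)) sums (measure \<mu> A * measure \<mu> (\<Union>i. B i))"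
      using B union(1) by (intro sums_mult finite_measure_UNION) auto
    moreover have "A \<inter> (\<Union>i. B i) = (\<Union>i. A \<inter> B i)" by auto
    ultimately show ?case by (simp only: union(3)) (rule sums_unique2)
  qed (use cl in auto)
qed

text \<open>The closed half of the portmanteau theorem: bumps dominate the indicator along the
  sequence and decrease to it in the limit. Positivity of \<open>c\<close> makes \<open>F\<close>
  nonempty.\<close>

lemma weak_star_limit_closed:
  fixes M :: "nat \<Rightarrow> 'a::metric_space measure"
  assumes lim: "weak_star_limit M \<mu>" and comp: "compact (UNIV::'a set)" and F: "closed F" and "c > 0"
    and ev: "eventually (\<lambda>n. borel_probability (M n) \<and> measure (M n) F \<ge> c) sequentially"
  shows "measure \<mu> F \<ge> c"
proof -
  have \<mu>: "borel_probability \<mu>" using lim unfolding weak_star_limit_def by auto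
  obtain n where "measure (M n) F \<ge> c" using ev unfolding eventually_sequentially by auto
  then have ne: "F \<noteq> {}" using \<open>c > 0\<close> by auto
  have "integral\<^sup>L \<mu> (closed_bump F k) \<ge> c" for k
  proof (rule tendsto_lowerbound)
    show "(\<lambda>n. integral\<^sup>L (M n) (closed_bump F k)) \<longlonglongrightarrow> integral\<^sup>L \<mu> (closed_bump F k)"
      using lim closed_bump_continuous unfolding weak_star_limit_def by auto
    show "eventually (\<lambda>n. c \<le> integral\<^sup>L (M n) (closed_bump F k)) sequentially"
      using ev
    proof eventually_elim
      case (elim n)
      interpret prob_space "M n" using elim borel_probabilityD by blast
      note [simp] = borel_probabilityD[OF elim[THEN conjunct1]]
      have "c \<le> measure (M n) F" using elim by auto
      also have "\<dots> = (\<integral>x. indicator F x \<partial>M n)" using F by simp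
      also have "\<dots> \<le> integral\<^sup>L (M n) (closed_bump F k)"
        using F elim comp closed_bump_continuous closed_bump_ge_indicator
        by (intro integral_mono) (auto simp: borel_closed emeasure_eq_measure intro!: integrable_continuous_compact)
      finally show ?case .
    qed
  qed simp
  moreover have "(\<lambda>k. integral\<^sup>L \<mu> (closed_bump F k)) \<longlonglongrightarrow> measure \<mu> F"
    using integral_closed_bump_tendsto[OF \<mu> F ne, of UNIV] by auto
  ultimately show ?thesis by (intro tendsto_lowerbound) auto
qed

section \<open>Invariant measures\<close>

lemma continuous_on_funpow:
  "continuous_on UNIV (T::'a::topological_space \<Rightarrow> 'a) \<Longrightarrow> continuous_on UNIV (T ^^ n)"
proof (induction n)
  case 0
  then show ?case by (simp add: id_def)
next
  case (Suc n)
  then show ?case unfolding funpow.simps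
    by (intro continuous_on_compose) (auto intro: continuous_on_subset)
qed

definition invariant_measure :: "('a::topological_space \<Rightarrow> 'a) \<Rightarrow> 'a measure \<Rightarrow> bool" where
  "invariant_measure T \<mu> \<longleftrightarrow> borel_probability \<mu> \<and> T \<in> borel_measurable borel \<and> distr \<mu> \<mu> T = \<mu>"

lemma invariant_measure_integral:
  fixes f :: "'a::topological_space \<Rightarrow> real"
  assumes "invariant_measure T \<mu>" "f \<in> borel_measurable borel"
  shows "(\<integral>x. f ((T ^^ n) x) \<partial>\<mu>) = integral\<^sup>L \<mu> f"
proof (induction n)
  case (Suc n)
  have \<mu>: "borel_probability \<mu>" "T \<in> borel_measurable borel" "distr \<mu> \<mu> T = \<mu>"
    using assms unfolding invariant_measure_def by auto
  have Tn: "T ^^ n \<in> borel_measurable borel" using \<mu>(2) by (rule measurable_compose_n)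
  have "(\<integral>x. f ((T ^^ Suc n) x) \<partial>\<mu>) = (\<integral>x. (f \<circ> (T ^^ n)) (T x) \<partial>\<mu>)"
    by (simp add: funpow_swap1)
  also have "\<dots> = (\<integral>x. (f \<circ> (T ^^ n)) x \<partial>distr \<mu> \<mu> T)"
    using \<mu> assms(2) Tn by (subst integral_distr) (auto simp: borel_probabilityD[OF \<mu>(1)])
  finally show ?case using \<mu> Suc by simp
qed simp

lemma invariant_measure_vimage:
  assumes "invariant_measure T \<mu>" "A \<in> sets borel"
  shows "measure \<mu> ((T ^^ n) -` A) = measure \<mu> A"
proof -
  have \<mu>: "borel_probability \<mu>" "T \<in> borel_measurable borel" "distr \<mu> \<mu> T = \<mu>"
    using assms unfolding invariant_measure_def by auto
  note [simp] = borel_probabilityD[OF \<mu>(1)]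
  have Tn: "T ^^ n \<in> borel_measurable borel" using \<mu>(2) by (rule measurable_compose_n)
  have *: "(T ^^ n) -` A \<in> sets borel" using measurable_sets[OF Tn assms(2)] by simp
  have "measure \<mu> ((T ^^ n) -` A) = (\<integral>x. indicator ((T ^^ n) -` A) x \<partial>\<mu>)" using * by simp
  also have "\<dots> = (\<integral>x. indicator A ((T ^^ n) x) \<partial>\<mu>)" by (simp add: indicator_def)
  also have "\<dots> = measure \<mu> A" using invariant_measure_integral[OF assms(1), of "indicator A" n] assms(2) by simp
  finally show ?thesis .
qed

lemma ergodic_measure_iff:
  "ergodic_measure T \<mu> \<longleftrightarrow> invariant_measure T \<mu> \<and>
     (\<forall>A\<in>sets borel. T -` A = A \<longrightarrow> measure \<mu> A = 0 \<or> measure \<mu> A = 1)"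
proof (cases "borel_probability \<mu>")
  case True
  have "T \<in> measurable \<mu> \<mu> \<longleftrightarrow> T \<in> borel_measurable borel"
    by (simp add: borel_probabilityD(4,5)[OF True])
  then show ?thesis
    unfolding ergodic_measure_def invariant_measure_def by (simp add: borel_probabilityD(2)[OF True])
qed (simp add: ergodic_measure_def invariant_measure_def)

section \<open>The limit of a GIKN sequence: invariance, shadowing, ergodicity and support\<close>

locale gikn_limit =
  fixes T :: "'a::metric_space \<Rightarrow> 'a" and \<Gamma> :: "nat \<Rightarrow> 'a set" and \<mu> :: "'a measure"
  assumes compact_UNIV: "compact (UNIV::'a set)"
    and cont_T: "continuous_on UNIV T"
    and orb: "orbit_sequence T \<Gamma>"
    and tail: "\<And>\<epsilon>. \<epsilon> > 0 \<Longrightarrow> \<exists>N0\<ge>1. \<forall>N\<ge>N0. \<forall>m>N. good_approximation T \<epsilon> (1 - \<epsilon>) (\<Gamma> m) (\<Gamma> N)"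
    and lim: "weak_star_limit (\<lambda>n. orbit_measure (\<Gamma> n)) \<mu>"
begin

lemma prob: "borel_probability \<mu>" using lim unfolding weak_star_limit_def by auto

sublocale prob_space \<mu> using prob borel_probabilityD by blast

lemmas mu_simps [simp] = borel_probabilityD(2-5)[OF prob]

lemma per: "n \<ge> 1 \<Longrightarrow> periodic_orbit T (\<Gamma> n)" using orb unfolding orbit_sequence_def by auto

lemma orbit_finite: "n \<ge> 1 \<Longrightarrow> finite (\<Gamma> n)" "n \<ge> 1 \<Longrightarrow> \<Gamma> n \<noteq> {}" "n \<ge> 1 \<Longrightarrow> card (\<Gamma> n) > 0"
  using per periodic_orbit_finite periodic_orbit_card_pos by (fastforce simp: card_gt_0_iff)+

lemma
  assumes "n \<ge> 1"
  shows prob_orbit: "borel_probability (orbit_measure (\<Gamma> n))"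
    and measure_orbit: "A \<in> sets borel \<Longrightarrow> measure (orbit_measure (\<Gamma> n)) A = card (\<Gamma> n \<inter> A) / card (\<Gamma> n)"
    and integral_orbit: "\<phi> \<in> borel_measurable borel \<Longrightarrow>
      integral\<^sup>L (orbit_measure (\<Gamma> n)) (\<phi> :: 'a \<Rightarrow> real) = sum \<phi> (\<Gamma> n) / card (\<Gamma> n)"
  using borel_probability_orbit_measure[of "\<Gamma> n"] measure_orbit_measure[of "\<Gamma> n" A]
    integral_orbit_measure[of "\<Gamma> n" \<phi>] orbit_finite[OF assms] by auto

lemma T_measurable [measurable]: "T \<in> borel_measurable borel"
  using cont_T by (rule borel_measurable_continuous_onI)

lemma Tn_measurable [measurable]: "T ^^ n \<in> borel_measurable borel"
  using T_measurable by (rule measurable_compose_n)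

lemma invariant: "invariant_measure T \<mu>"
proof -
  have "distr \<mu> \<mu> T = \<mu>"
  proof (rule borel_probability_eqI)
    show "borel_probability (distr \<mu> \<mu> T)"
      unfolding borel_probability_def by (auto intro: prob_space_distr)
    fix \<phi> :: "'a \<Rightarrow> real" assume \<phi>: "continuous_on UNIV \<phi>"
    then have \<phi>T: "continuous_on UNIV (\<phi> \<circ> T)"
      using cont_T by (intro continuous_on_compose) (auto intro: continuous_on_subset)
    have m: "\<phi> \<in> borel_measurable borel" "\<phi> \<circ> T \<in> borel_measurable borel"
      using \<phi> \<phi>T by (auto intro: borel_measurable_continuous_onI)
    have "eventually (\<lambda>n. integral\<^sup>L (orbit_measure (\<Gamma> n)) (\<phi> \<circ> T) = integral\<^sup>L (orbit_measure (\<Gamma> n)) \<phi>) sequentially"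
      using eventually_ge_at_top[of "1::nat"]
    proof eventually_elim
      case (elim n)
      have "sum (\<phi> \<circ> T) (\<Gamma> n) = sum \<phi> (\<Gamma> n)"
        using sum.reindex_bij_betw[OF periodic_orbit_bij_betw[OF per[OF elim]], of \<phi>] by simp
      then show ?case using integral_orbit[OF elim] m by simp
    qed
    then have "(\<lambda>n. integral\<^sup>L (orbit_measure (\<Gamma> n)) \<phi>) \<longlonglongrightarrow> integral\<^sup>L \<mu> (\<phi> \<circ> T)"
      using lim \<phi>T unfolding weak_star_limit_def by (blast intro: Lim_transform_eventually)
    moreover have "(\<lambda>n. integral\<^sup>L (orbit_measure (\<Gamma> n)) \<phi>) \<longlonglongrightarrow> integral\<^sup>L \<mu> \<phi>"
      using lim \<phi> unfolding weak_star_limit_def by blast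
    ultimately have "integral\<^sup>L \<mu> (\<phi> \<circ> T) = integral\<^sup>L \<mu> \<phi>" by (rule LIMSEQ_unique)
    then show "integral\<^sup>L (distr \<mu> \<mu> T) \<phi> = integral\<^sup>L \<mu> \<phi>"
      using m by (subst integral_distr) (auto simp: o_def)
  qed (rule prob)
  then show ?thesis unfolding invariant_measure_def using prob by auto
qed

text \<open>The inequality is weak, although good approximations give a strict one: the set is then
  closed and lower bounds for its measure pass to the limit.\<close>

definition shadow :: "nat \<Rightarrow> real \<Rightarrow> 'a set" where
  "shadow N \<epsilon> = {x. \<exists>z\<in>\<Gamma> N. \<forall>j<card (\<Gamma> N). dist ((T ^^ j) x) ((T ^^ j) z) \<le> \<epsilon>}"

lemma closed_shadow: "N \<ge> 1 \<Longrightarrow> closed (shadow N \<epsilon>)"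
proof -
  assume N: "N \<ge> 1"
  have "shadow N \<epsilon> = (\<Union>z\<in>\<Gamma> N. \<Inter>j<card (\<Gamma> N). {x. dist ((T ^^ j) x) ((T ^^ j) z) \<le> \<epsilon>})"
    unfolding shadow_def by auto
  moreover have "closed {x. dist ((T ^^ j) x) ((T ^^ j) z) \<le> \<epsilon>}" for j z
    using continuous_on_funpow[OF cont_T, of j] by (intro closed_Collect_le continuous_intros) auto
  ultimately show ?thesis using orbit_finite(1)[OF N] by (auto intro!: closed_UN closed_INT)
qed

lemma shadow_measure:
  assumes "\<epsilon> > 0"
  shows "eventually (\<lambda>N. N \<ge> 1 \<and> measure \<mu> (shadow N \<epsilon>) \<ge> 1 - \<epsilon>) sequentially"
proof -
  obtain N0 where N0: "N0 \<ge> 1" "\<And>N m. N \<ge> N0 \<Longrightarrow> m > N \<Longrightarrow> good_approximation T \<epsilon> (1 - \<epsilon>) (\<Gamma> m) (\<Gamma> N)"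
    using tail[OF assms] by blast
  have "measure \<mu> (shadow N \<epsilon>) \<ge> 1 - \<epsilon>" if N: "N \<ge> N0" for N
  \<comment> \<open>The portmanteau bound needs a positive constant; otherwise the claim is
    trivial.\<close>
  proof (cases "1 - \<epsilon> > 0")
    case True
    show ?thesis
    proof (rule weak_star_limit_closed[OF lim compact_UNIV _ True])
      show cl: "closed (shadow N \<epsilon>)" using closed_shadow N N0 by auto
      show "eventually (\<lambda>n. borel_probability (orbit_measure (\<Gamma> n)) \<and> 1 - \<epsilon> \<le> measure (orbit_measure (\<Gamma> n)) (shadow N \<epsilon>)) sequentially"
        using eventually_gt_at_top[of N]
      proof eventually_elim
        case (elim m)
        have m1: "m \<ge> 1" using elim N N0 by auto
        obtain \<Delta> \<psi> k where *: "\<Delta> \<subseteq> \<Gamma> m" "(1 - \<epsilon>) * real (card (\<Gamma> m)) \<le> card \<Delta>" "\<psi> ` \<Delta> = \<Gamma> N"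
          "\<And>z. z \<in> \<Gamma> N \<Longrightarrow> card {y\<in>\<Delta>. \<psi> y = z} = k" "card \<Delta> = k * card (\<Gamma> N)" "k > 0"
          "\<And>y j. y \<in> \<Delta> \<Longrightarrow> j < card (\<Gamma> N) \<Longrightarrow> dist ((T ^^ j) y) ((T ^^ j) (\<psi> y)) < \<epsilon>"
          using good_approximationE[OF N0(2)[OF N elim]] by blast
        have "\<Delta> \<subseteq> \<Gamma> m \<inter> shadow N \<epsilon>"
        proof
          fix y assume "y \<in> \<Delta>"
          then show "y \<in> \<Gamma> m \<inter> shadow N \<epsilon>"
            unfolding shadow_def using * by (auto intro!: bexI[of _ "\<psi> y"] less_imp_le)
        qed
        then have "card \<Delta> \<le> card (\<Gamma> m \<inter> shadow N \<epsilon>)"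
          using orbit_finite(1)[OF m1] by (intro card_mono) auto
        then have "(1 - \<epsilon>) * real (card (\<Gamma> m)) \<le> card (\<Gamma> m \<inter> shadow N \<epsilon>)" using *(2) by linarith
        then show ?case
          using prob_orbit[OF m1] orbit_finite(3)[OF m1] measure_orbit[OF m1 borel_closed[OF cl]]
          by (simp add: pos_le_divide_eq)
      qed
    qed
  qed (use measure_nonneg[of \<mu> "shadow N \<epsilon>"] in linarith)
  then show ?thesis using N0(1) unfolding eventually_sequentially by (metis le_trans)
qed

text \<open>All points of \<open>\<Gamma> N\<close> have the same average over a full period, the
  integral against the orbit measure, so the phase of the shadowed point does not matter. Half of
  \<open>e\<close> pays for uniform continuity, half for the weak convergence.\<close>

lemma birkhoff_average_shadow:
  fixes \<phi> :: "'a \<Rightarrow> real"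
  assumes \<phi>: "continuous_on UNIV \<phi>" and e: "e > 0"
  obtains p where "p > 0" "measure \<mu> {x. \<bar>(\<Sum>j<p. \<phi> ((T ^^ j) x)) / p - integral\<^sup>L \<mu> \<phi>\<bar> \<le> e} \<ge> 1 - e"
proof -
  have "uniformly_continuous_on UNIV \<phi>" using \<phi> compact_UNIV compact_uniformly_continuous by blast
  then obtain d where d: "d > 0" "\<And>x y. dist x y < d \<Longrightarrow> dist (\<phi> x) (\<phi> y) < e / 2"
    using e unfolding uniformly_continuous_on_def by (metis UNIV_I half_gt_zero dist_commute)
  define \<epsilon> where "\<epsilon> = min e (d / 2)"
  have \<epsilon>: "\<epsilon> > 0" "\<epsilon> \<le> e" "\<epsilon> < d" using e d unfolding \<epsilon>_def by auto
  have "(\<lambda>n. integral\<^sup>L (orbit_measure (\<Gamma> n)) \<phi>) \<longlonglongrightarrow> integral\<^sup>L \<mu> \<phi>"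
    using lim \<phi> unfolding weak_star_limit_def by blast
  then have "eventually (\<lambda>n. dist (integral\<^sup>L (orbit_measure (\<Gamma> n)) \<phi>) (integral\<^sup>L \<mu> \<phi>) < e / 2) sequentially"
    using e by (intro tendstoD) auto
  then obtain N where N: "dist (integral\<^sup>L (orbit_measure (\<Gamma> N)) \<phi>) (integral\<^sup>L \<mu> \<phi>) < e / 2"
    "N \<ge> 1" "measure \<mu> (shadow N \<epsilon>) \<ge> 1 - \<epsilon>"
    using eventually_conj[OF _ shadow_measure[OF \<epsilon>(1)]] unfolding eventually_sequentially by blast
  define p where "p = card (\<Gamma> N)"
  have p: "p > 0" using orbit_finite(3)[OF N(2)] unfolding p_def .
  have m: "\<phi> \<in> borel_measurable borel" using \<phi> by (rule borel_measurable_continuous_onI)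
  have sub: "shadow N \<epsilon> \<subseteq> {x. \<bar>(\<Sum>j<p. \<phi> ((T ^^ j) x)) / p - integral\<^sup>L \<mu> \<phi>\<bar> \<le> e}"
  proof
    fix x assume "x \<in> shadow N \<epsilon>"
    then obtain z where z: "z \<in> \<Gamma> N" "\<And>j. j < p \<Longrightarrow> dist ((T ^^ j) x) ((T ^^ j) z) \<le> \<epsilon>"
      unfolding shadow_def p_def by auto
    have I: "integral\<^sup>L (orbit_measure (\<Gamma> N)) \<phi> = (\<Sum>j<p. \<phi> ((T ^^ j) z)) / p"
      using integral_orbit[OF N(2) m] sum_periodic_orbit[OF per[OF N(2)] z(1), of \<phi>]
      unfolding p_def by simp
    have "\<bar>(\<Sum>j<p. \<phi> ((T ^^ j) x)) - (\<Sum>j<p. \<phi> ((T ^^ j) z))\<bar> \<le> (\<Sum>j<p. \<bar>\<phi> ((T ^^ j) x) - \<phi> ((T ^^ j) z)\<bar>)"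
      unfolding sum_subtractf[symmetric] by (rule sum_abs)
    also have "\<dots> \<le> (\<Sum>j<p. e / 2)"
      using z d \<epsilon> by (intro sum_mono) (force simp: dist_real_def intro: less_imp_le)
    finally have "\<bar>(\<Sum>j<p. \<phi> ((T ^^ j) x)) / p - (\<Sum>j<p. \<phi> ((T ^^ j) z)) / p\<bar> \<le> e / 2"
      using p by (simp add: diff_divide_distrib[symmetric] field_simps)
    then have "\<bar>(\<Sum>j<p. \<phi> ((T ^^ j) x)) / p - integral\<^sup>L \<mu> \<phi>\<bar> \<le> e"
      using N(1) I unfolding dist_real_def by linarith
    then show "x \<in> {x. \<bar>(\<Sum>j<p. \<phi> ((T ^^ j) x)) / p - integral\<^sup>L \<mu> \<phi>\<bar> \<le> e}" by simp
  qed
  have "{x. \<bar>(\<Sum>j<p. \<phi> ((T ^^ j) x)) / p - integral\<^sup>L \<mu> \<phi>\<bar> \<le> e} \<in> sets borel"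
    using m by measurable
  then have "measure \<mu> (shadow N \<epsilon>) \<le> measure \<mu> {x. \<bar>(\<Sum>j<p. \<phi> ((T ^^ j) x)) / p - integral\<^sup>L \<mu> \<phi>\<bar> \<le> e}"
    using sub by (intro finite_measure_mono) auto
  then show thesis using that[OF p] N(3) \<epsilon> by linarith
qed

text \<open>Since \<open>A\<close> is invariant, \<open>\<phi>\<close> may be replaced by its
  average over \<open>p\<close> steps under the integral over \<open>A\<close>. The average is
  within \<open>e\<close> of the constant \<open>c\<close> off a set of measure \<open>e\<close>,
  where it differs from \<open>c\<close> by at most \<open>2 * B\<close>.\<close>

lemma integral_invariant_set:
  fixes \<phi> :: "'a \<Rightarrow> real"
  assumes \<phi>: "continuous_on UNIV \<phi>" and A: "A \<in> sets borel" "T -` A = A"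
  shows "(\<integral>x. indicator A x * \<phi> x \<partial>\<mu>) = measure \<mu> A * integral\<^sup>L \<mu> \<phi>"
proof -
  define c where "c = integral\<^sup>L \<mu> \<phi>"
  have m: "\<phi> \<in> borel_measurable borel" using \<phi> by (rule borel_measurable_continuous_onI)
  have "bounded (range \<phi>)" using \<phi> compact_UNIV compact_continuous_image compact_imp_bounded by blast
  then obtain B where B: "\<And>x. \<bar>\<phi> x\<bar> \<le> B" unfolding bounded_real by auto
  have B0: "B \<ge> 0" using B[of undefined] by linarith
  have cB: "\<bar>c\<bar> \<le> B" unfolding c_def
    using integrable_continuous_compact[OF prob compact_UNIV \<phi>] B
    by (intro order.trans[OF integral_abs_bound] integral_le_const) auto
  have TA: "indicator A ((T ^^ j) x) = (indicator A x :: real)" for j x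
    by (induction j) (use A(2) in \<open>auto simp: indicator_def\<close>)
  have "\<bar>(\<integral>x. indicator A x * \<phi> x \<partial>\<mu>) - measure \<mu> A * c\<bar> \<le> e * (1 + 2 * B)" if e: "e > 0" for e
  proof -
    obtain p where p: "p > 0" "measure \<mu> {x. \<bar>(\<Sum>j<p. \<phi> ((T ^^ j) x)) / p - c\<bar> \<le> e} \<ge> 1 - e"
      using birkhoff_average_shadow[OF \<phi> e] unfolding c_def by blast
    define G where "G = {x. \<bar>(\<Sum>j<p. \<phi> ((T ^^ j) x)) / p - c\<bar> \<le> e}"
    have G: "G \<in> sets borel" unfolding G_def using m by measurable
    have int: "integrable \<mu> (\<lambda>x. indicator A x * \<phi> ((T ^^ j) x))" for j
      using B m A(1) B0 by (intro integrable_const_bound[where B=B]) (auto simp: indicator_def)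
    have eq: "(\<integral>x. indicator A x * \<phi> ((T ^^ j) x) \<partial>\<mu>) = (\<integral>x. indicator A x * \<phi> x \<partial>\<mu>)" for j
      using invariant_measure_integral[OF invariant, of "\<lambda>x. indicator A x * \<phi> x" j] m A(1) by (simp add: TA)
    have "(\<integral>x. indicator A x * ((\<Sum>j<p. \<phi> ((T ^^ j) x)) / p - c) \<partial>\<mu>)
      = (\<integral>x. (\<Sum>j<p. indicator A x * \<phi> ((T ^^ j) x)) / p - c * indicator A x \<partial>\<mu>)"
      by (simp only: sum_distrib_left[symmetric] right_diff_distrib times_divide_eq_right mult.commute[of c])
    also have "\<dots> = (\<Sum>j<p. (\<integral>x. indicator A x * \<phi> ((T ^^ j) x) \<partial>\<mu>)) / p - c * measure \<mu> A"
    proof -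
      have "integrable \<mu> (\<lambda>x. (\<Sum>j<p. indicator A x * \<phi> ((T ^^ j) x)) / p)"
        using int by (intro integrable_divide_zero Bochner_Integration.integrable_sum) auto
      moreover have "integrable \<mu> (\<lambda>x. c * indicator A x)" using A(1) by (auto simp: emeasure_eq_measure)
      moreover have "(\<integral>x. (\<Sum>j<p. indicator A x * \<phi> ((T ^^ j) x)) / p \<partial>\<mu>)
          = (\<Sum>j<p. (\<integral>x. indicator A x * \<phi> ((T ^^ j) x) \<partial>\<mu>)) / p"
        using int by (simp only: integral_divide_zero) (subst Bochner_Integration.integral_sum, auto)
      moreover have "(\<integral>x. c * indicator A x \<partial>\<mu>) = c * measure \<mu> A" using A(1) by simp
      ultimately show ?thesis by (simp only: Bochner_Integration.integral_diff)
    qed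
    also have "\<dots> = (\<integral>x. indicator A x * \<phi> x \<partial>\<mu>) - measure \<mu> A * c"
      using p by (simp add: eq)
    finally have "\<bar>(\<integral>x. indicator A x * \<phi> x \<partial>\<mu>) - measure \<mu> A * c\<bar>
      = \<bar>\<integral>x. indicator A x * ((\<Sum>j<p. \<phi> ((T ^^ j) x)) / p - c) \<partial>\<mu>\<bar>" by simp
    also have "\<dots> \<le> (\<integral>x. \<bar>indicator A x * ((\<Sum>j<p. \<phi> ((T ^^ j) x)) / p - c)\<bar> \<partial>\<mu>)"
      by (rule integral_abs_bound)
    also have "\<dots> \<le> (\<integral>x. e + 2 * B * indicator (UNIV - G) x \<partial>\<mu>)"
    proof (rule integral_mono')
      show "integrable \<mu> (\<lambda>x. e + 2 * B * indicator (UNIV - G) x)"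
        using G by (auto simp: emeasure_eq_measure)
      fix x
      have "\<bar>\<Sum>j<p. \<phi> ((T ^^ j) x)\<bar> \<le> (\<Sum>j<p. \<bar>\<phi> ((T ^^ j) x)\<bar>)" by (rule sum_abs)
      also have "\<dots> \<le> (\<Sum>j<p. B)" using B by (intro sum_mono) auto
      finally have "\<bar>(\<Sum>j<p. \<phi> ((T ^^ j) x)) / p\<bar> \<le> B" using p by (simp add: field_simps abs_divide)
      then have "\<bar>(\<Sum>j<p. \<phi> ((T ^^ j) x)) / p - c\<bar> \<le> 2 * B" using cB by linarith
      then show "\<bar>indicator A x * ((\<Sum>j<p. \<phi> ((T ^^ j) x)) / p - c)\<bar> \<le> e + 2 * B * indicator (UNIV - G) x"
        using e B0 unfolding G_def by (auto simp: indicator_def)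
      show "0 \<le> e + 2 * B * indicator (UNIV - G) x" using e B0 by (auto simp: indicator_def)
    qed
    also have "\<dots> = e + 2 * B * measure \<mu> (UNIV - G)"
      using G prob_space by (subst Bochner_Integration.integral_add) (auto simp: emeasure_eq_measure)
    also have "\<dots> \<le> e + 2 * B * e"
      using p(2) G prob_compl[of G] B0 unfolding G_def[symmetric] by (intro add_mono mult_left_mono) auto
    finally show ?thesis by (simp add: algebra_simps)
  qed
  note bound = this
  have "\<bar>(\<integral>x. indicator A x * \<phi> x \<partial>\<mu>) - measure \<mu> A * c\<bar> \<le> 0"
  proof (rule field_le_epsilon)
    fix e :: real assume "e > 0"
    then have "e / (1 + 2 * B) > 0" using B0 by simp
    from bound[OF this] show "\<bar>(\<integral>x. indicator A x * \<phi> x \<partial>\<mu>) - measure \<mu> A * c\<bar> \<le> 0 + e"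
      using B0 by simp
  qed
  then show ?thesis unfolding c_def by simp
qed

text \<open>An invariant set is uncorrelated with every continuous function, hence independent of
  every closed set, hence of every Borel set, itself included.\<close>

lemma ergodic: "ergodic_measure T \<mu>"
  unfolding ergodic_measure_iff
proof (intro conjI ballI impI)
  show "invariant_measure T \<mu>" by (rule invariant)
  fix A assume A: "A \<in> sets borel" "T -` A = A"
  have "measure \<mu> (A \<inter> F) = measure \<mu> A * measure \<mu> F" if F: "closed F" for F
  proof (cases "F = {}")
    case False
    have "(\<lambda>k. \<integral>x. indicator A x * closed_bump F k x \<partial>\<mu>) \<longlonglongrightarrow> measure \<mu> (A \<inter> F)"
      by (rule integral_closed_bump_tendsto[OF prob F False A(1)])
    moreover have "(\<lambda>k. measure \<mu> A * integral\<^sup>L \<mu> (closed_bump F k)) \<longlonglongrightarrow> measure \<mu> A * measure \<mu> F"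
      using integral_closed_bump_tendsto[OF prob F False, of UNIV] by (intro tendsto_intros) auto
    ultimately show ?thesis
      using integral_invariant_set[OF closed_bump_continuous A] LIMSEQ_unique by force
  qed simp
  then have "measure \<mu> (A \<inter> A) = measure \<mu> A * measure \<mu> A"
    using measure_Int_eq_mult_borel[OF prob A(1) A(1)] by blast
  then show "measure \<mu> A = 0 \<or> measure \<mu> A = 1" by auto
qed

text \<open>One inclusion holds because each tail closure carries all later orbit measures, hence
  full mass. For the other, constant fibres are decisive: exactly one
  \<open>card (\<Gamma> N)\<close>-th of \<open>\<Delta>\<close> shadows a given point
  \<open>z\<close> of \<open>\<Gamma> N\<close>, so \<open>z\<close> keeps a mass bounded below near
  it along all later orbits.\<close>

lemma support: "measure_support \<mu> = (\<Inter>k\<in>{1..}. closure (\<Union>n\<in>{k..}. \<Gamma> n))"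
proof (intro equalityI subsetI)
  fix x assume x: "x \<in> measure_support \<mu>"
  show "x \<in> (\<Inter>k\<in>{1..}. closure (\<Union>n\<in>{k..}. \<Gamma> n))"
  proof (rule ccontr)
    assume "\<not> ?thesis"
    then obtain k where k: "k \<ge> 1" "x \<notin> closure (\<Union>n\<in>{k..}. \<Gamma> n)" by auto
    define C where "C = closure (\<Union>n\<in>{k..}. \<Gamma> n)"
    have "measure \<mu> C \<ge> 1"
    proof (rule weak_star_limit_closed[OF lim compact_UNIV])
      show C: "closed C" unfolding C_def by simp
      show "eventually (\<lambda>n. borel_probability (orbit_measure (\<Gamma> n)) \<and> 1 \<le> measure (orbit_measure (\<Gamma> n)) C) sequentially"
        using eventually_ge_at_top[of k]
      proof eventually_elim
        case (elim n)
        then have n: "n \<ge> 1" using k by auto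
        have "\<Gamma> n \<subseteq> C" unfolding C_def using elim closure_subset by fastforce
        then have "\<Gamma> n \<inter> C = \<Gamma> n" by auto
        then show ?case
          using prob_orbit[OF n] orbit_finite(3)[OF n] measure_orbit[OF n borel_closed[OF C]] by simp
      qed
    qed simp
    then have "measure \<mu> (- C) = 0"
      using prob_compl[of C] prob_le_1[of C] unfolding C_def by (simp add: Compl_eq_Diff_UNIV)
    then have "emeasure \<mu> (- C) = 0" by (simp add: emeasure_eq_measure)
    moreover have "open (- C)" "x \<in> - C" using k unfolding C_def by auto
    ultimately show False using x unfolding measure_support_def by auto
  qed
next
  fix x assume x: "x \<in> (\<Inter>k\<in>{1..}. closure (\<Union>n\<in>{k..}. \<Gamma> n))"
  show "x \<in> measure_support \<mu>"
    unfolding measure_support_def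
  proof (intro CollectI allI impI)
    fix U assume U: "open U \<and> x \<in> U"
    then obtain r where r: "r > 0" "ball x r \<subseteq> U" using open_contains_ball by blast
    \<comment> \<open>The bound \<open>1/2\<close> keeps the mass \<open>c\<close> positive;
      \<open>r / 2\<close> leaves room for the distance from \<open>z\<close> to
      \<open>x\<close>.\<close>
    define \<epsilon> where "\<epsilon> = min (1/2) (r / 2)"
    have \<epsilon>: "\<epsilon> > 0" "\<epsilon> \<le> 1/2" "\<epsilon> \<le> r / 2" using r unfolding \<epsilon>_def by auto
    obtain N0 where N0: "N0 \<ge> 1" "\<And>N m. N \<ge> N0 \<Longrightarrow> m > N \<Longrightarrow> good_approximation T \<epsilon> (1 - \<epsilon>) (\<Gamma> m) (\<Gamma> N)"
      using tail[OF \<epsilon>(1)] by blast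
    have "x \<in> closure (\<Union>n\<in>{N0..}. \<Gamma> n)" using x N0 by auto
    then obtain z N where z: "N \<ge> N0" "z \<in> \<Gamma> N" "dist z x < r / 2"
      unfolding closure_approachable using r(1) by (auto dest!: spec[of _ "r/2"])
    have N: "N \<ge> 1" using z N0 by auto
    define c where "c = (1 - \<epsilon>) / card (\<Gamma> N)"
    have c: "c > 0" unfolding c_def using orbit_finite(3)[OF N] \<epsilon> by simp
    have "measure \<mu> (cball z \<epsilon>) \<ge> c"
    proof (rule weak_star_limit_closed[OF lim compact_UNIV _ c])
      show "eventually (\<lambda>n. borel_probability (orbit_measure (\<Gamma> n)) \<and> c \<le> measure (orbit_measure (\<Gamma> n)) (cball z \<epsilon>)) sequentially"
        using eventually_gt_at_top[of N]
      proof eventually_elim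
        case (elim m)
        have m1: "m \<ge> 1" using elim N by auto
        obtain \<Delta> \<psi> k where *: "\<Delta> \<subseteq> \<Gamma> m" "(1 - \<epsilon>) * real (card (\<Gamma> m)) \<le> card \<Delta>" "\<psi> ` \<Delta> = \<Gamma> N"
          "\<And>z. z \<in> \<Gamma> N \<Longrightarrow> card {y\<in>\<Delta>. \<psi> y = z} = k" "card \<Delta> = k * card (\<Gamma> N)" "k > 0"
          "\<And>y j. y \<in> \<Delta> \<Longrightarrow> j < card (\<Gamma> N) \<Longrightarrow> dist ((T ^^ j) y) ((T ^^ j) (\<psi> y)) < \<epsilon>"
          using good_approximationE[OF N0(2)[OF z(1) elim]] by blast
        have "{y\<in>\<Delta>. \<psi> y = z} \<subseteq> \<Gamma> m \<inter> cball z \<epsilon>"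
          using *(1) *(7)[of _ 0] orbit_finite(3)[OF N] by (auto simp: dist_commute less_imp_le)
        then have "k \<le> card (\<Gamma> m \<inter> cball z \<epsilon>)"
          unfolding *(4)[OF z(2), symmetric] using orbit_finite(1)[OF m1] by (intro card_mono) auto
        then have "real k * card (\<Gamma> N) \<le> real (card (\<Gamma> m \<inter> cball z \<epsilon>)) * card (\<Gamma> N)"
          by (intro mult_right_mono) auto
        then have "(1 - \<epsilon>) * real (card (\<Gamma> m)) \<le> real (card (\<Gamma> m \<inter> cball z \<epsilon>)) * card (\<Gamma> N)"
          using *(2) unfolding *(5) by simp
        then have "c \<le> card (\<Gamma> m \<inter> cball z \<epsilon>) / card (\<Gamma> m)"
          unfolding c_def using orbit_finite(3)[OF N] orbit_finite(3)[OF m1] by (simp add: field_simps)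
        then show ?case
          using prob_orbit[OF m1] measure_orbit[OF m1, of "cball z \<epsilon>"] by simp
      qed
    qed simp
    moreover have "cball z \<epsilon> \<subseteq> U"
    proof
      fix y assume "y \<in> cball z \<epsilon>"
      then have "dist x y < r" using z(3) \<epsilon> dist_triangle[of x y z] by (auto simp: dist_commute)
      then show "y \<in> U" using r by auto
    qed
    then have "measure \<mu> (cball z \<epsilon>) \<le> measure \<mu> U" using U by (intro finite_measure_mono) auto
    ultimately show "emeasure \<mu> U > 0" using c by (simp add: emeasure_eq_measure)
  qed
qed

end

section \<open>Near periodicity, partitions and edit distance\<close>

text \<open>The threshold \<open>6 * \<gamma>\<close> is three sides of length
  \<open>2 * \<gamma>\<close>. Once a single bad pair \<open>(t\<^sub>1, s\<^sub>1)\<close> is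
  fixed, every bad pair sits at the phase \<open>t\<^sub>1\<close> or
  \<open>t\<^sub>1 + s\<^sub>1\<close>, which yields the two points.\<close>

lemma two_exceptional_points:
  fixes z :: "nat \<Rightarrow> 'a::metric_space"
  assumes p: "p > 0" and per: "\<And>i. z (i + p) = z i" and \<gamma>: "\<gamma> \<ge> 0"
  defines "bad t s \<equiv> (\<forall>t'. t' mod p \<noteq> t mod p \<longrightarrow> dist (z t') (z (t' + s)) \<le> 2 * \<gamma>) \<and> dist (z t) (z (t + s)) > 6 * \<gamma>"
  shows "\<exists>a b. \<forall>t s. bad t s \<longrightarrow> z t \<in> {a, b}"
proof -
  have perm: "z (i + k * p) = z i" for i k
  proof (induction k)
    case (Suc k)
    have "z (i + Suc k * p) = z ((i + k * p) + p)" by (simp add: algebra_simps)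
    then show ?case using per Suc by simp
  qed simp
  have zmod: "z i = z (i mod p)" for i
    using perm[of "i mod p" "i div p"] by simp
  \<comment> \<open>A shift by a multiple of \<open>p\<close> moves nothing and cannot jump. So a
    bad shift leaves no phase fixed, and the side starting at \<open>t\<^sub>1 + s\<^sub>2\<close>
    avoids the exceptional phase of the first shift.\<close>
  have s0: "(t' + s) mod p \<noteq> t' mod p" if "bad t s" for t s t'
  proof
    assume "(t' + s) mod p = t' mod p"
    then have "p dvd s" by (simp add: mod_eq_dvd_iff_nat)
    then have "z (t + s) = z t" using perm by (auto elim!: dvdE simp: mult.commute)
    then show False using that \<gamma> unfolding bad_def by simp
  qed
  \<comment> \<open>The shifts by \<open>s\<^sub>1\<close> and \<open>s\<^sub>2\<close> commute, so a large jump of the first at \<open>t\<^sub>1\<close> forces a large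
    jump along one of the other three sides of the parallelogram.\<close>
  have key: "t\<^sub>2 mod p = t\<^sub>1 mod p \<or> t\<^sub>2 mod p = (t\<^sub>1 + s\<^sub>1) mod p" if b: "bad t\<^sub>1 s\<^sub>1" "bad t\<^sub>2 s\<^sub>2" for t\<^sub>1 s\<^sub>1 t\<^sub>2 s\<^sub>2
  proof (rule ccontr)
    assume n: "\<not> ?thesis"
    have 1: "dist (z (t\<^sub>1 + s\<^sub>1)) (z (t\<^sub>1 + s\<^sub>1 + s\<^sub>2)) \<le> 2 * \<gamma>" using b(2) n unfolding bad_def by metis
    have 2: "dist (z (t\<^sub>1 + s\<^sub>2)) (z (t\<^sub>1 + s\<^sub>2 + s\<^sub>1)) \<le> 2 * \<gamma>"
      using b(1) s0[OF b(2), of t\<^sub>1] unfolding bad_def by metis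
    have 3: "dist (z t\<^sub>1) (z (t\<^sub>1 + s\<^sub>2)) \<le> 2 * \<gamma>" using b(2) n unfolding bad_def by metis
    have "t\<^sub>1 + s\<^sub>2 + s\<^sub>1 = t\<^sub>1 + s\<^sub>1 + s\<^sub>2" by simp
    then have "dist (z (t\<^sub>1 + s\<^sub>2)) (z (t\<^sub>1 + s\<^sub>1 + s\<^sub>2)) \<le> 2 * \<gamma>" using 2 by metis
    then have "dist (z t\<^sub>1) (z (t\<^sub>1 + s\<^sub>1)) \<le> 6 * \<gamma>"
      using 1 3 dist_triangle[of "z t\<^sub>1" "z (t\<^sub>1 + s\<^sub>1)" "z (t\<^sub>1 + s\<^sub>2)"]
        dist_triangle2[of "z (t\<^sub>1 + s\<^sub>2)" "z (t\<^sub>1 + s\<^sub>1)" "z (t\<^sub>1 + s\<^sub>1 + s\<^sub>2)"] by linarith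
    then show False using b(1) unfolding bad_def by auto
  qed
  show ?thesis
  proof (cases "\<exists>t s. bad t s")
    case True
    then obtain t\<^sub>1 s\<^sub>1 where b: "bad t\<^sub>1 s\<^sub>1" by blast
    have "z t \<in> {z t\<^sub>1, z (t\<^sub>1 + s\<^sub>1)}" if "bad t s" for t s
      using key[OF b that] zmod[of t] zmod[of "t\<^sub>1"] zmod[of "t\<^sub>1 + s\<^sub>1"] by auto
    then show ?thesis by blast
  qed blast
qed

text \<open>The windows of \<open>x\<close> and of \<open>T x\<close> overlap in
  \<open>p - 1\<close> times, at which two orbit points are both within \<open>\<gamma>\<close> of
  the same point. So one shift \<open>s\<close> of the orbit moves every phase except that of
  \<open>x\<close>, called \<open>i\<close>, by at most \<open>2 * \<gamma>\<close>. If
  \<open>z i\<close> is not exceptional, it moves by at most \<open>6 * \<gamma>\<close> too, and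
  \<open>T ^^ p\<close> moves \<open>x\<close> by at most
  \<open>\<gamma> + 6 * \<gamma> + \<gamma>\<close>. If it is, then \<open>x\<close> lies within
  \<open>\<gamma>\<close> of \<open>a\<close> or \<open>b\<close>.\<close>

lemma shadowing_imp_nearly_periodic:
  fixes T :: "'a::metric_space \<Rightarrow> 'a"
  assumes orb: "periodic_orbit T \<Gamma>" and \<gamma>: "\<gamma> \<ge> 0"
  defines "V \<equiv> {x. \<exists>z\<in>\<Gamma>. \<forall>j<card \<Gamma>. dist ((T ^^ j) x) ((T ^^ j) z) \<le> \<gamma>}"
  shows "\<exists>a b. \<forall>x. x \<in> V \<and> T x \<in> V \<and> dist a x > \<gamma> \<and> dist b x > \<gamma> \<longrightarrow> dist x ((T ^^ card \<Gamma>) x) \<le> 8 * \<gamma>"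
proof -
  define p where "p = card \<Gamma>"
  have p: "p > 0" using periodic_orbit_card_pos[OF orb] unfolding p_def .
  then obtain z0 where z0: "z0 \<in> \<Gamma>" unfolding p_def by (auto simp: card_gt_0_iff)
  define z where "z i = (T ^^ i) z0" for i
  have per: "z (i + p) = z i" for i
    unfolding z_def using periodic_orbit_period[OF orb z0] by (simp add: funpow_add p_def)
  have Tz: "(T ^^ j) (z i) = z (i + j)" for i j
    unfolding z_def by (metis add.commute comp_apply funpow_add)
  have \<Gamma>z: "\<exists>i<p. w = z i" if "w \<in> \<Gamma>" for w
    using that periodic_orbit_eq[OF orb z0] unfolding z_def p_def by auto
  have V: "\<exists>i<p. \<forall>j<p. dist ((T ^^ j) x) (z (i + j)) \<le> \<gamma>" if "x \<in> V" for x
  proof -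
    obtain w where w: "w \<in> \<Gamma>" "\<forall>j<p. dist ((T ^^ j) x) ((T ^^ j) w) \<le> \<gamma>"
      using \<open>x \<in> V\<close> unfolding V_def p_def by blast
    then obtain i where "i < p" "w = z i" using \<Gamma>z by blast
    then show ?thesis using w Tz by auto
  qed
  have permod: "z i = z j" if "i mod p = j mod p" for i j
  proof -
    have "z i = z (i mod p)" for i
    proof -
      have "z (i mod p + k * p) = z (i mod p)" for k
      proof (induction k)
        case (Suc k)
        have "z (i mod p + Suc k * p) = z ((i mod p + k * p) + p)" by (simp add: algebra_simps)
        then show ?case using per Suc by simp
      qed simp
      from this[of "i div p"] show ?thesis by simp
    qed
    then show ?thesis using that by metis
  qed
  obtain a b where ab: "\<forall>t s. (\<forall>t'. t' mod p \<noteq> t mod p \<longrightarrow> dist (z t') (z (t' + s)) \<le> 2 * \<gamma>) \<and>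
      dist (z t) (z (t + s)) > 6 * \<gamma> \<longrightarrow> z t \<in> {a, b}"
    using two_exceptional_points[of p z, OF p per \<gamma>] by (elim exE)
  have "dist x ((T ^^ p) x) \<le> 8 * \<gamma>"
    if x: "x \<in> V" "T x \<in> V" "dist a x > \<gamma>" "dist b x > \<gamma>" for x
  proof -
    obtain i where i: "i < p" "\<And>j. j < p \<Longrightarrow> dist ((T ^^ j) x) (z (i + j)) \<le> \<gamma>" using V[OF x(1)] by blast
    obtain i' where i': "i' < p" "\<And>j. j < p \<Longrightarrow> dist ((T ^^ j) (T x)) (z (i' + j)) \<le> \<gamma>" using V[OF x(2)] by blast
    \<comment> \<open>Modulo \<open>p\<close> this is \<open>i' - 1 - i\<close>; two periods are
      added so that the subtraction is not truncated.\<close>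
    define s where "s = i' + 2 * p - 1 - i"
    have s: "i + s = i' + (p - 1) + p" using i i' p unfolding s_def by linarith
    have end': "z (i + s) = z (i' + (p - 1))" unfolding s by (rule per)
    have close: "dist (z t') (z (t' + s)) \<le> 2 * \<gamma>" if t': "t' mod p \<noteq> i mod p" for t'
    proof -
      \<comment> \<open>The time at which the window of \<open>x\<close> passes the phase of
        \<open>t'\<close>. It is nonzero because \<open>t'\<close> is not the starting phase, so the
        window of \<open>T x\<close> covers it at its own time \<open>\<tau> - 1\<close>.\<close>
      define \<tau> where "\<tau> = (t' + (p - i)) mod p"
      have "(i + \<tau>) mod p = (i + (t' + (p - i))) mod p" unfolding \<tau>_def by presburger
      also have "i + (t' + (p - i)) = t' + p" using i by simp
      finally have it: "(i + \<tau>) mod p = t' mod p" by simp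
      have \<tau>: "\<tau> < p" "\<tau> \<noteq> 0" using p it t' unfolding \<tau>_def[symmetric] by (auto simp: \<tau>_def intro: gr0I)
      have "(t' + s) mod p = (i + \<tau> + s) mod p" using it by (metis mod_add_left_eq)
      also have "i + \<tau> + s = (i' + (\<tau> - 1)) + p + p" using s \<tau> p by linarith
      finally have "z (t' + s) = z (i' + (\<tau> - 1))" by (intro permod) simp
      moreover have "z t' = z (i + \<tau>)" using it by (intro permod) simp
      moreover have "dist ((T ^^ \<tau>) x) (z (i + \<tau>)) \<le> \<gamma>" using i \<tau> by simp
      moreover have "dist ((T ^^ \<tau>) x) (z (i' + (\<tau> - 1))) \<le> \<gamma>"
      proof -
        have "(T ^^ (\<tau> - 1)) (T x) = (T ^^ \<tau>) x" using \<tau> by (metis Suc_pred' funpow_Suc_right gr0I o_apply)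
        then show ?thesis using i'(2)[of "\<tau> - 1"] \<tau> by simp
      qed
      ultimately show ?thesis
        using dist_triangle3[of "z (i + \<tau>)" "z (i' + (\<tau> - 1))" "(T ^^ \<tau>) x"] by simp
    qed
    have xi: "dist x (z i) \<le> \<gamma>" using i(2)[of 0] p by simp
    have "z i \<notin> {a, b}" using x(3,4) xi by (auto simp: dist_commute)
    then have "dist (z i) (z (i + s)) \<le> 6 * \<gamma>" using ab[THEN spec, THEN spec, of i s] close by (metis not_le)
    moreover have "dist ((T ^^ p) x) (z (i + s)) \<le> \<gamma>"
    proof -
      have "(T ^^ (p - 1)) (T x) = (T ^^ p) x" using p by (metis Suc_pred' funpow_Suc_right o_apply)
      then show ?thesis unfolding end' using i'(2)[of "p - 1"] p by simp
    qed
    ultimately show ?thesis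
      using xi dist_triangle[of x "(T ^^ p) x" "z i"] dist_triangle2[of "z i" "(T ^^ p) x" "z (i + s)"] by linarith
  qed
  then show ?thesis unfolding p_def by blast
qed

text \<open>Inner and outer approximations are carried together because complementation exchanges
  them. The induction starts from closed sets, which are intersections of their metric
  neighbourhoods.\<close>

lemma closed_inner_regular:
  fixes \<mu> :: "'a::metric_space measure"
  assumes \<mu>: "borel_probability \<mu>" and "B \<in> sets borel" "e > 0"
  shows "\<exists>F U. closed F \<and> open U \<and> F \<subseteq> B \<and> B \<subseteq> U \<and> measure \<mu> (U - F) < e"
proof -
  interpret prob_space \<mu> using \<mu> borel_probabilityD by blast
  note [simp] = borel_probabilityD[OF \<mu>]
  have B: "B \<in> sigma_sets UNIV {F. closed F}" using assms sigma_sets_closed by auto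
  have sub: "{F. closed F} \<subseteq> Pow (UNIV::'a set)" by simp
  show ?thesis using \<open>e > 0\<close>
  proof (induction arbitrary: e rule: sigma_sets_induct_disjoint[OF Int_stable_closed sub B, case_names basic empty compl union])
    case (basic F)
    then have F: "closed F" by simp
    show ?case
    proof (cases "F = {}")
      case False
      define U where "U n = {x. infdist x F < 1 / real (Suc n)}" for n
      have op: "open (U n)" for n unfolding U_def by (intro open_Collect_less continuous_intros)
      have "(\<Inter>n. U n) = F"
      proof (intro equalityI subsetI)
        fix x assume "x \<in> (\<Inter>n. U n)"
        then have "infdist x F \<le> 1 / real (Suc n)" for n unfolding U_def by (auto intro: less_imp_le)
        then have "infdist x F \<le> 0"
          by (intro tendsto_lowerbound[OF LIMSEQ_inverse_real_of_nat]) (auto simp: inverse_eq_divide)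
        then show "x \<in> F" using F False by (metis in_closed_iff_infdist_zero infdist_nonneg order_antisym)
      qed (auto simp: U_def)
      moreover have "decseq U"
        unfolding decseq_def U_def
      proof (intro allI impI subsetI CollectI)
        fix m n :: nat and x assume "m \<le> n" "x \<in> {x. infdist x F < 1 / real (Suc n)}"
        moreover have "1 / real (Suc n) \<le> 1 / real (Suc m)" using \<open>m \<le> n\<close> by (intro divide_left_mono) auto
        ultimately show "infdist x F < 1 / real (Suc m)" by simp
      qed
      then have "(\<lambda>n. measure \<mu> (U n)) \<longlonglongrightarrow> measure \<mu> (\<Inter>n. U n)"
        using op by (intro finite_Lim_measure_decseq) auto
      ultimately have "eventually (\<lambda>n. measure \<mu> (U n) < measure \<mu> F + e) sequentially"
        using basic by (intro order_tendstoD(2)[where y="measure \<mu> F"]) auto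
      then obtain n where "measure \<mu> (U n) < measure \<mu> F + e" unfolding eventually_sequentially by auto
      moreover have "F \<subseteq> U n" unfolding U_def by auto
      ultimately show ?thesis using F op[of n]
        by (intro exI[of _ F] exI[of _ "U n"]) (auto simp: finite_measure_Diff)
    qed (use basic in \<open>auto intro!: exI[of _ "{}"]\<close>)
  next
    case empty
    then show ?case by (auto intro!: exI[of _ "{}"])
  next
    case (compl B)
    obtain F U where FU: "closed F" "open U" "F \<subseteq> B" "B \<subseteq> U" "measure \<mu> (U - F) < e"
      using compl(2)[OF compl(3)] by blast
    have "(- F) - (- U) = U - F" by auto
    then show ?case using FU by (intro exI[of _ "- U"] exI[of _ "- F"]) auto
  next
    case (union B)
    have Bm: "range B \<subseteq> sets borel" using union(2) sigma_sets_closed by auto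
    \<comment> \<open>Half of \<open>e\<close> is spent on the gaps \<open>U n - F n\<close>, the
      other half on cutting the union of the \<open>F n\<close> down to a finite one, which is
      closed.\<close>
    define \<epsilon> where "\<epsilon> n = (e / 2) * (1 / 2) ^ Suc n" for n
    have "\<epsilon> n > 0" for n unfolding \<epsilon>_def using union by simp
    then have "\<forall>n. \<exists>F U. closed F \<and> open U \<and> F \<subseteq> B n \<and> B n \<subseteq> U \<and> measure \<mu> (U - F) < \<epsilon> n" using union(3) by blast
    then obtain F U where FU: "\<And>n. closed (F n)" "\<And>n. open (U n)" "\<And>n. F n \<subseteq> B n" "\<And>n. B n \<subseteq> U n"
      "\<And>n. measure \<mu> (U n - F n) < \<epsilon> n" by metis
    have sums: "\<epsilon> sums (e / 2)" unfolding \<epsilon>_def using sums_mult[OF power_half_series, of "e / 2"] by simp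
    have 1: "measure \<mu> ((\<Union>n. U n) - (\<Union>n. F n)) \<le> e / 2"
    proof -
      have sm: "summable (\<lambda>n. measure \<mu> (U n - F n))"
        by (rule summable_comparison_test[OF _ sums_summable[OF sums]]) (auto intro: less_imp_le FU(5))
      have "measure \<mu> ((\<Union>n. U n) - (\<Union>n. F n)) \<le> measure \<mu> (\<Union>n. U n - F n)"
        using FU(1,2) by (intro finite_measure_mono) auto
      also have "\<dots> \<le> (\<Sum>n. measure \<mu> (U n - F n))"
        using FU(1,2) sm by (intro finite_measure_subadditive_countably) auto
      also have "\<dots> \<le> (\<Sum>n. \<epsilon> n)" using FU(5) sm sums_summable[OF sums] by (intro suminf_le) (auto intro: less_imp_le)
      finally show ?thesis using sums_unique[OF sums] by simp
    qed
    define C where "C N = (\<Union>n\<le>N. F n)" for N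
    have Cc: "closed (C N)" for N unfolding C_def using FU(1) by (intro closed_UN) auto
    have "(\<lambda>N. measure \<mu> (C N)) \<longlonglongrightarrow> measure \<mu> (\<Union>N. C N)"
      using Cc by (intro finite_Lim_measure_incseq) (auto simp: incseq_def C_def intro: order_trans)
    then have "eventually (\<lambda>N. measure \<mu> (\<Union>N. C N) - e / 2 < measure \<mu> (C N)) sequentially"
      using union by (intro order_tendstoD(1)[where y="measure \<mu> (\<Union>N. C N)"]) auto
    then obtain N where N: "measure \<mu> (\<Union>N. C N) - e / 2 < measure \<mu> (C N)" unfolding eventually_sequentially by auto
    have UC: "(\<Union>N. C N) = (\<Union>n. F n)" unfolding C_def by auto
    have m: "(\<Union>n. F n) \<in> sets borel" "(\<Union>n. U n) \<in> sets borel" using FU(1,2) by auto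
    have CF: "C N \<subseteq> (\<Union>n. F n)" "(\<Union>n. F n) \<subseteq> (\<Union>n. U n)" unfolding C_def using FU(3,4) by blast+
    have "measure \<mu> ((\<Union>n. U n) - C N) < e"
      using 1 N m CF Cc[of N] unfolding UC by (subst (asm) finite_measure_Diff) (auto simp: finite_measure_Diff)
    moreover have "open (\<Union>n. U n)" using FU(2) by auto
    moreover have "C N \<subseteq> (\<Union>n. B n)" "(\<Union>n. B n) \<subseteq> (\<Union>n. U n)" unfolding C_def using FU(3,4) by blast+
    ultimately show ?case using Cc[of N] by (intro exI[of _ "C N"] exI[of _ "\<Union>n. U n"]) simp
  qed
qed

section \<open>Cells, cores and names of a finite partition\<close>

definition cell :: "'a set set \<Rightarrow> 'a \<Rightarrow> 'a set" where
  "cell P x = (THE A. A \<in> P \<and> x \<in> A)"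

lemma cell_eqI:
  assumes "partition_on UNIV P" "A \<in> P" "x \<in> A"
  shows "cell P x = A"
  unfolding cell_def using assms partition_onD2[OF assms(1)]
  by (intro the_equality) (auto simp: disjoint_def)

lemma cell_in:
  assumes "partition_on UNIV P"
  shows "cell P x \<in> P" "x \<in> cell P x"
proof -
  obtain A where "A \<in> P" "x \<in> A" using partition_onD1[OF assms] by auto
  then show "cell P x \<in> P" "x \<in> cell P x" using cell_eqI[OF assms] by auto
qed

text \<open>Lusin's theorem for the map \<open>cell P\<close>: disjoint compact cores of the cells
  are at positive distance, so nearby points of the union of the cores lie in the same cell.\<close>

lemma partition_core:
  fixes \<mu> :: "'a::metric_space measure"
  assumes \<mu>: "borel_probability \<mu>" and comp: "compact (UNIV::'a set)"
    and P: "finite_borel_partition P" and \<eta>: "\<eta> > 0"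
  obtains K \<delta> where "closed K" "\<delta> > 0" "measure \<mu> K \<ge> 1 - \<eta>"
    "\<And>x y. x \<in> K \<Longrightarrow> y \<in> K \<Longrightarrow> dist x y < \<delta> \<Longrightarrow> cell P x = cell P y"
proof -
  interpret prob_space \<mu> using \<mu> borel_probabilityD by blast
  note [simp] = borel_probabilityD[OF \<mu>]
  have fin: "finite P" and part: "partition_on UNIV P" and bor: "P \<subseteq> sets borel"
    using P unfolding finite_borel_partition_def by auto
  have "P \<noteq> {}" using partition_onD1[OF part] by auto
  then have c: "card P > 0" using fin by (simp add: card_gt_0_iff)
  have "\<forall>A\<in>P. \<exists>F. closed F \<and> F \<subseteq> A \<and> measure \<mu> (A - F) < \<eta> / card P"
  proof
    fix A assume "A \<in> P"
    then have A: "A \<in> sets borel" using bor by auto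
    obtain F U where FU: "closed F" "open U" "F \<subseteq> A" "A \<subseteq> U" "measure \<mu> (U - F) < \<eta> / card P"
      using closed_inner_regular[OF \<mu> A, of "\<eta> / card P"] \<eta> c by auto
    have "measure \<mu> (A - F) \<le> measure \<mu> (U - F)" using FU A by (intro finite_measure_mono) auto
    then show "\<exists>F. closed F \<and> F \<subseteq> A \<and> measure \<mu> (A - F) < \<eta> / card P" using FU by force
  qed
  then obtain F where F: "\<And>A. A \<in> P \<Longrightarrow> closed (F A)" "\<And>A. A \<in> P \<Longrightarrow> F A \<subseteq> A"
    "\<And>A. A \<in> P \<Longrightarrow> measure \<mu> (A - F A) < \<eta> / card P" by metis
  define K where "K = (\<Union>A\<in>P. F A)"
  have K: "closed K" unfolding K_def using fin F(1) by (intro closed_UN) auto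
  have "measure \<mu> (UNIV - K) \<le> measure \<mu> (\<Union>A\<in>P. A - F A)"
  proof (rule finite_measure_mono)
    show "UNIV - K \<subseteq> (\<Union>A\<in>P. A - F A)" unfolding K_def using partition_onD1[OF part] by blast
    show "(\<Union>A\<in>P. A - F A) \<in> sets \<mu>" using fin bor F(1) by (intro sets.finite_UN) auto
  qed
  also have "\<dots> \<le> (\<Sum>A\<in>P. measure \<mu> (A - F A))"
    using fin bor F(1) by (intro finite_measure_subadditive_finite) auto
  also have "\<dots> \<le> (\<Sum>A\<in>P. \<eta> / card P)" using F(3) by (intro sum_mono) (auto intro: less_imp_le)
  also have "\<dots> = \<eta>" using c by simp
  finally have mK: "measure \<mu> K \<ge> 1 - \<eta>" using prob_compl[of K] K by simp
  \<comment> \<open>Phrasing separation as a property of all small \<open>d\<close> replaces the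
    minimum over finitely many pairs of cells.\<close>
  have "\<forall>A\<in>P. \<forall>B\<in>P. eventually (\<lambda>d::real. \<forall>x\<in>F A. \<forall>y\<in>F B. dist x y < d \<longrightarrow> A = B) (at_right 0)"
  proof (intro ballI)
    fix A B assume AB: "A \<in> P" "B \<in> P"
    show "eventually (\<lambda>d::real. \<forall>x\<in>F A. \<forall>y\<in>F B. dist x y < d \<longrightarrow> A = B) (at_right 0)"
    proof (cases "A = B")
      case False
      then have "A \<inter> B = {}" using AB partition_onD2[OF part] by (auto simp: disjoint_def)
      then have disj: "F A \<inter> F B = {}" using F(2) AB by blast
      have "compact (F A)" using comp F(1)[OF AB(1)] compact_Int_closed by fastforce
      have "\<exists>d>0. \<forall>x\<in>F A. \<forall>y\<in>F B. d \<le> dist x y"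
      proof (cases "F A = {} \<or> F B = {}")
        case False
        have "continuous_on (F A) (\<lambda>x. infdist x (F B))" by (intro continuous_intros)
        then have "\<exists>x\<in>F A. \<forall>y\<in>F A. infdist x (F B) \<le> infdist y (F B)"
          using continuous_attains_inf \<open>compact (F A)\<close> False by blast
        then obtain x0 where x0: "x0 \<in> F A" "\<And>x. x \<in> F A \<Longrightarrow> infdist x0 (F B) \<le> infdist x (F B)"
          by blast
        have "infdist x0 (F B) > 0"
          using F(1)[OF AB(2)] False x0(1) disj
          by (metis IntI empty_iff in_closed_iff_infdist_zero infdist_nonneg order_le_less)
        then show ?thesis using x0(2) infdist_le by (meson order_trans)
      qed (auto intro: exI[of _ 1])
      then obtain d where d: "d > 0" "\<forall>x\<in>F A. \<forall>y\<in>F B. d \<le> dist x y" by blast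
      show ?thesis unfolding eventually_at_right_field using d by (intro exI[of _ d]) fastforce
    qed simp
  qed
  then have "eventually (\<lambda>d::real. \<forall>A\<in>P. \<forall>B\<in>P. \<forall>x\<in>F A. \<forall>y\<in>F B. dist x y < d \<longrightarrow> A = B) (at_right 0)"
    using fin by (simp add: eventually_ball_finite_distrib)
  then obtain b where b: "b > 0" "\<And>d. 0 < d \<Longrightarrow> d < b \<Longrightarrow> \<forall>A\<in>P. \<forall>B\<in>P. \<forall>x\<in>F A. \<forall>y\<in>F B. dist x y < d \<longrightarrow> A = B"
    unfolding eventually_at_right_field by auto
  have cellb: "cell P x = cell P y" if xy: "x \<in> K" "y \<in> K" "dist x y < b / 2" for x y
  proof -
    obtain A B where AB: "A \<in> P" "x \<in> F A" "B \<in> P" "y \<in> F B" using xy unfolding K_def by auto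
    then have "A = B" using b(2)[of "b / 2"] b(1) xy(3) by auto
    moreover have "cell P x = A" "cell P y = B" using AB F(2) by (auto intro!: cell_eqI[OF part])
    ultimately show ?thesis by simp
  qed
  show thesis
  proof (rule that[OF K _ mK])
    show "b / 2 > 0" using b(1) by simp
  qed (rule cellb)
qed

definition name_word :: "('a \<Rightarrow> 'a) \<Rightarrow> 'a set set \<Rightarrow> nat \<Rightarrow> 'a \<Rightarrow> 'a set list" where
  "name_word T P n x = map (\<lambda>j. cell P ((T ^^ j) x)) [0..<n]"

lemma cylinder_eq_name_word:
  assumes "partition_on UNIV P" "set w \<subseteq> P"
  shows "cylinder T w = {x. name_word T P (length w) x = w}"
proof -
  have *: "(T ^^ j) x \<in> w ! j \<longleftrightarrow> cell P ((T ^^ j) x) = w ! j" if "j < length w" for x j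
    using cell_in(2)[OF assms(1), of "(T ^^ j) x"] cell_eqI[OF assms(1), of "w ! j"] assms(2) nth_mem[OF that]
    by (metis subsetD)
  show ?thesis
    unfolding cylinder_def name_word_def list_eq_iff_nth_eq using * by auto
qed

lemma partition_words_eq:
  assumes "partition_on UNIV P"
  shows "partition_words T P n = range (name_word T P n)"
proof (intro equalityI subsetI)
  fix w assume "w \<in> partition_words T P n"
  then have w: "length w = n" "set w \<subseteq> P" "cylinder T w \<noteq> {}" unfolding partition_words_def by auto
  then obtain x where "name_word T P n x = w" using cylinder_eq_name_word[OF assms, of w T] by auto
  then show "w \<in> range (name_word T P n)" by blast
next
  fix w assume "w \<in> range (name_word T P n)"
  then obtain x where x: "w = name_word T P n x" by auto
  then have "length w = n" "set w \<subseteq> P" using cell_in[OF assms] unfolding name_word_def by auto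
  then show "w \<in> partition_words T P n"
    unfolding partition_words_def using cylinder_eq_name_word[OF assms, of w T] x by auto
qed

lemma finite_partition_words:
  assumes "finite P"
  shows "finite (partition_words T P n)"
  by (rule finite_subset[OF _ finite_lists_length_eq[OF assms, of n]]) (auto simp: partition_words_def)

lemma cylinder_borel:
  assumes "P \<subseteq> sets borel" "set w \<subseteq> P" "T \<in> borel_measurable borel"
  shows "cylinder T w \<in> sets borel"
proof -
  have "(T ^^ j) -` (w ! j) \<in> sets borel" if "j < length w" for j
  proof -
    have "w ! j \<in> sets borel" using nth_mem[OF that] assms(1,2) by blast
    then show ?thesis using measurable_sets[OF measurable_compose_n[OF assms(3), of j], of "w ! j"] by simp
  qed
  then show ?thesis unfolding cylinder_def by (cases "length w = 0") auto
qed

text \<open>A match of shifted words: \<open>C\<close> is a set of common clock times, with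
  \<open>u\<close> started at time \<open>a\<close> and \<open>w\<close> at time \<open>a'\<close>.
  Listing \<open>C\<close> in increasing order gives both index sequences.\<close>

lemma fbar_le:
  assumes len: "length u = n" "length w = n" and n: "n > 0" and fin: "finite C"
    and C: "\<And>b. b \<in> C \<Longrightarrow> a \<le> b \<and> a' \<le> b \<and> b - a < n \<and> b - a' < n \<and> u ! (b - a) = w ! (b - a')"
  shows "fbar u w \<le> 1 - card C / n"
proof -
  define L where "L = {l::nat. \<exists>i j :: nat \<Rightarrow> nat. strict_mono_on {..<l} i \<and> strict_mono_on {..<l} j \<and>
                     (\<forall>s<l. i s < length u \<and> j s < length w \<and> u ! i s = w ! j s)}"
  have "l \<le> n" if "l \<in> L" for l
  proof -
    obtain i :: "nat \<Rightarrow> nat" where i: "strict_mono_on {..<l} i" "\<forall>s<l. i s < n"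
      using \<open>l \<in> L\<close> len unfolding L_def by auto
    have "card (i ` {..<l}) = l" using strict_mono_on_imp_inj_on[OF i(1)] by (simp add: card_image)
    moreover have "card (i ` {..<l}) \<le> card {..<n}" using i(2) by (intro card_mono) auto
    ultimately show ?thesis by simp
  qed
  then have finL: "finite L" by (meson finite_nat_set_iff_bounded_le)
  define c where "c s = sorted_list_of_set C ! s" for s
  have cC: "c s \<in> C" if "s < card C" for s
    using nth_mem[of s "sorted_list_of_set C"] that fin unfolding c_def by simp
  have mono: "c s < c t" if "s < t" "t < card C" for s t
    using sorted_wrt_nth_less[OF strict_sorted_list_of_set, of s t C] that fin unfolding c_def by simp
  have "card C \<in> L" unfolding L_def
  proof (intro CollectI exI conjI allI impI)
    show "strict_mono_on {..<card C} (\<lambda>s. c s - a)" "strict_mono_on {..<card C} (\<lambda>s. c s - a')"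
      using mono cC C by (auto intro!: strict_mono_onI diff_less_mono)
    fix s assume "s < card C"
    then show "c s - a < length u" "c s - a' < length w" "u ! (c s - a) = w ! (c s - a')"
      using C[OF cC] len by auto
  qed
  then have "card C \<le> Max L" using finL by simp
  moreover have "fbar u w = 1 - real (Max L) / n" unfolding fbar_def L_def len by simp
  ultimately show ?thesis using n by (simp add: divide_right_mono)
qed

text \<open>Otherwise heavy balls of radius tending to 0 exist; their centres accumulate at some
  \<open>l\<close>, and every ball around \<open>l\<close> has mass at least \<open>e\<close>, so
  \<open>l\<close> is an atom.\<close>

lemma uniformly_small_balls:
  fixes \<mu> :: "'a::metric_space measure"
  assumes \<mu>: "borel_probability \<mu>" and comp: "compact (UNIV::'a set)"
    and na: "\<And>a. measure \<mu> {a} = 0" and e: "e > 0"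
  shows "\<exists>r>0. \<forall>a. measure \<mu> (cball a r) < e"
proof (rule ccontr)
  interpret prob_space \<mu> using \<mu> borel_probabilityD by blast
  note [simp] = borel_probabilityD[OF \<mu>]
  assume "\<not> ?thesis"
  then have "\<exists>a. measure \<mu> (cball a r) \<ge> e" if "r > 0" for r using \<open>r > 0\<close> by (meson not_less)
  then have "\<forall>n. \<exists>a. measure \<mu> (cball a (1 / real (Suc n))) \<ge> e" by simp
  then obtain a where a: "\<And>n. measure \<mu> (cball (a n) (1 / real (Suc n))) \<ge> e" by metis
  obtain l r where lr: "strict_mono r" "(a \<circ> r) \<longlonglongrightarrow> l"
    using comp unfolding compact_def by blast
  have "measure \<mu> (cball l (1 / real (Suc k))) \<ge> e" for k
  proof -
    \<comment> \<open>Half the target radius: one half for the distance of the centres, one for the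
      radius of the small ball.\<close>
    define d where "d = 1 / (2 * real (Suc k))"
    have d: "d > 0" unfolding d_def by simp
    have "eventually (\<lambda>n. dist ((a \<circ> r) n) l < d) sequentially" using lr(2) d by (rule tendstoD)
    moreover have "eventually (\<lambda>n. n \<ge> 2 * Suc k) sequentially" by (rule eventually_ge_at_top)
    ultimately obtain n where n: "dist (a (r n)) l < d" "n \<ge> 2 * Suc k"
      using eventually_conj unfolding eventually_sequentially by (metis comp_apply nle_le)
    have "Suc (r n) \<ge> 2 * Suc k" using n(2) seq_suble[OF lr(1), of n] by linarith
    then have "real (Suc (r n)) \<ge> 2 * real (Suc k)" by linarith
    then have "1 / real (Suc (r n)) \<le> d" unfolding d_def by (intro divide_left_mono) auto
    moreover have "d + d = 1 / real (Suc k)" unfolding d_def by (simp add: field_simps)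
    ultimately have "cball (a (r n)) (1 / real (Suc (r n))) \<subseteq> cball l (1 / real (Suc k))"
    proof (intro subsetI)
      fix y assume h: "1 / real (Suc (r n)) \<le> d" "d + d = 1 / real (Suc k)" "y \<in> cball (a (r n)) (1 / real (Suc (r n)))"
      then have "dist l y \<le> d + d" using n(1) dist_triangle[of l y "a (r n)"] by (simp add: dist_commute)
      then show "y \<in> cball l (1 / real (Suc k))" using h(2) by simp
    qed
    then have "measure \<mu> (cball (a (r n)) (1 / real (Suc (r n)))) \<le> measure \<mu> (cball l (1 / real (Suc k)))"
      by (intro finite_measure_mono) auto
    then show ?thesis using a[of "r n"] by linarith
  qed
  moreover have "(\<lambda>k. measure \<mu> (cball l (1 / real (Suc k)))) \<longlonglongrightarrow> measure \<mu> (\<Inter>k. cball l (1 / real (Suc k)))"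
  proof (rule finite_Lim_measure_decseq)
    show "decseq (\<lambda>k. cball l (1 / real (Suc k)))"
      unfolding decseq_def by (auto intro!: subset_cball divide_left_mono)
  qed auto
  ultimately have "measure \<mu> (\<Inter>k. cball l (1 / real (Suc k))) \<ge> e" by (intro tendsto_lowerbound) auto
  moreover have "(\<Inter>k. cball l (1 / real (Suc k))) = {l}"
  proof (intro equalityI subsetI)
    fix x assume "x \<in> (\<Inter>k. cball l (1 / real (Suc k)))"
    then have "dist l x \<le> 1 / real (Suc k)" for k by auto
    then have "dist l x \<le> 0" by (intro tendsto_lowerbound[OF LIMSEQ_inverse_real_of_nat]) (auto simp: inverse_eq_divide)
    then show "x \<in> {l}" by simp
  qed auto
  ultimately show False using na[of l] e by simp
qed

text \<open>Markov's inequality for the number of visits to \<open>G\<close>, whose mean is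
  \<open>n * measure M G\<close> by invariance.\<close>

lemma
  fixes M :: "'a::topological_space measure"
  assumes inv: "invariant_measure T M" and G: "G \<in> sets borel" and c: "c > 0" and n: "n > 0"
  shows measure_visits_le: "measure M {x. real (card {j\<in>{..<n}. (T ^^ j) x \<in> G}) > c * real n} \<le> measure M G / c"
    and visits_borel: "{x. real (card {j\<in>{..<n}. (T ^^ j) x \<in> G}) > c * real n} \<in> sets borel"
proof -
  have bp: "borel_probability M" and T: "T \<in> borel_measurable borel"
    using inv unfolding invariant_measure_def by auto
  interpret prob_space M using borel_probabilityD(1)[OF bp] .
  note [simp] = borel_probabilityD(2-)[OF bp]
  have Tj [measurable]: "T ^^ j \<in> borel_measurable borel" for j using T by (rule measurable_compose_n)
  note G [measurable]
  have Tjm: "T ^^ j \<in> borel_measurable M" for j by simp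
  define f where "f x = (\<Sum>j<n. indicator G ((T ^^ j) x) :: real)" for x
  have f: "real (card {j\<in>{..<n}. (T ^^ j) x \<in> G}) = f x" for x
    unfolding f_def by (simp add: indicator_def if_distrib sum.If_cases Int_def)
  have fm: "f \<in> borel_measurable borel" unfolding f_def by measurable
  have int1: "integrable M (\<lambda>x. indicator G ((T ^^ j) x) :: real)" for j
    by (intro integrable_const_bound[where B=1]) (auto simp: indicator_def)
  have int: "integrable M f" unfolding f_def using int1 by (intro Bochner_Integration.integrable_sum)
  have "integral\<^sup>L M f = (\<Sum>j<n. \<integral>x. indicator G ((T ^^ j) x) \<partial>M)"
    unfolding f_def using int1 by (intro Bochner_Integration.integral_sum)
  also have "\<dots> = (\<Sum>j<n. measure M G)"
    using invariant_measure_integral[OF inv, of "indicator G"] G by (intro sum.cong) auto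
  finally have I: "integral\<^sup>L M f = n * measure M G" by simp
  show "{x. real (card {j\<in>{..<n}. (T ^^ j) x \<in> G}) > c * real n} \<in> sets borel"
    unfolding f using fm by measurable
  have "measure M {x. f x > c * n} \<le> measure M {x\<in>space M. f x \<ge> c * n}"
    using fm by (intro finite_measure_mono) auto
  also have "\<dots> \<le> integral\<^sup>L M f / (c * n)"
    using int c n by (intro integral_Markov_inequality_measure[where A="{}"]) (auto simp: f_def[symmetric] intro!: AE_I2, auto simp: f_def intro: sum_nonneg)
  also have "\<dots> = measure M G / c" unfolding I using n by simp
  finally show "measure M {x. real (card {j\<in>{..<n}. (T ^^ j) x \<in> G}) > c * real n} \<le> measure M G / c" unfolding f .
qed

section \<open>Coherence over many periods and the loosely Kronecker property\<close>

context gikn_limit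
begin

text \<open>Four exceptional sets of measure at most \<open>\<theta>\<close> each: the complement of
  the shadowing set, that of its preimage, and two balls. The centres of the balls depend on
  \<open>N\<close>; the uniform bound on small balls lets \<open>r\<close> be chosen before
  \<open>N\<close>.\<close>

lemma nearly_periodic_measure:
  assumes na: "\<And>a. measure \<mu> {a} = 0" and \<theta>: "\<theta> > 0"
  shows "\<exists>r>0. \<forall>\<gamma>. 0 < \<gamma> \<and> \<gamma> \<le> r \<longrightarrow>
    eventually (\<lambda>N. N \<ge> 1 \<and> measure \<mu> (shadow N \<gamma>) \<ge> 1 - \<theta> \<and>
      measure \<mu> {x. dist x ((T ^^ card (\<Gamma> N)) x) \<le> 8 * \<gamma>} \<ge> 1 - 4 * \<theta>) sequentially"
proof -
  obtain r0 where r0: "r0 > 0" "\<And>a. measure \<mu> (cball a r0) < \<theta>"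
    using uniformly_small_balls[OF prob compact_UNIV na \<theta>] by blast
  show ?thesis
  proof (intro exI[of _ "min r0 \<theta>"] conjI allI impI)
    show "min r0 \<theta> > 0" using r0 \<theta> by simp
    fix \<gamma> assume \<gamma>: "0 < \<gamma> \<and> \<gamma> \<le> min r0 \<theta>"
    show "eventually (\<lambda>N. N \<ge> 1 \<and> measure \<mu> (shadow N \<gamma>) \<ge> 1 - \<theta> \<and>
      measure \<mu> {x. dist x ((T ^^ card (\<Gamma> N)) x) \<le> 8 * \<gamma>} \<ge> 1 - 4 * \<theta>) sequentially"
      using shadow_measure[OF \<gamma>[THEN conjunct1]]
    proof eventually_elim
      case (elim N)
      define p where "p = card (\<Gamma> N)"
      define V where "V = shadow N \<gamma>"
      define D where "D = {x. dist x ((T ^^ p) x) \<le> 8 * \<gamma>}"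
      have V: "closed V" unfolding V_def using closed_shadow elim by auto
      have D: "closed D" unfolding D_def
        using continuous_on_funpow[OF cont_T, of p] by (intro closed_Collect_le continuous_intros) auto
      obtain a b where ab: "\<forall>x. x \<in> V \<and> T x \<in> V \<and> dist a x > \<gamma> \<and> dist b x > \<gamma> \<longrightarrow> dist x ((T ^^ p) x) \<le> 8 * \<gamma>"
        using shadowing_imp_nearly_periodic[OF per, of N \<gamma>] elim \<gamma> unfolding V_def p_def shadow_def by auto
      have TV: "T -` V \<in> sets borel" using measurable_sets[OF T_measurable borel_closed[OF V]] by simp
      have "UNIV - D \<subseteq> (UNIV - V) \<union> (UNIV - T -` V) \<union> cball a \<gamma> \<union> cball b \<gamma>"
        using ab unfolding D_def by (auto simp: not_le)
      then have "measure \<mu> (UNIV - D) \<le> measure \<mu> ((UNIV - V) \<union> (UNIV - T -` V) \<union> cball a \<gamma> \<union> cball b \<gamma>)"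
        using V TV D by (intro finite_measure_mono) auto
      also have "\<dots> \<le> measure \<mu> (UNIV - V) + measure \<mu> (UNIV - T -` V) + measure \<mu> (cball a \<gamma>) + measure \<mu> (cball b \<gamma>)"
        using V TV
        by (intro order.trans[OF measure_Un_le] add_right_mono) auto
      finally have 1: "measure \<mu> (UNIV - D) \<le> measure \<mu> (UNIV - V) + measure \<mu> (UNIV - T -` V) + measure \<mu> (cball a \<gamma>) + measure \<mu> (cball b \<gamma>)" .
      have mV: "measure \<mu> V \<ge> 1 - \<theta>" using elim \<gamma> unfolding V_def by auto
      have "measure \<mu> (T -` V) = measure \<mu> V"
        using invariant_measure_vimage[OF invariant borel_closed[OF V], of 1] by simp
      moreover have "measure \<mu> (cball c \<gamma>) < \<theta>" for c
      proof -
        have "measure \<mu> (cball c \<gamma>) \<le> measure \<mu> (cball c r0)" using \<gamma> by (intro finite_measure_mono) auto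
        then show ?thesis using r0(2)[of c] by simp
      qed
      ultimately have "measure \<mu> (UNIV - D) \<le> 4 * \<theta>"
      proof -
        assume h: "measure \<mu> (T -` V) = measure \<mu> V" "\<And>c. measure \<mu> (cball c \<gamma>) < \<theta>"
        have "measure \<mu> (UNIV - V) \<le> \<theta>" using prob_compl[of V] mV V by simp
        moreover have "measure \<mu> (UNIV - T -` V) \<le> \<theta>" using prob_compl[of "T -` V"] mV TV h by simp
        ultimately show ?thesis using 1 h(2)[of a] h(2)[of b] by linarith
      qed
      then have "measure \<mu> D \<ge> 1 - 4 * \<theta>" using prob_compl[of D] D by simp
      then show ?case using elim mV unfolding V_def D_def p_def by simp
    qed
  qed
qed

lemma loosely_kronecker_words:
  assumes na: "\<And>a. measure \<mu> {a} = 0" and P: "finite_borel_partition P" and \<epsilon>: "\<epsilon> > 0"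
  shows "\<exists>n>0. \<exists>W\<subseteq>partition_words T P n. measure \<mu> (\<Union>w\<in>W. cylinder T w) > 1 - \<epsilon> \<and>
           (\<forall>u\<in>W. \<forall>w\<in>W. fbar u w < \<epsilon>)"
proof -
  have fin: "finite P" and part: "partition_on UNIV P" and bor: "P \<subseteq> sets borel"
    using P unfolding finite_borel_partition_def by auto
  \<comment> \<open>Two words of length \<open>M * p\<close> are aligned after a phase shift of less
    than \<open>p\<close>, which loses the proportion \<open>1 / M\<close> of the letters.\<close>
  obtain M :: nat where M: "2 / \<epsilon> < real M" using reals_Archimedean2 by blast
  then have M0: "M > 0" using \<epsilon> by (metis divide_pos_pos gr0I of_nat_0 order_less_asym zero_less_numeral)
  have M1: "1 / real M < \<epsilon> / 2" using M M0 \<epsilon> by (simp add: field_simps)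
  \<comment> \<open>The tolerated frequency of bad times. A bad time spoils at most \<open>M\<close>
    times of its residue class modulo \<open>p\<close>, so two words lose together at most
    \<open>2 * M * \<eta> \<le> \<epsilon> / 4\<close>.\<close>
  define \<eta> where "\<eta> = min 1 (\<epsilon> / (8 * real M))"
  have \<eta>: "\<eta> > 0" "\<eta> \<le> 1" "2 * M * \<eta> \<le> \<epsilon> / 4"
  proof -
    show "\<eta> > 0" "\<eta> \<le> 1" unfolding \<eta>_def using \<epsilon> M0 by auto
    have "2 * M * \<eta> \<le> 2 * M * (\<epsilon> / (8 * real M))" unfolding \<eta>_def by (intro mult_left_mono) auto
    also have "\<dots> = \<epsilon> / 4" using M0 by simp
    finally show "2 * M * \<eta> \<le> \<epsilon> / 4" .
  qed
  \<comment> \<open>The bad set has measure at most \<open>5 * \<theta>\<close>: four from failed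
    near returns, one from the complement of \<open>K\<close>. Markov's inequality divides this by
    \<open>\<eta>\<close>.\<close>
  define \<theta> where "\<theta> = \<eta> * \<epsilon> / 16"
  have \<theta>: "\<theta> > 0" "5 * \<theta> / \<eta> < \<epsilon> / 2" "\<theta> < \<epsilon> / 2"
  proof -
    show "\<theta> > 0" "5 * \<theta> / \<eta> < \<epsilon> / 2" unfolding \<theta>_def using \<eta> \<epsilon> by auto
    have "\<eta> * \<epsilon> \<le> 1 * \<epsilon>" using \<eta> \<epsilon> by (intro mult_right_mono) auto
    then show "\<theta> < \<epsilon> / 2" unfolding \<theta>_def using \<epsilon> by linarith
  qed
  obtain K \<delta> where K: "closed K" "\<delta> > 0" "measure \<mu> K \<ge> 1 - \<theta>"
    "\<And>x y. x \<in> K \<Longrightarrow> y \<in> K \<Longrightarrow> dist x y < \<delta> \<Longrightarrow> cell P x = cell P y"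
    using partition_core[OF prob compact_UNIV P \<theta>(1)] by metis
  obtain r where r: "r > 0" "\<And>\<gamma>. 0 < \<gamma> \<and> \<gamma> \<le> r \<Longrightarrow>
    eventually (\<lambda>N. N \<ge> 1 \<and> measure \<mu> (shadow N \<gamma>) \<ge> 1 - \<theta> \<and>
      measure \<mu> {x. dist x ((T ^^ card (\<Gamma> N)) x) \<le> 8 * \<gamma>} \<ge> 1 - 4 * \<theta>) sequentially"
    using nearly_periodic_measure[OF na \<theta>(1)] by blast
  \<comment> \<open>Fewer than \<open>M\<close> near returns cost at most
    \<open>8 * M * \<gamma>\<close> and the shadowing costs \<open>\<gamma>\<close>. The factor 2
    accounts for comparing two points through the orbit.\<close>
  define \<gamma> where "\<gamma> = min r (\<delta> / (4 * (1 + 8 * real M)))"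
  have \<gamma>: "0 < \<gamma>" "\<gamma> \<le> r" "2 * ((1 + 8 * real M) * \<gamma>) < \<delta>"
  proof -
    show "0 < \<gamma>" "\<gamma> \<le> r" unfolding \<gamma>_def using r K by auto
    have "(1 + 8 * real M) * \<gamma> \<le> (1 + 8 * real M) * (\<delta> / (4 * (1 + 8 * real M)))"
      unfolding \<gamma>_def by (intro mult_left_mono) auto
    also have "\<dots> = \<delta> / 4" using K by (simp add: field_simps)
    finally show "2 * ((1 + 8 * real M) * \<gamma>) < \<delta>" using K by linarith
  qed
  obtain N where N: "N \<ge> 1" "measure \<mu> (shadow N \<gamma>) \<ge> 1 - \<theta>"
      "measure \<mu> {x. dist x ((T ^^ card (\<Gamma> N)) x) \<le> 8 * \<gamma>} \<ge> 1 - 4 * \<theta>"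
    using r(2)[of \<gamma>] \<gamma> unfolding eventually_sequentially by auto
  define p where "p = card (\<Gamma> N)"
  have p: "p > 0" unfolding p_def using orbit_finite(3)[OF N(1)] .
  define n where "n = M * p"
  have n: "n > 0" unfolding n_def using M0 p by simp
  define D where "D = {x. dist x ((T ^^ p) x) \<le> 8 * \<gamma>}"
  have D: "closed D" unfolding D_def
    using continuous_on_funpow[OF cont_T, of p] by (intro closed_Collect_le continuous_intros) auto
  define G where "G = UNIV - (D \<inter> K)"
  have G: "G \<in> sets borel" unfolding G_def using D K by auto
  have mG: "measure \<mu> G \<le> 5 * \<theta>"
  proof -
    have "measure \<mu> ((UNIV - D) \<union> (UNIV - K)) \<le> measure \<mu> (UNIV - D) + measure \<mu> (UNIV - K)"
      using D K by (intro measure_Un_le) auto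
    moreover have "G = (UNIV - D) \<union> (UNIV - K)" unfolding G_def by auto
    moreover have "measure \<mu> (UNIV - D) \<le> 4 * \<theta>"
      using N(3) prob_compl[of D] D unfolding D_def p_def by simp
    moreover have "measure \<mu> (UNIV - K) \<le> \<theta>" using K(1,3) prob_compl[of K] by simp
    ultimately show ?thesis by simp
  qed
  define B where "B x = {j\<in>{..<n}. (T ^^ j) x \<in> G}" for x
  define Z where "Z = {x. real (card (B x)) > \<eta> * n}"
  have Z: "Z \<in> sets borel" "measure \<mu> Z \<le> measure \<mu> G / \<eta>"
    unfolding Z_def B_def
    by (rule visits_borel[OF invariant G \<eta>(1) n], rule measure_visits_le[OF invariant G \<eta>(1) n])
  define Y where "Y = shadow N \<gamma> - Z"
  have Vb: "shadow N \<gamma> \<in> sets borel" using closed_shadow[OF N(1)] by auto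
  have "measure \<mu> G / \<eta> \<le> 5 * \<theta> / \<eta>" using mG \<eta> by (intro divide_right_mono) auto
  then have "measure \<mu> Z < \<epsilon> / 2" using Z \<theta> by linarith
  moreover have "measure \<mu> (shadow N \<gamma>) \<le> measure \<mu> Y + measure \<mu> Z"
  proof -
    have "measure \<mu> (shadow N \<gamma>) \<le> measure \<mu> (Y \<union> Z)"
      unfolding Y_def using Vb Z by (intro finite_measure_mono) auto
    also have "\<dots> \<le> measure \<mu> Y + measure \<mu> Z"
      unfolding Y_def using Vb Z by (intro measure_Un_le) auto
    finally show ?thesis .
  qed
  ultimately have mY: "measure \<mu> Y > 1 - \<epsilon>" using N(2) \<theta>(3) by linarith
  obtain z0 where z0: "z0 \<in> \<Gamma> N" using orbit_finite(2)[OF N(1)] by auto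
  define z where "z i = (T ^^ i) z0" for i
  have zmod: "z (i + (j mod p)) = z (i + j)" for i j
  proof -
    have "z (i + k mod p) = z (i + k)" for i k
    proof -
      have "(T ^^ (k mod p)) z0 = (T ^^ k) z0"
        using periodic_orbit_period[OF per[OF N(1)] z0] by (intro funpow_mod_eq) (simp add: p_def)
      then show ?thesis unfolding z_def by (simp add: funpow_add)
    qed
    then show ?thesis .
  qed
  \<comment> \<open>times from which the orbit can be compared with the first period of the word\<close>
  define J where "J x = {j\<in>{..<n}. \<forall>b\<in>B x. \<not> (b \<le> j \<and> p dvd j - b)}" for x
  \<comment> \<open>Each bad time \<open>b\<close> rules out only \<open>b, b + p, b + 2 * p\<close>
    and so on, at most \<open>M\<close> times below \<open>n = M * p\<close>.\<close>
  have Jcard: "real (card (J x)) \<ge> n - M * (\<eta> * n)" if "x \<in> Y" for x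
  proof -
    have finB: "finite (B x)" unfolding B_def by simp
    have "{..<n} - J x \<subseteq> (\<lambda>(b, i). b + i * p) ` (B x \<times> {..<M})"
    proof
      fix j assume "j \<in> {..<n} - J x"
      then obtain b where b: "j < n" "b \<in> B x" "b \<le> j" "p dvd j - b" unfolding J_def by auto
      then obtain i where i: "j - b = i * p" by (metis dvd_def mult.commute)
      then have "i * p < M * p" using b(1) unfolding n_def by linarith
      then have "i < M" by simp
      moreover have "j = b + i * p" using i b by linarith
      ultimately show "j \<in> (\<lambda>(b, i). b + i * p) ` (B x \<times> {..<M})" using b(2) by force
    qed
    then have "card ({..<n} - J x) \<le> card ((\<lambda>(b, i). b + i * p) ` (B x \<times> {..<M}))"
      using finB by (intro card_mono) auto
    also have "\<dots> \<le> card (B x \<times> {..<M})" using finB by (intro card_image_le) auto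
    also have "\<dots> = M * card (B x)" by (simp add: card_cartesian_product)
    finally have "card ({..<n} - J x) \<le> M * card (B x)" .
    moreover have "card ({..<n} - J x) = n - card (J x)"
      by (subst card_Diff_subset) (auto simp: J_def)
    ultimately have "n \<le> M * card (B x) + card (J x)" by linarith
    then have "real n \<le> M * real (card (B x)) + card (J x)" by (metis of_nat_add of_nat_le_iff of_nat_mult)
    moreover have "M * real (card (B x)) \<le> M * (\<eta> * n)"
      using that unfolding Y_def Z_def by (intro mult_left_mono) auto
    ultimately show ?thesis by linarith
  qed
  \<comment> \<open>From time \<open>j mod p\<close> one reaches \<open>j\<close> by
    \<open>j div p < M\<close> applications of \<open>T ^^ p\<close>, all starting at good
    times.\<close>
  have Jclose: "dist ((T ^^ (j mod p)) x) ((T ^^ j) x) \<le> 8 * M * \<gamma>" "(T ^^ j) x \<in> K" if j: "j \<in> J x" for j x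
  proof -
    have jn: "j < n" and notB: "\<And>b. b \<le> j \<Longrightarrow> p dvd j - b \<Longrightarrow> b \<notin> B x" using j unfolding J_def by auto
    have ok: "(T ^^ b) x \<in> D \<inter> K" if "b \<le> j" "p dvd j - b" for b
      using notB[OF that] that jn unfolding B_def G_def by auto
    show "(T ^^ j) x \<in> K" using ok[of j] by auto
    define \<tau> where "\<tau> = j mod p"
    have step: "dist ((T ^^ \<tau>) x) ((T ^^ (\<tau> + m * p)) x) \<le> 8 * real m * \<gamma>" if "m \<le> j div p" for m
      using that
    proof (induction m)
      case (Suc m)
      have jm: "j = (\<tau> + m * p) + (j div p - m) * p"
      proof -
        have "j = \<tau> + (j div p) * p" unfolding \<tau>_def by simp
        also have "j div p = m + (j div p - m)" using Suc.prems by simp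
        finally show ?thesis by (simp add: add_mult_distrib)
      qed
      have "(T ^^ (\<tau> + m * p)) x \<in> D" using ok[of "\<tau> + m * p"] jm by (metis IntD1 add_diff_cancel_left' dvd_triv_right le_add1)
      then have "dist ((T ^^ (\<tau> + m * p)) x) ((T ^^ p) ((T ^^ (\<tau> + m * p)) x)) \<le> 8 * \<gamma>" unfolding D_def by simp
      also have "(T ^^ p) ((T ^^ (\<tau> + m * p)) x) = (T ^^ (\<tau> + Suc m * p)) x"
        by (metis (no_types, lifting) add.left_commute comp_apply funpow_add mult_Suc)
      finally show ?case
        using Suc.IH Suc.prems dist_triangle[of "(T ^^ \<tau>) x" "(T ^^ (\<tau> + Suc m * p)) x" "(T ^^ (\<tau> + m * p)) x"]
        by (simp add: algebra_simps)
    qed simp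
    have "j div p < M" using jn p unfolding n_def by (simp add: less_mult_imp_div_less)
    then have "8 * real (j div p) * \<gamma> \<le> 8 * M * \<gamma>" using \<gamma> by (intro mult_right_mono) auto
    moreover have "\<tau> + (j div p) * p = j" unfolding \<tau>_def by simp
    ultimately show "dist ((T ^^ (j mod p)) x) ((T ^^ j) x) \<le> 8 * M * \<gamma>"
      using step[of "j div p"] unfolding \<tau>_def by simp
  qed
  \<comment> \<open>The phase found in the first period serves for all times in \<open>J x\<close>:
    by \<open>Jclose\<close> the point is still near its position in the first period, and
    \<open>z\<close> is exactly periodic.\<close>
  have phase: "\<exists>i<p. \<forall>j\<in>J x. dist ((T ^^ j) x) (z (i + j)) \<le> (1 + 8 * real M) * \<gamma>" if "x \<in> Y" for x
  proof -
    obtain w where w: "w \<in> \<Gamma> N" "\<forall>j<p. dist ((T ^^ j) x) ((T ^^ j) w) \<le> \<gamma>"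
      using \<open>x \<in> Y\<close> unfolding Y_def shadow_def p_def by blast
    obtain i where i: "i < p" "w = (T ^^ i) z0"
      using w(1) periodic_orbit_eq[OF per[OF N(1)] z0] unfolding p_def by blast
    have "dist ((T ^^ j) x) (z (i + j)) \<le> (1 + 8 * real M) * \<gamma>" if j: "j \<in> J x" for j
    proof -
      have "dist ((T ^^ (j mod p)) x) ((T ^^ (j mod p)) w) \<le> \<gamma>" using w(2) p by simp
      moreover have "(T ^^ (j mod p)) w = z (i + j mod p)"
        unfolding z_def i(2) by (metis add.commute comp_apply funpow_add)
      ultimately have "dist ((T ^^ (j mod p)) x) (z (i + j)) \<le> \<gamma>" using zmod by simp
      then show ?thesis
        using Jclose(1)[OF j] dist_triangle3[of "(T ^^ j) x" "z (i + j)" "(T ^^ (j mod p)) x"]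
        by (simp add: algebra_simps)
    qed
    then show ?thesis using i by blast
  qed
  have close: "fbar (name_word T P n x) (name_word T P n y) < \<epsilon>" if x: "x \<in> Y" and y: "y \<in> Y" for x y
  proof -
    obtain a where a: "a < p" "\<And>j. j \<in> J x \<Longrightarrow> dist ((T ^^ j) x) (z (a + j)) \<le> (1 + 8 * real M) * \<gamma>"
      using phase[OF x] by blast
    obtain b where b: "b < p" "\<And>j. j \<in> J y \<Longrightarrow> dist ((T ^^ j) y) (z (b + j)) \<le> (1 + 8 * real M) * \<gamma>"
      using phase[OF y] by blast
    have finJ: "finite (J x)" "finite (J y)" unfolding J_def by auto
    \<comment> \<open>Times on the clock of the orbit \<open>z\<close> that are good for both
      points. Both shifted sets lie below \<open>n + p\<close>, so their overlap misses at most
      \<open>p\<close> elements beyond the bad times.\<close>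
    define C where "C = (+) a ` J x \<inter> (+) b ` J y"
    have C: "a \<le> c \<and> b \<le> c \<and> c - a < n \<and> c - b < n \<and> name_word T P n x ! (c - a) = name_word T P n y ! (c - b)"
      if "c \<in> C" for c
    proof -
      obtain i j where ij: "i \<in> J x" "j \<in> J y" "c = a + i" "c = b + j" using \<open>c \<in> C\<close> unfolding C_def by blast
      then have lt: "i < n" "j < n" unfolding J_def by auto
      have "dist ((T ^^ i) x) ((T ^^ j) y) \<le> 2 * ((1 + 8 * real M) * \<gamma>)"
        using a(2)[OF ij(1)] b(2)[OF ij(2)] ij dist_triangle2[of "(T ^^ i) x" "(T ^^ j) y" "z c"] by simp
      then have "dist ((T ^^ i) x) ((T ^^ j) y) < \<delta>" using \<gamma>(3) by linarith
      then have "cell P ((T ^^ i) x) = cell P ((T ^^ j) y)" using K(4) Jclose(2) ij by blast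
      moreover have "c - a = i" "c - b = j" using ij by auto
      ultimately show ?thesis using lt ij unfolding name_word_def by auto
    qed
    have "card ((+) a ` J x) = card (J x)" "card ((+) b ` J y) = card (J y)" by (simp_all add: card_image)
    moreover have "card ((+) a ` J x \<union> (+) b ` J y) \<le> card {..<n + p}"
      using a b by (intro card_mono) (auto simp: J_def)
    moreover have "card ((+) a ` J x) + card ((+) b ` J y) = card ((+) a ` J x \<union> (+) b ` J y) + card C"
      unfolding C_def using finJ by (intro card_Un_Int) auto
    ultimately have "card (J x) + card (J y) \<le> n + p + card C" by simp
    then have "real (card (J x)) + card (J y) \<le> n + p + real (card C)"
      by (metis (mono_tags, lifting) of_nat_add of_nat_le_iff)
    then have "real (card C) \<ge> n - 2 * M * \<eta> * n - p" using Jcard[OF x] Jcard[OF y] by simp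
    then have "real (card C) / n \<ge> (n - 2 * M * \<eta> * n - p) / n" by (intro divide_right_mono) auto
    also have "(n - 2 * M * \<eta> * n - p) / n = 1 - 2 * M * \<eta> - p / n"
      using n by (simp add: diff_divide_distrib)
    also have "p / n = 1 / real M" unfolding n_def using p by simp
    finally have "1 - real (card C) / n < \<epsilon>" using M1 \<eta>(3) \<epsilon> by linarith
    moreover have "fbar (name_word T P n x) (name_word T P n y) \<le> 1 - card C / n"
    proof (rule fbar_le[where a=a and a'=b])
      show "finite C" unfolding C_def using finJ by simp
      show "length (name_word T P n x) = n" "length (name_word T P n y) = n" by (simp_all add: name_word_def)
    qed (fact n, fact C)
    ultimately show ?thesis by linarith
  qed
  define W where "W = name_word T P n ` Y"
  have Wsub: "W \<subseteq> partition_words T P n" unfolding W_def partition_words_eq[OF part] by auto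
  have Wfin: "finite W" using Wsub finite_partition_words[OF fin] finite_subset by blast
  have Wc: "w \<in> W \<Longrightarrow> set w \<subseteq> P \<and> length w = n" for w using Wsub unfolding partition_words_def by auto
  have "Y \<subseteq> (\<Union>w\<in>W. cylinder T w)"
  proof
    fix x assume x: "x \<in> Y"
    then have w: "name_word T P n x \<in> W" unfolding W_def by simp
    then have "x \<in> cylinder T (name_word T P n x)" using cylinder_eq_name_word[OF part, of _ T] Wc by auto
    then show "x \<in> (\<Union>w\<in>W. cylinder T w)" using w by blast
  qed
  moreover have "(\<Union>w\<in>W. cylinder T w) \<in> sets borel"
    using Wfin Wc cylinder_borel[OF bor _ T_measurable] by (intro sets.finite_UN) auto
  ultimately have "measure \<mu> Y \<le> measure \<mu> (\<Union>w\<in>W. cylinder T w)" by (intro finite_measure_mono) auto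
  then show ?thesis
    using mY n Wsub close unfolding W_def by (intro exI[of _ n] conjI exI[of _ "name_word T P n ` Y"]) auto
qed

end

section \<open>Entropy and atoms\<close>

lemma simple_function_iff_count_space:
  "simple_function M f \<longleftrightarrow> finite (f ` space M) \<and> f \<in> measurable M (count_space UNIV)"
  using simple_function_eq_measurable by blast

section \<open>Entropy of finite-valued maps\<close>

context information_space
begin

lemma entropy_Pair_le:
  assumes "simple_function M X" "simple_function M Y"
  shows "\<H>(\<lambda>x. (X x, Y x)) \<le> \<H>(X) + \<H>(Y)"
  using entropy_chain_rule[OF assms] conditional_entropy_less_eq_entropy[OF assms(2,1)] by linarith

lemma entropy_determined_le:
  assumes "simple_function M Y" "\<And>x. X x = f (Y x)"
  shows "\<H>(X) \<le> \<H>(Y)"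
proof -
  have "X = f \<circ> Y" using assms(2) by auto
  then show ?thesis using entropy_data_processing[OF assms(1), of f] by simp
qed

lemma simple_function_map:
  assumes "\<And>i. i < k \<Longrightarrow> simple_function M (X i)"
  shows "simple_function M (\<lambda>x. map (\<lambda>i. X i x) [0..<k])"
  using assms
proof (induction k)
  case (Suc k)
  then have "simple_function M (\<lambda>x. (map (\<lambda>i. X i x) [0..<k], X k x))" by (intro simple_function_Pair) auto
  then have "simple_function M ((\<lambda>(l, a). l @ [a]) \<circ> (\<lambda>x. (map (\<lambda>i. X i x) [0..<k], X k x)))"
    by (rule simple_function_compose)
  then show ?case by (simp add: comp_def)
qed simp

lemma entropy_map_le:
  fixes X :: "nat \<Rightarrow> 'a \<Rightarrow> 'c"
  assumes "\<And>i. i < k \<Longrightarrow> simple_function M (X i)"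
  shows "\<H>(\<lambda>x. map (\<lambda>i. X i x) [0..<k]) \<le> (\<Sum>i<k. \<H>(X i))"
  using assms
proof (induction k)
  case 0
  have "simple_function M (\<lambda>x. [] :: 'c list)" by simp
  from entropy_le_card[OF simple_distributedI[OF this measure_nonneg refl]]
  show ?case by (simp add: not_empty image_constant_conv)
next
  case (Suc k)
  have s: "simple_function M (\<lambda>x. map (\<lambda>i. X i x) [0..<k])" "simple_function M (X k)"
    using Suc.prems by (auto intro: simple_function_map)
  have "\<H>(\<lambda>x. map (\<lambda>i. X i x) [0..<Suc k]) \<le> \<H>(\<lambda>x. (map (\<lambda>i. X i x) [0..<k], X k x))"
    by (rule entropy_determined_le[where f="\<lambda>(l, a). l @ [a]"]) (use s in \<open>auto intro: simple_function_Pair\<close>)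
  also have "\<dots> \<le> \<H>(\<lambda>x. map (\<lambda>i. X i x) [0..<k]) + \<H>(X k)" by (rule entropy_Pair_le[OF s])
  also have "\<dots> \<le> (\<Sum>i<Suc k. \<H>(X i))" using Suc by simp
  finally show ?case .
qed

end

text \<open>The inequality \<open>ln x \<le> x - 1\<close> at \<open>x = 1 / sqrt t\<close>.\<close>

lemma neg_t_ln_t_le_sqrt:
  assumes "0 \<le> t"
  shows "- (t * ln t) \<le> 2 * sqrt (t::real)"
proof (cases "t = 0")
  case False
  define s where "s = sqrt t"
  have s: "s > 0" "t = s * s" unfolding s_def using assms False by auto
  have "- ln s \<le> 1 / s - 1" using ln_le_minus_one[of "1 / s"] s by (simp add: ln_div)
  then have "2 * (s * s) * (- ln s) \<le> 2 * (s * s) * (1 / s - 1)" using s by (intro mult_left_mono) auto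
  also have "\<dots> = 2 * s - 2 * (s * s)" using s by (simp add: field_simps)
  also have "\<dots> \<le> 2 * s" by simp
  finally show ?thesis using s unfolding s_def[symmetric] by (simp add: ln_mult)
qed simp

lemma neg_t_ln_t_le_one_minus:
  assumes "0 < t"
  shows "- (t * ln t) \<le> 1 - (t::real)"
proof -
  have "- ln t \<le> 1 / t - 1" using ln_le_minus_one[of "1 / t"] assms by (simp add: ln_div)
  then have "t * (- ln t) \<le> t * (1 / t - 1)" using assms by (intro mult_left_mono) auto
  moreover have "t * (1 / t - 1) = 1 - t" using assms by (simp add: right_diff_distrib)
  ultimately show ?thesis by simp
qed

lemma log_exp_1: "log (exp 1) x = ln x"
  by (simp add: log_def)

text \<open>The value \<open>None\<close> has probability near 1, and each of the
  \<open>card Q\<close> remaining ones has probability at most \<open>\<xi>\<close>. This bounds the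
  information in a correction at a single time; \<open>card Q\<close> stays fixed while
  \<open>\<xi>\<close> tends to 0, so the square root is harmless.\<close>

lemma (in information_space) entropy_rare_le:
  fixes E :: "'a \<Rightarrow> 'b option"
  assumes b: "b = exp 1" and E: "simple_function M E" and Q: "finite Q" "\<And>x. E x \<in> insert None (Some ` Q)"
    and \<xi>: "measure M {x\<in>space M. E x \<noteq> None} \<le> \<xi>" "\<xi> < 1"
  shows "\<H>(E) \<le> 2 * card Q * sqrt \<xi> + \<xi>"
proof -
  define q where "q y = measure M (E -` {y} \<inter> space M)" for y
  have fin: "finite (E ` space M)" using E unfolding simple_function_def by auto
  have meas: "E -` B \<inter> space M \<in> sets M" for B using E by (rule simple_functionD)
  have q: "0 \<le> q y" "q y \<le> 1" for y unfolding q_def by auto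
  have h0: "- (q y * ln (q y)) \<ge> 0" for y
  proof (cases "q y = 0")
    case False
    then have "0 < q y" using q(1)[of y] by simp
    then have "ln (q y) \<le> 0" using q(2)[of y] by (simp add: ln_le_zero_iff)
    then show ?thesis using q(1)[of y] by (simp add: mult_nonneg_nonpos)
  qed simp
  have \<xi>0: "\<xi> \<ge> 0" using \<xi>(1) measure_nonneg[of M "{x\<in>space M. E x \<noteq> None}"] by linarith
  have qN: "q None \<ge> 1 - \<xi>"
  proof -
    have "E -` {None} \<inter> space M = space M - {x\<in>space M. E x \<noteq> None}" by auto
    moreover have "{x\<in>space M. E x \<noteq> None} = E -` (UNIV - {None}) \<inter> space M" by auto
    ultimately have "q None = 1 - measure M {x\<in>space M. E x \<noteq> None}"
      unfolding q_def using meas[of "UNIV - {None}"] by (simp add: prob_compl)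
    then show ?thesis using \<xi> by linarith
  qed
  have qS: "q (Some a) \<le> \<xi>" for a
  proof -
    have "{x\<in>space M. E x \<noteq> None} = E -` (UNIV - {None}) \<inter> space M" by auto
    then have "q (Some a) \<le> measure M {x\<in>space M. E x \<noteq> None}"
      unfolding q_def using meas[of "UNIV - {None}"] by (intro finite_measure_mono) auto
    then show ?thesis using \<xi> by linarith
  qed
  have "\<H>(E) = (\<Sum>y\<in>E ` space M. - (q y * ln (q y)))"
    using entropy_simple_distributed[OF simple_distributedI[OF E measure_nonneg refl]]
    unfolding q_def b log_exp_1 by (simp add: sum_negf)
  also have "\<dots> \<le> (\<Sum>y\<in>insert None (Some ` Q). - (q y * ln (q y)))"
    using Q h0 by (intro sum_mono2) auto
  also have "\<dots> = - (q None * ln (q None)) + (\<Sum>a\<in>Q. - (q (Some a) * ln (q (Some a))))"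
    using Q by (subst sum.insert) (auto simp: sum.reindex)
  also have "\<dots> \<le> \<xi> + (\<Sum>a\<in>Q. 2 * sqrt \<xi>)"
  proof (intro add_mono sum_mono)
    show "- (q None * ln (q None)) \<le> \<xi>"
      using neg_t_ln_t_le_one_minus[of "q None"] qN \<xi>(2) by linarith
    fix a
    have "- (q (Some a) * ln (q (Some a))) \<le> 2 * sqrt (q (Some a))" by (rule neg_t_ln_t_le_sqrt[OF q(1)])
    also have "\<dots> \<le> 2 * sqrt \<xi>" using qS by simp
    finally show "- (q (Some a) * ln (q (Some a))) \<le> 2 * sqrt \<xi>" .
  qed
  finally show ?thesis by simp
qed

lemma simple_function_cell:
  assumes P: "finite_borel_partition P" and f: "f \<in> borel_measurable M"
  shows "simple_function M (\<lambda>x. cell P (f x))"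
proof -
  have fin: "finite P" and part: "partition_on UNIV P" and bor: "P \<subseteq> sets borel"
    using P unfolding finite_borel_partition_def by auto
  show ?thesis unfolding simple_function_def
  proof
    show "finite ((\<lambda>x. cell P (f x)) ` space M)"
      by (rule finite_subset[OF _ fin]) (auto intro: cell_in[OF part])
    show "\<forall>A\<in>(\<lambda>x. cell P (f x)) ` space M. (\<lambda>x. cell P (f x)) -` {A} \<inter> space M \<in> sets M"
    proof
      fix A assume "A \<in> (\<lambda>x. cell P (f x)) ` space M"
      then have A: "A \<in> P" using cell_in[OF part] by auto
      then have "(\<lambda>x. cell P (f x)) -` {A} = f -` A"
        using cell_in[OF part] cell_eqI[OF part] by auto
      then show "(\<lambda>x. cell P (f x)) -` {A} \<inter> space M \<in> sets M" using measurable_sets[OF f, of A] A bor by auto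
    qed
  qed
qed

lemma partition_entropy_nonneg:
  assumes "prob_space \<mu>"
  shows "0 \<le> partition_entropy \<mu> Q"
proof -
  interpret prob_space \<mu> by fact
  have "measure \<mu> A * ln (measure \<mu> A) \<le> 0" for A
  proof (cases "measure \<mu> A = 0")
    case False
    then have "ln (measure \<mu> A) \<le> 0" using measure_nonneg[of \<mu> A] prob_le_1[of A] by (simp add: ln_le_zero_iff order_le_less)
    then show ?thesis by (simp add: mult_nonneg_nonpos)
  qed simp
  then show ?thesis unfolding partition_entropy_def by (simp add: sum_nonpos)
qed

section \<open>Zero entropy of the limit measure\<close>

context gikn_limit
begin

sublocale I: information_space \<mu> "exp 1"
  by unfold_locales simp

lemma simple_function_name_word:
  assumes "finite_borel_partition P"
  shows "simple_function \<mu> (\<lambda>x. name_word T P n ((T ^^ k) x))"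
  unfolding name_word_def using assms
  by (intro I.simple_function_map simple_function_cell) (auto intro: measurable_compose[OF Tn_measurable])

text \<open>Words with empty cylinder are excluded from \<open>partition_words\<close>, so
  \<open>cylinder T\<close> is injective there and atoms can be summed as words. The base
  \<open>exp 1\<close> turns \<open>log\<close> into the natural logarithm.\<close>

lemma partition_entropy_eq:
  assumes P: "finite_borel_partition P"
  shows "partition_entropy \<mu> (iterated_partition T P n) = I.entropy_Pow (name_word T P n)"
proof -
  have part: "partition_on UNIV P" using P unfolding finite_borel_partition_def by auto
  have cyl: "cylinder T w = name_word T P n -` {w}" if "w \<in> partition_words T P n" for w
    using cylinder_eq_name_word[OF part, of w T] that unfolding partition_words_def by auto
  have inj: "inj_on (cylinder T) (partition_words T P n)"
  proof (rule inj_onI)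
    fix v w assume vw: "v \<in> partition_words T P n" "w \<in> partition_words T P n" "cylinder T v = cylinder T w"
    then obtain x where "x \<in> cylinder T v" unfolding partition_words_def by auto
    then show "v = w" using cyl[OF vw(1)] cyl[OF vw(2)] vw(3) by auto
  qed
  have "partition_entropy \<mu> (iterated_partition T P n)
    = - (\<Sum>w\<in>partition_words T P n. measure \<mu> (cylinder T w) * ln (measure \<mu> (cylinder T w)))"
    unfolding partition_entropy_def iterated_partition_def using sum.reindex[OF inj] by simp
  also have "\<dots> = - (\<Sum>w\<in>partition_words T P n. measure \<mu> (name_word T P n -` {w}) * ln (measure \<mu> (name_word T P n -` {w})))"
    by (simp add: cyl)
  also have "\<dots> = I.entropy_Pow (name_word T P n)"
    using I.entropy_simple_distributed[OF simple_distributedI[OF simple_function_name_word[OF P, of n 0, simplified] measure_nonneg refl]]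
    unfolding log_exp_1 partition_words_eq[OF part] by simp
  finally show ?thesis .
qed

text \<open>A name of length \<open>p\<close> is decoded from a phase, with at most
  \<open>p + 1\<close> values, and \<open>p\<close> corrections, each of them rarely present. The
  bound is stated for all iterates \<open>k\<close> because a long name is a concatenation of blocks
  starting at different times.\<close>

lemma block_entropy:
  assumes P: "finite_borel_partition P" and \<xi>: "0 < \<xi>" "\<xi> < 1"
  shows "eventually (\<lambda>N. N \<ge> 1 \<and> (\<forall>k. I.entropy_Pow (\<lambda>x. name_word T P (card (\<Gamma> N)) ((T ^^ k) x))
    \<le> ln (card (\<Gamma> N) + 1) + card (\<Gamma> N) * (2 * card P * sqrt \<xi> + \<xi>))) sequentially"
proof -
  have fin: "finite P" and part: "partition_on UNIV P" and bor: "P \<subseteq> sets borel"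
    using P unfolding finite_borel_partition_def by auto
  have x2: "\<xi> / 2 > 0" using \<xi> by simp
  obtain K \<delta> where K: "closed K" "\<delta> > 0" "measure \<mu> K \<ge> 1 - \<xi> / 2"
    "\<And>x y. x \<in> K \<Longrightarrow> y \<in> K \<Longrightarrow> dist x y < \<delta> \<Longrightarrow> cell P x = cell P y"
    using partition_core[OF prob compact_UNIV P x2] by metis
  define \<gamma> where "\<gamma> = min (\<xi> / 2) (\<delta> / 3)"
  have \<gamma>: "\<gamma> > 0" "\<gamma> \<le> \<xi> / 2" "2 * \<gamma> < \<delta>" unfolding \<gamma>_def using \<xi> K by auto
  show ?thesis using shadow_measure[OF \<gamma>(1)]
  proof eventually_elim
    case (elim N)
    define p where "p = card (\<Gamma> N)"
    define V where "V = shadow N \<gamma>"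
    have V: "closed V" "measure \<mu> V \<ge> 1 - \<xi> / 2" using elim closed_shadow \<gamma> unfolding V_def by auto
    have N: "N \<ge> 1" using elim by simp
    obtain z0 where z0: "z0 \<in> \<Gamma> N" using orbit_finite(2)[OF N] by auto
    define z where "z i = (T ^^ i) z0" for i
    \<comment> \<open>The value \<open>p\<close> marks points without a phase; it makes the
      \<open>LEAST\<close> below exist and stay bounded everywhere.\<close>
    define R where "R x i \<longleftrightarrow> i = p \<or> (i < p \<and> (\<forall>j<p. dist ((T ^^ j) x) (z (i + j)) \<le> \<gamma>))" for x i
    define I where "I x = (LEAST i. R x i)" for x
    \<comment> \<open>The predicted letter: the cell of any point of \<open>K\<close> near
      \<open>z i\<close>. The choice is arbitrary if there is none, but it is used only when
      \<open>(T ^^ j) x\<close> is itself such a point, and then all choices give its cell.\<close>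
    define ref where "ref i = cell P (SOME y. y \<in> K \<and> dist y (z i) \<le> \<gamma>)" for i
    define E where "E j x = (if x \<in> V \<and> (T ^^ j) x \<in> K then None else Some (cell P ((T ^^ j) x)))" for j x
    have I: "I x \<le> p" "R x (I x)" for x
    proof -
      have "R x p" unfolding R_def by simp
      then show "I x \<le> p" "R x (I x)" unfolding I_def by (auto intro: Least_le LeastI)
    qed
    have IV: "I x < p" if "x \<in> V" for x
    proof -
      obtain w where w: "w \<in> \<Gamma> N" "\<forall>j<p. dist ((T ^^ j) x) ((T ^^ j) w) \<le> \<gamma>"
        using \<open>x \<in> V\<close> unfolding V_def shadow_def p_def by blast
      obtain i where i: "i < p" "w = (T ^^ i) z0"
        using w(1) periodic_orbit_eq[OF per[OF N] z0] unfolding p_def by blast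
      have "(T ^^ j) w = z (i + j)" for j unfolding z_def i(2) by (metis add.commute comp_apply funpow_add)
      then have "R x i" unfolding R_def using i w(2) by auto
      then have "I x \<le> i" unfolding I_def by (rule Least_le)
      then show ?thesis using i by simp
    qed
    have decode: "cell P ((T ^^ j) x) = (case E j x of None \<Rightarrow> ref (I x + j) | Some A \<Rightarrow> A)" if j: "j < p" for j x
    proof (cases "x \<in> V \<and> (T ^^ j) x \<in> K")
      case True
      then have d: "dist ((T ^^ j) x) (z (I x + j)) \<le> \<gamma>" using I(2)[of x] IV[of x] j unfolding R_def by auto
      define y where "y = (SOME y. y \<in> K \<and> dist y (z (I x + j)) \<le> \<gamma>)"
      have y: "y \<in> K \<and> dist y (z (I x + j)) \<le> \<gamma>"
        unfolding y_def by (rule someI[of _ "(T ^^ j) x"]) (use True d in simp)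
      then have "dist ((T ^^ j) x) y < \<delta>" using d \<gamma>(3) dist_triangle2[of "(T ^^ j) x" y "z (I x + j)"] by linarith
      then have "cell P ((T ^^ j) x) = cell P y" using K(4) y True by blast
      then show ?thesis using True unfolding E_def ref_def y_def by simp
    qed (auto simp: E_def)
    have Im: "I \<in> measurable borel (count_space UNIV)"
    proof -
      have "Measurable.pred borel (\<lambda>x. R x i)" for i
      proof -
        have "closed {x. dist ((T ^^ j) x) (z (i + j)) \<le> \<gamma>}" for j
          using continuous_on_funpow[OF cont_T, of j] by (intro closed_Collect_le continuous_intros) auto
        then have "closed (\<Inter>j<p. {x. dist ((T ^^ j) x) (z (i + j)) \<le> \<gamma>})" by (intro closed_INT) auto
        moreover have "(\<Inter>j<p. {x. dist ((T ^^ j) x) (z (i + j)) \<le> \<gamma>}) = {x. \<forall>j<p. dist ((T ^^ j) x) (z (i + j)) \<le> \<gamma>}" by auto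
        ultimately have "Measurable.pred borel (\<lambda>x. \<forall>j<p. dist ((T ^^ j) x) (z (i + j)) \<le> \<gamma>)"
          unfolding pred_def by (metis (no_types, lifting) borel_closed space_borel Collect_cong UNIV_I)
        then show ?thesis unfolding R_def by measurable
      qed
      then show ?thesis unfolding I_def by measurable
    qed
    have "I.entropy_Pow (\<lambda>x. name_word T P p ((T ^^ k) x)) \<le> ln (p + 1) + p * (2 * card P * sqrt \<xi> + \<xi>)" for k
    proof -
      have sI: "simple_function \<mu> (\<lambda>x. I ((T ^^ k) x))"
        unfolding simple_function_iff_count_space
      proof
        show "finite ((\<lambda>x. I ((T ^^ k) x)) ` space \<mu>)" by (rule finite_subset[of _ "{..p}"]) (use I(1) in blast, simp)
        show "(\<lambda>x. I ((T ^^ k) x)) \<in> measurable \<mu> (count_space UNIV)"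
          using measurable_compose[OF Tn_measurable Im, of k] by simp
      qed
      have Kk: "{x. (T ^^ j) ((T ^^ k) x) \<in> K} \<in> sets borel" for j
        using measurable_sets[OF measurable_compose[OF Tn_measurable[of k] Tn_measurable[of j]] borel_closed[OF K(1)]]
        by (simp add: vimage_def)
      have Vk: "{x. (T ^^ k) x \<in> V} \<in> sets borel"
        using measurable_sets[OF Tn_measurable borel_closed[OF V(1)], of k] by (simp add: vimage_def)
      have sE: "simple_function \<mu> (\<lambda>x. E j ((T ^^ k) x))" for j
      proof -
        have "simple_function \<mu> (\<lambda>x. cell P ((T ^^ j) ((T ^^ k) x)))"
          using measurable_compose[OF Tn_measurable[of k] Tn_measurable[of j]] by (intro simple_function_cell[OF P]) simp
        then have "simple_function \<mu> (Some \<circ> (\<lambda>x. cell P ((T ^^ j) ((T ^^ k) x))))" by (rule simple_function_compose)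
        then have "simple_function \<mu> (\<lambda>x. Some (cell P ((T ^^ j) ((T ^^ k) x))))" by (simp add: comp_def)
        moreover have "{x \<in> space \<mu>. (T ^^ k) x \<in> V \<and> (T ^^ j) ((T ^^ k) x) \<in> K} \<in> sets \<mu>"
          using sets.Int[OF Vk Kk[of j]] by (simp add: Int_def)
        ultimately show ?thesis unfolding E_def by (intro simple_function_If) auto
      qed
      have "I.entropy_Pow (\<lambda>x. name_word T P p ((T ^^ k) x))
        \<le> I.entropy_Pow (\<lambda>x. (I ((T ^^ k) x), map (\<lambda>j. E j ((T ^^ k) x)) [0..<p]))"
      proof (rule I.entropy_determined_le)
        show "simple_function \<mu> (\<lambda>x. (I ((T ^^ k) x), map (\<lambda>j. E j ((T ^^ k) x)) [0..<p]))"
          using sI sE by (intro simple_function_Pair I.simple_function_map)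
        fix x
        show "name_word T P p ((T ^^ k) x) =
          (\<lambda>(i, l). map (\<lambda>j. case l ! j of None \<Rightarrow> ref (i + j) | Some A \<Rightarrow> A) [0..<p])
            (I ((T ^^ k) x), map (\<lambda>j. E j ((T ^^ k) x)) [0..<p])"
          unfolding name_word_def by (auto simp: decode)
      qed
      also have "\<dots> \<le> I.entropy_Pow (\<lambda>x. I ((T ^^ k) x)) + I.entropy_Pow (\<lambda>x. map (\<lambda>j. E j ((T ^^ k) x)) [0..<p])"
        using sI sE by (intro I.entropy_Pair_le I.simple_function_map)
      also have "\<dots> \<le> ln (p + 1) + (\<Sum>j<p. I.entropy_Pow (\<lambda>x. E j ((T ^^ k) x)))"
      proof (rule add_mono)
        have "card ((\<lambda>x. I ((T ^^ k) x)) ` space \<mu>) \<le> card {..p}" using I(1) by (intro card_mono) auto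
        moreover have "card ((\<lambda>x. I ((T ^^ k) x)) ` space \<mu>) > 0"
          using sI not_empty unfolding simple_function_def by (auto simp: card_gt_0_iff)
        ultimately have "ln (card ((\<lambda>x. I ((T ^^ k) x)) ` space \<mu>)) \<le> ln (p + 1)" by simp
        then show "I.entropy_Pow (\<lambda>x. I ((T ^^ k) x)) \<le> ln (p + 1)"
          using I.entropy_le_card[OF simple_distributedI[OF sI measure_nonneg refl]] unfolding log_exp_1 by linarith
        show "I.entropy_Pow (\<lambda>x. map (\<lambda>j. E j ((T ^^ k) x)) [0..<p]) \<le> (\<Sum>j<p. I.entropy_Pow (\<lambda>x. E j ((T ^^ k) x)))"
          using sE by (rule I.entropy_map_le)
      qed
      also have "\<dots> \<le> ln (p + 1) + (\<Sum>j<p. 2 * card P * sqrt \<xi> + \<xi>)"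
      proof (intro add_left_mono sum_mono)
        fix j
        have "measure \<mu> {x\<in>space \<mu>. E j ((T ^^ k) x) \<noteq> None}
          \<le> measure \<mu> ((UNIV - {x. (T ^^ k) x \<in> V}) \<union> (UNIV - {x. (T ^^ j) ((T ^^ k) x) \<in> K}))"
          using Vk Kk[of j] by (intro finite_measure_mono) (auto simp: E_def)
        also have "\<dots> \<le> measure \<mu> (UNIV - {x. (T ^^ k) x \<in> V}) + measure \<mu> (UNIV - {x. (T ^^ j) ((T ^^ k) x) \<in> K})"
          using Vk Kk[of j] by (intro measure_Un_le) auto
        also have "\<dots> = (1 - measure \<mu> {x. (T ^^ k) x \<in> V}) + (1 - measure \<mu> {x. (T ^^ j) ((T ^^ k) x) \<in> K})"
          using prob_compl[of "{x. (T ^^ k) x \<in> V}"] prob_compl[of "{x. (T ^^ j) ((T ^^ k) x) \<in> K}"] Vk Kk[of j] by simp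
        also have "measure \<mu> {x. (T ^^ k) x \<in> V} = measure \<mu> V"
          using invariant_measure_vimage[OF invariant borel_closed[OF V(1)], of k] by (simp add: vimage_def)
        also have "measure \<mu> {x. (T ^^ j) ((T ^^ k) x) \<in> K} = measure \<mu> K"
          using invariant_measure_vimage[OF invariant borel_closed[OF K(1)], of "j + k"]
          by (simp add: vimage_def funpow_add)
        finally have "measure \<mu> {x\<in>space \<mu>. E j ((T ^^ k) x) \<noteq> None} \<le> \<xi>" using V(2) K(3) by linarith
        then show "I.entropy_Pow (\<lambda>x. E j ((T ^^ k) x)) \<le> 2 * card P * sqrt \<xi> + \<xi>"
          using \<xi> fin cell_in[OF part] by (intro I.entropy_rare_le[OF refl sE]) (auto simp: E_def)
      qed
      finally show ?thesis by simp
    qed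
    then show ?case using N unfolding p_def by simp
  qed
qed

lemma name_word_entropy_le:
  assumes P: "finite_borel_partition P" and p: "p > 0"
    and c: "\<And>k. I.entropy_Pow (\<lambda>x. name_word T P p ((T ^^ k) x)) \<le> c"
  shows "I.entropy_Pow (name_word T P n) \<le> (n / p + 1) * c"
proof -
  \<comment> \<open>The additional block covers the incomplete end of the word.\<close>
  define m where "m = n div p + 1"
  have s: "simple_function \<mu> (\<lambda>x. map (\<lambda>i. name_word T P p ((T ^^ (i * p)) x)) [0..<m])"
    by (intro I.simple_function_map simple_function_name_word[OF P])
  have "I.entropy_Pow (name_word T P n) \<le> I.entropy_Pow (\<lambda>x. map (\<lambda>i. name_word T P p ((T ^^ (i * p)) x)) [0..<m])"
  proof (rule I.entropy_determined_le[OF s])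
    fix x
    have "cell P ((T ^^ j) x) = map (\<lambda>i. name_word T P p ((T ^^ (i * p)) x)) [0..<m] ! (j div p) ! (j mod p)" if "j < n" for j
    proof -
      have "j div p < m" unfolding m_def using that by (simp add: div_le_mono le_imp_less_Suc)
      moreover have "(T ^^ (j mod p)) ((T ^^ (j div p * p)) x) = (T ^^ j) x"
        by (metis comp_apply funpow_add mod_div_mult_eq)
      ultimately show ?thesis using p unfolding name_word_def by simp
    qed
    then show "name_word T P n x = (\<lambda>l. map (\<lambda>j. l ! (j div p) ! (j mod p)) [0..<n])
      (map (\<lambda>i. name_word T P p ((T ^^ (i * p)) x)) [0..<m])"
      unfolding name_word_def[of T P n] by simp
  qed
  also have "\<dots> \<le> (\<Sum>i<m. I.entropy_Pow (\<lambda>x. name_word T P p ((T ^^ (i * p)) x)))"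
    by (intro I.entropy_map_le simple_function_name_word[OF P])
  also have "\<dots> \<le> (\<Sum>i<m. c)" using c by (intro sum_mono)
  also have "\<dots> = m * c" by simp
  also have "\<dots> \<le> (n / p + 1) * c"
  proof (rule mult_right_mono)
    show "real m \<le> n / p + 1" unfolding m_def using of_nat_div_le_of_nat[of n p, where 'a=real] by simp
    have "0 \<le> partition_entropy \<mu> (iterated_partition T P p)" using partition_entropy_nonneg prob_space_axioms by blast
    then show "c \<ge> 0" using partition_entropy_eq[OF P, of p] c[of 0] by simp
  qed
  finally show ?thesis .
qed

text \<open>\<open>ks_entropy\<close> is written with \<open>lim\<close>, so actual convergence is
  shown: names of every length \<open>n\<close> are cut into blocks of one fixed length
  \<open>p = card (\<Gamma> N)\<close>. The phase costs \<open>ln (p + 1) / p\<close> per letter,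
  which is small because the cardinalities tend to infinity.\<close>

lemma ks_entropy_zero: "ks_entropy T \<mu> = 0"
proof -
  have "(\<lambda>n. partition_entropy \<mu> (iterated_partition T P n) / real n) \<longlonglongrightarrow> 0" if P: "finite_borel_partition P" for P
  proof (rule tendstoI)
    fix e :: real assume e: "e > 0"
    define C where "C = 2 * real (card P) + 1"
    have C: "C \<ge> 1" unfolding C_def by simp
    \<comment> \<open>Squared because the cost of corrections per letter is at most
      \<open>C * sqrt \<xi>\<close>; the cap \<open>1/2\<close> keeps
      \<open>\<xi> < 1\<close>.\<close>
    define \<xi> where "\<xi> = min (1/2) ((e / (4 * C))\<^sup>2)"
    have \<xi>: "0 < \<xi>" "\<xi> < 1" unfolding \<xi>_def using e C by auto
    have sq: "sqrt \<xi> \<le> e / (4 * C)" unfolding \<xi>_def using e C by (intro real_le_lsqrt) auto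
    have "\<xi> \<le> sqrt \<xi>" using \<xi> by (intro real_le_rsqrt) (simp add: power2_eq_square mult_left_le)
    then have "2 * card P * sqrt \<xi> + \<xi> \<le> C * sqrt \<xi>" unfolding C_def by (simp add: algebra_simps)
    also have "\<dots> \<le> C * (e / (4 * C))" using sq C by (intro mult_left_mono) auto
    also have "\<dots> = e / 4" using C by simp
    finally have f: "2 * card P * sqrt \<xi> + \<xi> \<le> e / 4" .
    have "(\<lambda>k::nat. ln (real k + 1) / real k) \<longlonglongrightarrow> 0"
    proof (rule tendsto_sandwich[of "\<lambda>_. 0"])
      show "(\<lambda>k::nat. ln 2 / real k + ln (real k) / real k) \<longlonglongrightarrow> 0"
        using tendsto_add[OF lim_const_over_n[of "ln 2 :: real"] lim_ln_over_n] by simp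
      show "eventually (\<lambda>k::nat. ln (real k + 1) / real k \<le> ln 2 / real k + ln (real k) / real k) sequentially"
        using eventually_ge_at_top[of 1]
      proof eventually_elim
        case (elim k)
        then have "ln (real k + 1) \<le> ln (2 * real k)" by simp
        also have "\<dots> = ln 2 + ln (real k)" using elim by (simp add: ln_mult)
        finally show ?case by (simp add: add_divide_distrib[symmetric] divide_right_mono)
      qed
    qed (auto intro!: always_eventually)
    then have "(\<lambda>N. ln (real (card (\<Gamma> N)) + 1) / real (card (\<Gamma> N))) \<longlonglongrightarrow> 0"
      using orb unfolding orbit_sequence_def by (auto intro: filterlim_compose)
    then have "eventually (\<lambda>N. ln (real (card (\<Gamma> N)) + 1) / real (card (\<Gamma> N)) < e / 4) sequentially"
      using e by (intro order_tendstoD(2)) auto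
    from eventually_happens'[OF sequentially_bot eventually_conj[OF this block_entropy[OF P \<xi>]]]
    obtain N where N': "ln (real (card (\<Gamma> N)) + 1) / real (card (\<Gamma> N)) < e / 4 \<and> N \<ge> 1 \<and>
      (\<forall>k. I.entropy_Pow (\<lambda>x. name_word T P (card (\<Gamma> N)) ((T ^^ k) x))
        \<le> ln (card (\<Gamma> N) + 1) + card (\<Gamma> N) * (2 * card P * sqrt \<xi> + \<xi>))" by (elim exE)
    note N = N'[THEN conjunct1] N'[THEN conjunct2, THEN conjunct1] N'[THEN conjunct2, THEN conjunct2, THEN spec]
    define p where "p = card (\<Gamma> N)"
    have p: "p > 0" unfolding p_def using orbit_finite(3)[OF N(2)] .
    define c where "c = ln (p + 1) + p * (2 * card P * sqrt \<xi> + \<xi>)"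
    have "c / p = ln (real p + 1) / p + (2 * card P * sqrt \<xi> + \<xi>)" unfolding c_def using p by (simp add: add_divide_distrib add.commute)
    then have cp: "c / p < e / 2" using N(1) f unfolding p_def by linarith
    have "(\<lambda>n. c / real n) \<longlonglongrightarrow> 0" by (intro tendsto_divide_0[OF tendsto_const] filterlim_at_top_imp_at_infinity filterlim_real_sequentially)
    then have "eventually (\<lambda>n. c / real n < e / 2) sequentially" using e by (intro order_tendstoD(2)) auto
    then show "eventually (\<lambda>n. dist (partition_entropy \<mu> (iterated_partition T P n) / real n) 0 < e) sequentially"
      using eventually_gt_at_top[of 0]
    proof eventually_elim
      case (elim n)
      have H: "partition_entropy \<mu> (iterated_partition T P n) \<le> (n / p + 1) * c"
        unfolding partition_entropy_eq[OF P] c_def p_def using N(3) p unfolding p_def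
        by (intro name_word_entropy_le[OF P]) auto
      have "partition_entropy \<mu> (iterated_partition T P n) / n \<le> (n / p + 1) * c / n"
        using H by (intro divide_right_mono) auto
      also have "\<dots> = c / p + c / n" using elim by (simp add: field_simps)
      finally have "partition_entropy \<mu> (iterated_partition T P n) / n < e" using cp elim by linarith
      then show ?case using partition_entropy_nonneg[OF prob_space_axioms] by simp
    qed
  qed
  then have L: "lim (\<lambda>n. partition_entropy \<mu> (iterated_partition T P n) / real n) = 0" if "finite_borel_partition P" for P
    using that by (intro limI)
  \<comment> \<open>The supremum runs over a nonempty set; over the empty set it would be minus
    infinity.\<close>
  have "finite_borel_partition {UNIV :: 'a set}" unfolding finite_borel_partition_def partition_on_def by auto
  then have "Collect finite_borel_partition \<noteq> ({} :: 'a set set set)" by blast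
  moreover have "ks_entropy T \<mu> = (SUP P\<in>Collect (finite_borel_partition :: 'a set set \<Rightarrow> bool). 0)"
    unfolding ks_entropy_def using L by (intro SUP_cong) (auto simp: zero_ereal_def)
  ultimately show ?thesis by simp
qed

lemma loosely_kronecker:
  assumes "\<And>a. measure \<mu> {a} = 0"
  shows "loosely_kronecker T \<mu>"
  unfolding loosely_kronecker_def using ergodic ks_entropy_zero loosely_kronecker_words[OF assms] by auto

end

section \<open>Atoms of ergodic measures\<close>

lemma ergodic_atom_imp_periodic:
  fixes T :: "'a::metric_space \<Rightarrow> 'a"
  assumes erg: "ergodic_measure T \<mu>" and a: "measure \<mu> {a} \<noteq> 0"
  shows "periodic_measure T \<mu>" "\<exists>p>0. (T ^^ p) a = a"
proof -
  have inv: "invariant_measure T \<mu>" using erg unfolding ergodic_measure_iff by auto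
  have bp: "borel_probability \<mu>" and T: "T \<in> borel_measurable borel"
    using inv unfolding invariant_measure_def by auto
  interpret prob_space \<mu> using borel_probabilityD(1)[OF bp] .
  note [simp] = borel_probabilityD(2-)[OF bp]
  have apos: "measure \<mu> {a} > 0" using a by (simp add: zero_less_measure_iff)
  have pre: "(T ^^ n) -` B \<in> sets borel" if "B \<in> sets borel" for n B
    using measurable_sets[OF measurable_compose_n[OF T] that] by simp
  show per: "\<exists>p>0. (T ^^ p) a = a"
  proof (rule ccontr)
    assume no: "\<not> ?thesis"
    \<comment> \<open>If \<open>a\<close> never returns, its preimages are disjoint, and they all
      have the mass of \<open>a\<close>; infinitely many do not fit into a probability
      space.\<close>
    have "disjoint_family (\<lambda>n. (T ^^ n) -` {a})"
      unfolding disjoint_family_on_def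
    proof (intro ballI impI)
      have *: "(T ^^ m) -` {a} \<inter> (T ^^ n) -` {a} = {}" if "m < n" for m n :: nat
      proof -
        have "(T ^^ n) x = (T ^^ (n - m)) ((T ^^ m) x)" for x
          using that by (metis comp_apply funpow_add le_add_diff_inverse2 less_imp_le)
        then have "(T ^^ (n - m)) a = a" if "(T ^^ m) x = a" "(T ^^ n) x = a" for x
          using that by metis
        moreover have "(T ^^ (n - m)) a \<noteq> a" using no \<open>m < n\<close> zero_less_diff by blast
        ultimately have "\<not> ((T ^^ m) x = a \<and> (T ^^ n) x = a)" for x by blast
        then show ?thesis by blast
      qed
      fix m n :: nat assume "m \<noteq> n"
      then show "(T ^^ m) -` {a} \<inter> (T ^^ n) -` {a} = {}" using *[of m n] *[of n m] by (metis Int_commute linorder_neqE_nat)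
    qed
    then have "(\<lambda>n. measure \<mu> ((T ^^ n) -` {a})) sums measure \<mu> (\<Union>n. (T ^^ n) -` {a})"
      using pre by (intro finite_measure_UNION) auto
    then have "summable (\<lambda>n::nat. measure \<mu> {a})"
      using invariant_measure_vimage[OF inv, of "{a}"] by (simp add: sums_iff)
    then show False using a by (simp add: summable_const_iff)
  qed
  then obtain p where p: "p > 0" "(T ^^ p) a = a" by blast
  define \<Gamma> where "\<Gamma> = (\<lambda>j. (T ^^ j) a) ` {..<p}"
  have orb: "periodic_orbit T \<Gamma>" unfolding periodic_orbit_def \<Gamma>_def using p by blast
  have fin: "finite \<Gamma>" "\<Gamma> \<noteq> {}" unfolding \<Gamma>_def using p by auto
  have aG: "a \<in> \<Gamma>" unfolding \<Gamma>_def using p by force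
  have G: "\<Gamma> \<in> sets borel" using fin by (intro borel_closed finite_imp_closed)
  \<comment> \<open>Ergodicity speaks of sets equal to their preimage, whereas
    \<open>\<Gamma>\<close> may have preimages outside itself. Its saturation is such a set and, as
    an increasing union of preimages, has the same measure.\<close>
  define A where "A = (\<Union>n. (T ^^ n) -` \<Gamma>)"
  have mono: "incseq (\<lambda>n. (T ^^ n) -` \<Gamma>)"
    unfolding incseq_Suc_iff using periodic_orbit_image[OF orb] by auto
  have "T -` A = (\<Union>n. (T ^^ Suc n) -` \<Gamma>)" unfolding A_def by (auto simp: funpow_swap1)
  also have "\<dots> = A"
  proof (intro equalityI subsetI)
    fix x assume "x \<in> A"
    then obtain n where "x \<in> (T ^^ n) -` \<Gamma>" unfolding A_def by blast
    moreover have "(T ^^ n) -` \<Gamma> \<subseteq> (T ^^ Suc n) -` \<Gamma>" using incseqD[OF mono, of n "Suc n"] by simp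
    ultimately have "x \<in> (T ^^ Suc n) -` \<Gamma>" by (rule subsetD[rotated])
    then show "x \<in> (\<Union>n. (T ^^ Suc n) -` \<Gamma>)" by blast
  qed (auto simp: A_def simp del: funpow.simps)
  finally have TA: "T -` A = A" .
  have A: "A \<in> sets borel" unfolding A_def using pre[OF G] by auto
  have "(\<lambda>n. measure \<mu> ((T ^^ n) -` \<Gamma>)) \<longlonglongrightarrow> measure \<mu> A"
    unfolding A_def using mono pre[OF G] by (intro finite_Lim_measure_incseq) auto
  then have mA: "measure \<mu> A = measure \<mu> \<Gamma>"
    unfolding invariant_measure_vimage[OF inv G] by (simp add: LIMSEQ_const_iff)
  have "measure \<mu> {a} \<le> measure \<mu> \<Gamma>" using aG G by (intro finite_measure_mono) auto
  then have "measure \<mu> A \<noteq> 0" using mA apos by linarith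
  then have "measure \<mu> A = 1" using erg A TA unfolding ergodic_measure_iff by blast
  then have mG: "measure \<mu> \<Gamma> = 1" using mA by simp
  \<comment> \<open>Point masses cannot decrease along the orbit; on a cycle they are therefore
    equal.\<close>
  have le: "measure \<mu> {x} \<le> measure \<mu> {(T ^^ n) x}" for x n
  proof -
    have "measure \<mu> {x} \<le> measure \<mu> ((T ^^ n) -` {(T ^^ n) x})" using pre by (intro finite_measure_mono) auto
    then show ?thesis using invariant_measure_vimage[OF inv, of "{(T ^^ n) x}" n] by simp
  qed
  have same: "measure \<mu> {x} = measure \<mu> {a}" if "x \<in> \<Gamma>" for x
  proof -
    have 1: "x \<in> (\<lambda>j. (T ^^ j) a) ` {..<card \<Gamma>}" and 2: "a \<in> (\<lambda>j. (T ^^ j) x) ` {..<card \<Gamma>}"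
      using periodic_orbit_eq[OF orb aG] periodic_orbit_eq[OF orb \<open>x \<in> \<Gamma>\<close>] aG \<open>x \<in> \<Gamma>\<close> by blast+
    obtain i where i: "x = (T ^^ i) a" using 1 by (rule imageE)
    obtain j where j: "a = (T ^^ j) x" using 2 by (rule imageE)
    show ?thesis using le[of a i] le[of x j] unfolding i[symmetric] j[symmetric] by (rule antisym[rotated])
  qed
  have sumF: "measure \<mu> F = card F * measure \<mu> {a}" if "F \<subseteq> \<Gamma>" for F
  proof -
    have "finite F" using that fin finite_subset by blast
    then have "measure \<mu> F = (\<Sum>x\<in>F. measure \<mu> {x})" by (intro finite_measure_eq_sum_singleton) auto
    also have "\<dots> = (\<Sum>x\<in>F. measure \<mu> {a})" using same that by (intro sum.cong) auto
    finally show ?thesis by simp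
  qed
  have ca: "measure \<mu> {a} = 1 / card \<Gamma>" using sumF[of \<Gamma>] mG fin by (simp add: field_simps)
  have bo: "borel_probability (orbit_measure \<Gamma>)" by (rule borel_probability_orbit_measure[OF fin])
  interpret O: prob_space "orbit_measure \<Gamma>" using borel_probabilityD(1)[OF bo] .
  have "\<mu> = orbit_measure \<Gamma>"
  proof (rule measure_eqI)
    show "sets \<mu> = sets (orbit_measure \<Gamma>)" using borel_probabilityD(2)[OF bo] by simp
    fix B assume "B \<in> sets \<mu>"
    then have B: "B \<in> sets borel" by simp
    have "measure \<mu> B \<le> measure \<mu> ((\<Gamma> \<inter> B) \<union> (UNIV - \<Gamma>))" using B G by (intro finite_measure_mono) auto
    also have "\<dots> \<le> measure \<mu> (\<Gamma> \<inter> B) + measure \<mu> (UNIV - \<Gamma>)" using B G by (intro measure_Un_le) auto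
    also have "measure \<mu> (UNIV - \<Gamma>) = 0" using prob_compl[of \<Gamma>] G mG by simp
    finally have "measure \<mu> B \<le> measure \<mu> (\<Gamma> \<inter> B)" by simp
    moreover have "measure \<mu> (\<Gamma> \<inter> B) \<le> measure \<mu> B" using B by (intro finite_measure_mono) auto
    ultimately have "measure \<mu> B = measure \<mu> (\<Gamma> \<inter> B)" by simp
    also have "\<dots> = measure (orbit_measure \<Gamma>) B"
      using sumF[of "\<Gamma> \<inter> B"] ca measure_orbit_measure[OF fin B] by simp
    finally show "emeasure \<mu> B = emeasure (orbit_measure \<Gamma>) B" by (simp add: emeasure_eq_measure O.emeasure_eq_measure)
  qed
  then show "periodic_measure T \<mu>" unfolding periodic_measure_def using orb by blast
qed

lemma aperiodic_imp_no_atom: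
  fixes T :: "'a::metric_space \<Rightarrow> 'a"
  assumes "ergodic_measure T \<mu>" "aperiodic_measure T \<mu>"
  shows "measure \<mu> {a} = 0"
proof (rule ccontr)
  assume a: "measure \<mu> {a} \<noteq> 0"
  have bp: "borel_probability \<mu>" using assms unfolding ergodic_measure_def by auto
  note [simp] = borel_probabilityD(2-)[OF bp]
  have "{a} \<subseteq> {x. \<exists>p>0. (T ^^ p) x = x}" using ergodic_atom_imp_periodic(2)[OF assms(1) a] by auto
  then have "{a} \<in> null_sets \<mu>"
    using assms(2) unfolding aperiodic_measure_def by (rule null_sets_subset[rotated 2]) simp
  then show False using a by (simp add: measure_eq_0_null_sets)
qed

section \<open>Birkhoff's theorem\<close>

text \<open>The maximum of the Birkhoff sums of lengths 0 to \<open>n\<close>. The recursion through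
  \<open>T x\<close> is the identity behind the maximal ergodic theorem.\<close>

primrec running_max :: "('a \<Rightarrow> 'a) \<Rightarrow> ('a \<Rightarrow> real) \<Rightarrow> nat \<Rightarrow> 'a \<Rightarrow> real" where
  "running_max T f 0 x = 0"
| "running_max T f (Suc n) x = max 0 (f x + running_max T f n (T x))"

lemma sum_le_running_max: "(\<Sum>j<n. f ((T ^^ j) x)) \<le> running_max T f n x"
proof (induction n arbitrary: x)
  case (Suc n)
  have "(\<Sum>j<Suc n. f ((T ^^ j) x)) = f x + (\<Sum>j<n. f ((T ^^ j) (T x)))"
    by (subst sum.lessThan_Suc_shift) (simp add: funpow_swap1)
  then show ?case using Suc[of "T x"] by simp
qed simp

lemma running_max_nonneg: "0 \<le> running_max T f n x"
  by (cases n) auto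

lemma running_max_mono: "running_max T f n x \<le> running_max T f (Suc n) x"
proof (induction n arbitrary: x)
  case (Suc n)
  show ?case using Suc[of "T x"] by (auto simp: max_def)
qed simp

lemma running_max_measurable:
  assumes [measurable]: "T \<in> borel_measurable borel" "f \<in> borel_measurable borel"
  shows "running_max T f n \<in> borel_measurable borel"
proof (induction n)
  case 0
  have "running_max T f 0 = (\<lambda>x. 0)" by auto
  then show ?case by simp
next
  case (Suc n)
  note [measurable] = Suc
  have "running_max T f (Suc n) = (\<lambda>x. max 0 (f x + running_max T f n (T x)))" by auto
  also have "\<dots> \<in> borel_measurable borel" by measurable
  finally show ?case .
qed

text \<open>The set where the running maxima \<open>F n\<close> are unbounded is invariant, and on it
  \<open>F (Suc n) - F n \<circ> T\<close>, whose integral is nonnegative, converges to \<open>f\<close>.\<close>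

lemma ergodic_sums_bounded_above:
  fixes f :: "'a::topological_space \<Rightarrow> real"
  assumes erg: "ergodic_measure T \<mu>" and f: "f \<in> borel_measurable borel" "\<And>x. \<bar>f x\<bar> \<le> B"
    and neg: "integral\<^sup>L \<mu> f < 0"
  shows "AE x in \<mu>. \<exists>C. \<forall>n. (\<Sum>j<n. f ((T ^^ j) x)) \<le> C"
proof -
  have inv: "invariant_measure T \<mu>" using erg unfolding ergodic_measure_iff by auto
  have bp: "borel_probability \<mu>" and T [measurable]: "T \<in> borel_measurable borel"
    using inv unfolding invariant_measure_def by auto
  interpret prob_space \<mu> using borel_probabilityD(1)[OF bp] .
  note [simp] = borel_probabilityD(2-)[OF bp]
  note f(1) [measurable]
  define F where "F = running_max T f"
  have F0: "F n x \<ge> 0" for n x unfolding F_def by (rule running_max_nonneg)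
  have Fm [measurable]: "F n \<in> borel_measurable borel" for n unfolding F_def by (rule running_max_measurable[OF T f(1)])
  have FS: "F (Suc n) x = max 0 (f x + F n (T x))" for n x unfolding F_def by simp
  have mono: "F m x \<le> F n x" if "m \<le> n" for m n x
    using lift_Suc_mono_le[of "\<lambda>n. F n x", OF _ that] running_max_mono unfolding F_def by metis
  have B0: "B \<ge> 0" using f(2)[of undefined] by linarith
  have FB: "F n x \<le> n * B" for n x
  proof (induction n arbitrary: x)
    case 0
    then show ?case unfolding F_def by simp
  next
    case (Suc n)
    have "f x + F n (T x) \<le> B + n * B" using f(2)[of x] Suc[of "T x"] by linarith
    moreover have "0 \<le> B + n * B" using B0 by simp
    ultimately show ?case unfolding FS by (simp add: algebra_simps)
  qed
  \<comment> \<open>Integer thresholds keep the set a countable combination of Borel sets. One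
    application of \<open>T\<close> changes a running maximum above \<open>B\<close> by at most
    \<open>B\<close>, whence the choice \<open>B + C < D\<close> below.\<close>
  define A where "A = {x. \<forall>C::nat. \<exists>n. F n x > C}"
  have Am: "A \<in> sets borel" unfolding A_def by measurable
  have "T x \<in> A" if "x \<in> A" for x
    unfolding A_def
  proof (intro CollectI allI)
    fix C :: nat
    obtain D :: nat where D: "B + C < D" using reals_Archimedean2 by blast
    obtain n where n: "F n x > D" using \<open>x \<in> A\<close> unfolding A_def by auto
    have "F (Suc n) x > D" using n mono[of n "Suc n" x] by simp
    then have "f x + F n (T x) > D" unfolding FS using B0 D by (auto simp: max_def split: if_splits)
    then have "F n (T x) > C" using f(2)[of x] D by linarith
    then show "\<exists>n. F n (T x) > C" by blast
  qed
  moreover have "x \<in> A" if "T x \<in> A" for x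
    unfolding A_def
  proof (intro CollectI allI)
    fix C :: nat
    obtain D :: nat where D: "B + C < D" using reals_Archimedean2 by blast
    obtain n where n: "F n (T x) > D" using \<open>T x \<in> A\<close> unfolding A_def by auto
    have "F (Suc n) x \<ge> f x + F n (T x)" unfolding FS by simp
    then have "F (Suc n) x > C" using n D f(2)[of x] by linarith
    then show "\<exists>n. F n x > C" by blast
  qed
  ultimately have TA: "T -` A = A" by auto
  have "measure \<mu> A \<noteq> 1"
  proof
    assume A1: "measure \<mu> A = 1"
    then have aeA: "AE x in \<mu>. x \<in> A" using Am by (simp add: prob_eq_1)
    \<comment> \<open>By the recursion this is the maximum of \<open>f x\<close> and
      \<open>- F n (T x)\<close>: bounded by \<open>B\<close>, and equal to \<open>f x\<close> as
      soon as \<open>F n (T x) \<ge> B\<close>.\<close>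
    define g where "g n x = F (Suc n) x - F n (T x)" for n x
    have gm: "g n \<in> borel_measurable borel" for n unfolding g_def by measurable
    have gB: "\<bar>g n x\<bar> \<le> B" for n x
    proof -
      have "g n x = max (- F n (T x)) (f x)" unfolding g_def FS by (auto simp: max_def)
      then show ?thesis using f(2)[of x] F0[of n "T x"] B0 by (auto simp: max_def abs_le_iff)
    qed
    have intF: "integrable \<mu> (F n)" for n
      using FB F0 Fm by (intro integrable_const_bound[where B="n * B"]) auto
    have intFT: "integrable \<mu> (\<lambda>x. F n (T x))" for n
      using FB F0 by (intro integrable_const_bound[where B="n * B"]) auto
    have g0: "integral\<^sup>L \<mu> (g n) \<ge> 0" for n
    proof -
      have "integral\<^sup>L \<mu> (g n) = integral\<^sup>L \<mu> (F (Suc n)) - (\<integral>x. F n (T x) \<partial>\<mu>)"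
        unfolding g_def using intF intFT by (rule Bochner_Integration.integral_diff)
      also have "(\<integral>x. F n (T x) \<partial>\<mu>) = integral\<^sup>L \<mu> (F n)"
        using invariant_measure_integral[OF inv Fm[of n], of 1] by simp
      finally show ?thesis
        using integral_mono[OF intF intF, of n "Suc n"] mono[of n "Suc n"] by simp
    qed
    have "(\<lambda>n. integral\<^sup>L \<mu> (g n)) \<longlonglongrightarrow> integral\<^sup>L \<mu> f"
    proof (rule integral_dominated_convergence[where w="\<lambda>_. B"])
      show "AE x in \<mu>. (\<lambda>n. g n x) \<longlonglongrightarrow> f x"
        using aeA
      proof eventually_elim
        case (elim x)
        then have "T x \<in> A" using TA by auto
        obtain D :: nat where D: "B < D" using reals_Archimedean2 by blast
        obtain N where N: "F N (T x) > D" using \<open>T x \<in> A\<close> unfolding A_def by auto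
        have "g n x = f x" if "n \<ge> N" for n
        proof -
          have "f x + F n (T x) \<ge> 0" using N D mono[OF that, of "T x"] f(2)[of x] by linarith
          then show ?thesis unfolding g_def FS by simp
        qed
        then have "eventually (\<lambda>n. g n x = f x) sequentially" unfolding eventually_sequentially by blast
        then show ?case by (rule tendsto_eventually)
      qed
    qed (use gm gB f in auto)
    then have "integral\<^sup>L \<mu> f \<ge> 0" using g0 by (intro tendsto_lowerbound) auto
    then show False using neg by simp
  qed
  then have "measure \<mu> A = 0" using erg Am TA unfolding ergodic_measure_iff by blast
  then have "AE x in \<mu>. x \<notin> A" using Am by (simp add: prob_eq_0)
  then show ?thesis
  proof eventually_elim
    case (elim x)
    then obtain C :: nat where "\<And>n. F n x \<le> C" unfolding A_def by (auto simp: not_less)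
    then have "(\<Sum>j<n. f ((T ^^ j) x)) \<le> C" for n
      using sum_le_running_max[of f T x n] unfolding F_def by (metis order_trans)
    then show ?case by blast
  qed
qed

text \<open>The functions \<open>f - (c + e)\<close> and \<open>(c - e) - f\<close> have negative
  integral, so their sums are bounded above almost surely; after division by \<open>n\<close> the
  averages are squeezed between \<open>c - e\<close> and \<open>c + e\<close>. Countably many
  \<open>e\<close> suffice.\<close>

lemma birkhoff_ergodic:
  fixes f :: "'a::topological_space \<Rightarrow> real"
  assumes erg: "ergodic_measure T \<mu>" and f: "f \<in> borel_measurable borel" "\<And>x. \<bar>f x\<bar> \<le> B"
  shows "AE x in \<mu>. (\<lambda>n. (\<Sum>j<n. f ((T ^^ j) x)) / n) \<longlonglongrightarrow> integral\<^sup>L \<mu> f"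
proof -
  have bp: "borel_probability \<mu>" using erg unfolding ergodic_measure_iff invariant_measure_def by auto
  interpret prob_space \<mu> using borel_probabilityD(1)[OF bp] .
  note [simp] = borel_probabilityD(2-)[OF bp]
  define c where "c = integral\<^sup>L \<mu> f"
  have int: "integrable \<mu> f" using f by (intro integrable_const_bound[where B=B]) auto
  define e where "e k = 1 / real (Suc k)" for k
  have e: "e k > 0" for k unfolding e_def by simp
  have "AE x in \<mu>. \<exists>C. \<forall>n. (\<Sum>j<n. f ((T ^^ j) x) - (c + e k)) \<le> C" for k
    by (rule ergodic_sums_bounded_above[OF erg, where B="B + \<bar>c + e k\<bar>"])
      (use f int e[of k] prob_space in \<open>auto simp: c_def intro: order.trans[OF abs_triangle_ineq4] add_right_mono\<close>)
  then have 1: "AE x in \<mu>. \<forall>k. \<exists>C. \<forall>n. (\<Sum>j<n. f ((T ^^ j) x) - (c + e k)) \<le> C" by (simp add: AE_all_countable)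
  have "AE x in \<mu>. \<exists>C. \<forall>n. (\<Sum>j<n. (c - e k) - f ((T ^^ j) x)) \<le> C" for k
    by (rule ergodic_sums_bounded_above[OF erg, where B="\<bar>c - e k\<bar> + B"])
      (use f int e[of k] prob_space in \<open>auto simp: c_def intro: order.trans[OF abs_triangle_ineq4] add_left_mono\<close>)
  then have 2: "AE x in \<mu>. \<forall>k. \<exists>C. \<forall>n. (\<Sum>j<n. (c - e k) - f ((T ^^ j) x)) \<le> C" by (simp add: AE_all_countable)
  show ?thesis using 1 2
  proof eventually_elim
    case (elim x)
    define S where "S n = (\<Sum>j<n. f ((T ^^ j) x))" for n
    have "(\<lambda>n. S n / n) \<longlonglongrightarrow> c"
    proof (rule tendstoI)
      fix r :: real assume r: "r > 0"
      obtain k where k: "e k < r / 2" unfolding e_def using r nat_approx_posE[of "r / 2"] by auto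
      obtain C1 where C1: "\<And>n. (\<Sum>j<n. f ((T ^^ j) x) - (c + e k)) \<le> C1" using elim(1) by blast
      obtain C2 where C2: "\<And>n. (\<Sum>j<n. (c - e k) - f ((T ^^ j) x)) \<le> C2" using elim(2) by blast
      have C1': "S n - n * (c + e k) \<le> C1" for n using C1[of n] unfolding S_def by (simp add: sum_subtractf)
      have C2': "n * (c - e k) - S n \<le> C2" for n using C2[of n] unfolding S_def by (simp add: sum_subtractf)
      have "(\<lambda>n. C1 / real n) \<longlonglongrightarrow> 0" "(\<lambda>n. C2 / real n) \<longlonglongrightarrow> 0" by (rule lim_const_over_n)+
      then have "eventually (\<lambda>n. C1 / real n < r / 2) sequentially" "eventually (\<lambda>n. C2 / real n < r / 2) sequentially"
        using r by (metis order_tendstoD(2) half_gt_zero)+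
      then show "eventually (\<lambda>n. dist (S n / n) c < r) sequentially"
        using eventually_gt_at_top[of 0]
      proof eventually_elim
        case (elim n)
        have "S n / n \<le> (C1 + n * (c + e k)) / n" using C1'[of n] by (intro divide_right_mono) auto
        also have "\<dots> = C1 / n + (c + e k)" using elim by (simp add: add_divide_distrib)
        finally have u: "S n / n < c + r" using elim k by linarith
        have "(n * (c - e k) - C2) / n \<le> S n / n" using C2'[of n] by (intro divide_right_mono) auto
        moreover have "(n * (c - e k) - C2) / n = (c - e k) - C2 / n" using elim by (simp add: diff_divide_distrib)
        ultimately have "S n / n > c - r" using elim k by linarith
        then show ?case using u by (auto simp: dist_real_def abs_less_iff)
      qed
    qed
    then show ?case unfolding S_def c_def .
  qed
qed

section \<open>Existence of the limit measure\<close>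

text \<open>From independent uniform points \<open>b\<close> of \<open>\<Lambda>\<close> and \<open>w\<close> of \<open>\<Gamma>\<close> one obtains a uniform point \<open>g b w\<close> of \<open>\<Gamma>\<close>
  that is close to \<open>b\<close> with probability at least \<open>\<kappa>\<close>.\<close>

lemma coupling_step:
  assumes ga: "good_approximation T \<gamma> \<kappa> \<Gamma> \<Lambda>"
  obtains g where "\<And>b w. b \<in> \<Lambda> \<Longrightarrow> w \<in> \<Gamma> \<Longrightarrow> g b w \<in> \<Gamma>"
    "\<And>c. c \<in> \<Gamma> \<Longrightarrow> card {(b, w). b \<in> \<Lambda> \<and> w \<in> \<Gamma> \<and> g b w = c} = card \<Lambda>"
    "real (card {(b, w). b \<in> \<Lambda> \<and> w \<in> \<Gamma> \<and> \<not> dist b (g b w) < \<gamma>}) \<le> (1 - \<kappa>) * (card \<Lambda> * card \<Gamma>)"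
proof -
  have per: "periodic_orbit T \<Gamma>" "periodic_orbit T \<Lambda>" using ga unfolding good_approximation_def by auto
  have fin: "finite \<Gamma>" "finite \<Lambda>" "card \<Lambda> > 0" using per periodic_orbit_finite periodic_orbit_card_pos by metis+
  obtain \<Delta> \<psi> k where *: "\<Delta> \<subseteq> \<Gamma>" "\<kappa> * card \<Gamma> \<le> card \<Delta>" "\<psi> ` \<Delta> = \<Lambda>"
    "\<And>z. z \<in> \<Lambda> \<Longrightarrow> card {y\<in>\<Delta>. \<psi> y = z} = k" "card \<Delta> = k * card \<Lambda>" "k > 0"
    "\<And>y j. y \<in> \<Delta> \<Longrightarrow> j < card \<Lambda> \<Longrightarrow> dist ((T ^^ j) y) ((T ^^ j) (\<psi> y)) < \<gamma>"
    using good_approximationE[OF ga] by blast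
  have finD: "finite \<Delta>" using * fin finite_subset by metis
  have "\<exists>\<beta>. bij_betw \<beta> {y\<in>\<Delta>. \<psi> y = u} {y\<in>\<Delta>. \<psi> y = b}" if "u \<in> \<Lambda>" "b \<in> \<Lambda>" for u b
    using that *(4) finD by (intro finite_same_card_bij) auto
  note ex = this
  define \<beta> where "\<beta> u b = (SOME \<beta>. bij_betw \<beta> {y\<in>\<Delta>. \<psi> y = u} {y\<in>\<Delta>. \<psi> y = b})" for u b
  have \<beta>: "bij_betw (\<beta> u b) {y\<in>\<Delta>. \<psi> y = u} {y\<in>\<Delta>. \<psi> y = b}" if "u \<in> \<Lambda>" "b \<in> \<Lambda>" for u b
    unfolding \<beta>_def by (rule someI_ex[OF ex[OF that]])
  \<comment> \<open>A point \<open>w\<close> of \<open>\<Delta>\<close> is carried to the fibre over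
    \<open>b\<close> by a fixed bijection of fibres, available because all fibres have the same
    size; a point outside \<open>\<Delta>\<close> is kept, and closeness to \<open>b\<close> is
    given up.\<close>
  define g where "g b w = (if w \<in> \<Delta> then \<beta> (\<psi> w) b w else w)" for b w
  have g\<Delta>: "g b w \<in> \<Delta> \<and> \<psi> (g b w) = b" if "w \<in> \<Delta>" "b \<in> \<Lambda>" for b w
    using bij_betwE[OF \<beta>[of "\<psi> w" b]] that *(3) unfolding g_def by auto
  show thesis
  proof (rule that)
    show "g b w \<in> \<Gamma>" if "b \<in> \<Lambda>" "w \<in> \<Gamma>" for b w
      using g\<Delta>[of w b] that *(1) unfolding g_def by (cases "w \<in> \<Delta>") auto
    show "card {(b, w). b \<in> \<Lambda> \<and> w \<in> \<Gamma> \<and> g b w = c} = card \<Lambda>" if c: "c \<in> \<Gamma>" for c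
    proof (cases "c \<in> \<Delta>")
      case False
      have "{(b, w). b \<in> \<Lambda> \<and> w \<in> \<Gamma> \<and> g b w = c} = (\<lambda>b. (b, c)) ` \<Lambda>"
      proof (intro equalityI subsetI)
        fix q assume "q \<in> {(b, w). b \<in> \<Lambda> \<and> w \<in> \<Gamma> \<and> g b w = c}"
        then obtain b w where q: "q = (b, w)" "b \<in> \<Lambda>" "w \<in> \<Gamma>" "g b w = c" by blast
        have "w \<notin> \<Delta>" using g\<Delta>[of w b] q False by metis
        then have "w = c" using q unfolding g_def by simp
        then show "q \<in> (\<lambda>b. (b, c)) ` \<Lambda>" using q by blast
      qed (use False c in \<open>auto simp: g_def\<close>)
      then show ?thesis by (simp add: card_image inj_on_def)
    next
      case True
      have pc: "\<psi> c \<in> \<Lambda>" using True *(3) by auto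
      define S where "S = {(b, w). b \<in> \<Lambda> \<and> w \<in> \<Gamma> \<and> g b w = c}"
      have S: "b = \<psi> c \<and> w \<in> \<Delta> \<and> \<beta> (\<psi> w) (\<psi> c) w = c" if "(b, w) \<in> S" for b w
      proof -
        have bw: "b \<in> \<Lambda>" "g b w = c" using that unfolding S_def by auto
        then have "w \<in> \<Delta>" using True unfolding g_def by (auto split: if_splits)
        then show ?thesis using g\<Delta>[of w b] bw unfolding g_def by auto
      qed
      \<comment> \<open>Here \<open>b\<close> must be \<open>\<psi> c\<close>, and each fibre of
        \<open>\<psi>\<close> contains exactly one \<open>w\<close> that is carried to
        \<open>c\<close>. The solutions are thus indexed by the fibres, that is by
        \<open>\<Lambda>\<close>.\<close>
      have "bij_betw (\<lambda>(b, w). \<psi> w) S \<Lambda>"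
        unfolding bij_betw_def
      proof
        show "inj_on (\<lambda>(b, w). \<psi> w) S"
        proof (rule inj_onI)
          fix q q' assume h: "q \<in> S" "q' \<in> S" "(case q of (b, w) \<Rightarrow> \<psi> w) = (case q' of (b, w) \<Rightarrow> \<psi> w)"
          obtain b w b' w' where q: "q = (b, w)" "q' = (b', w')" by fastforce
          have 1: "b = \<psi> c" "w \<in> \<Delta>" "\<beta> (\<psi> w) (\<psi> c) w = c" using S[of b w] h q by auto
          have 2: "b' = \<psi> c" "w' \<in> \<Delta>" "\<beta> (\<psi> w') (\<psi> c) w' = c" using S[of b' w'] h q by auto
          have 3: "\<psi> w = \<psi> w'" using h q by simp
          have "\<psi> w \<in> \<Lambda>" using 1(2) *(3) by auto
          then have "inj_on (\<beta> (\<psi> w) (\<psi> c)) {y\<in>\<Delta>. \<psi> y = \<psi> w}" using \<beta>[of "\<psi> w" "\<psi> c"] pc by (auto simp: bij_betw_def)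
          then have "w = w'" using 1 2 3 inj_onD[of "\<beta> (\<psi> w) (\<psi> c)" _ w w'] by simp
          then show "q = q'" using q 1 2 by simp
        qed
        show "(\<lambda>(b, w). \<psi> w) ` S = \<Lambda>"
        proof (intro equalityI subsetI)
          fix u assume u: "u \<in> \<Lambda>"
          have "c \<in> \<beta> u (\<psi> c) ` {y\<in>\<Delta>. \<psi> y = u}"
            using bij_betw_imp_surj_on[OF \<beta>[OF u pc]] True by auto
          then obtain w where "c = \<beta> u (\<psi> c) w" "w \<in> {y\<in>\<Delta>. \<psi> y = u}" by (rule imageE)
          then have w: "w \<in> \<Delta>" "\<psi> w = u" "\<beta> u (\<psi> c) w = c" by simp_all
          then have "(\<psi> c, w) \<in> S" unfolding S_def g_def using pc *(1) by auto
          then show "u \<in> (\<lambda>(b, w). \<psi> w) ` S" using w(2) by force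
        next
          fix u assume "u \<in> (\<lambda>(b, w). \<psi> w) ` S"
          then obtain b w where "(b, w) \<in> S" "u = \<psi> w" by auto
          then show "u \<in> \<Lambda>" using S[of b w] *(3) by auto
        qed
      qed
      then show ?thesis unfolding S_def[symmetric] by (rule bij_betw_same_card)
    qed
    have "{(b, w). b \<in> \<Lambda> \<and> w \<in> \<Gamma> \<and> \<not> dist b (g b w) < \<gamma>} \<subseteq> \<Lambda> \<times> (\<Gamma> - \<Delta>)"
    proof
      fix q assume "q \<in> {(b, w). b \<in> \<Lambda> \<and> w \<in> \<Gamma> \<and> \<not> dist b (g b w) < \<gamma>}"
      then obtain b w where q: "q = (b, w)" "b \<in> \<Lambda>" "w \<in> \<Gamma>" "\<not> dist b (g b w) < \<gamma>" by blast
      have "w \<notin> \<Delta>"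
      proof
        assume "w \<in> \<Delta>"
        then have "dist (g b w) b < \<gamma>" using g\<Delta>[of w b] q(2) *(7)[of "g b w" 0] fin(3) by auto
        then show False using q(4) by (simp add: dist_commute)
      qed
      then show "q \<in> \<Lambda> \<times> (\<Gamma> - \<Delta>)" using q by simp
    qed
    then have "card {(b, w). b \<in> \<Lambda> \<and> w \<in> \<Gamma> \<and> \<not> dist b (g b w) < \<gamma>} \<le> card (\<Lambda> \<times> (\<Gamma> - \<Delta>))"
      using fin by (intro card_mono) auto
    also have "\<dots> = card \<Lambda> * (card \<Gamma> - card \<Delta>)"
      using *(1) finD by (simp add: card_cartesian_product card_Diff_subset)
    finally have "real (card {(b, w). b \<in> \<Lambda> \<and> w \<in> \<Gamma> \<and> \<not> dist b (g b w) < \<gamma>}) \<le> real (card \<Lambda> * (card \<Gamma> - card \<Delta>))"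
      by (rule of_nat_mono)
    also have "\<dots> = real (card \<Lambda>) * (real (card \<Gamma>) - real (card \<Delta>))"
      using card_mono[OF fin(1) *(1)] by (simp add: of_nat_diff)
    also have "\<dots> \<le> real (card \<Lambda>) * (card \<Gamma> - \<kappa> * card \<Gamma>)" using *(2) by (intro mult_left_mono) auto
    finally show "real (card {(b, w). b \<in> \<Lambda> \<and> w \<in> \<Gamma> \<and> \<not> dist b (g b w) < \<gamma>}) \<le> (1 - \<kappa>) * (card \<Lambda> * card \<Gamma>)"
      by (simp add: algebra_simps)
  qed
qed

lemma summable_dist_imp_Cauchy:
  fixes y :: "nat \<Rightarrow> 'a::metric_space"
  assumes "eventually (\<lambda>n. dist (y n) (y (Suc n)) \<le> \<gamma> n) sequentially" "summable \<gamma>"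
  shows "Cauchy y"
proof (rule metric_CauchyI)
  fix e :: real assume e: "e > 0"
  obtain N1 where N1: "\<And>n. n \<ge> N1 \<Longrightarrow> dist (y n) (y (Suc n)) \<le> \<gamma> n"
    using assms(1) unfolding eventually_sequentially by blast
  obtain N2 where N2: "\<And>m n. m \<ge> N2 \<Longrightarrow> norm (sum \<gamma> {m..<n}) < e"
    using assms(2) e unfolding summable_Cauchy by metis
  define N where "N = max N1 N2"
  have le: "dist (y m) (y n) \<le> sum \<gamma> {m..<n}" if "m \<ge> N" "m \<le> n" for m n
    using that(2)
  proof (induction n rule: dec_induct)
    case (step n)
    have "dist (y m) (y (Suc n)) \<le> dist (y m) (y n) + dist (y n) (y (Suc n))" by (rule dist_triangle)
    also have "\<dots> \<le> sum \<gamma> {m..<n} + \<gamma> n" using step N1[of n] \<open>m \<ge> N\<close> unfolding N_def by auto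
    finally show ?case using step by simp
  qed simp
  have lt: "dist (y m) (y n) < e" if "m \<ge> N" "m \<le> n" for m n
    using le[OF that] N2[of m n] that unfolding N_def by (auto simp: abs_less_iff)
  have "dist (y m) (y n) < e" if "m \<ge> N" "n \<ge> N" for m n
    using lt[of m n] lt[of n m] that by (cases "m \<le> n") (auto simp: dist_commute)
  then show "\<exists>M. \<forall>m\<ge>M. \<forall>n\<ge>M. dist (y m) (y n) < e" by blast
qed

text \<open>Iterating the coupling gives random points \<open>y n\<close>, uniform on \<open>G n\<close>, which converge almost surely
  by the Borel-Cantelli lemma. The limit measure is the law of their limit.\<close>

lemma weak_star_limit_exists:
  fixes G :: "nat \<Rightarrow> 'a::metric_space set"
  assumes comp: "compact (UNIV :: 'a set)"
    and ga: "\<And>n. good_approximation T (\<gamma> n) (\<kappa> n) (G (Suc n)) (G n)"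
    and sm: "summable \<gamma>" "summable (\<lambda>n. 1 - \<kappa> n)"
  shows "\<exists>\<mu>. weak_star_limit (\<lambda>n. orbit_measure (G n)) \<mu>"
proof -
  have per: "periodic_orbit T (G n)" for n using ga unfolding good_approximation_def by blast
  have fin: "finite (G n)" "G n \<noteq> {}" "card (G n) > 0" for n
    using periodic_orbit_finite[OF per] periodic_orbit_card_pos[OF per, of n] by (auto simp: card_gt_0_iff)
  define Q where "Q n g \<longleftrightarrow> (\<forall>b w. b \<in> G n \<longrightarrow> w \<in> G (Suc n) \<longrightarrow> g b w \<in> G (Suc n)) \<and>
    (\<forall>c. c \<in> G (Suc n) \<longrightarrow> card {(b, w). b \<in> G n \<and> w \<in> G (Suc n) \<and> g b w = c} = card (G n)) \<and>
    real (card {(b, w). b \<in> G n \<and> w \<in> G (Suc n) \<and> \<not> dist b (g b w) < \<gamma> n}) \<le> (1 - \<kappa> n) * (card (G n) * card (G (Suc n)))" for n g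
  have "\<exists>g. Q n g" for n
  proof -
    obtain g where g: "\<And>b w. b \<in> G n \<Longrightarrow> w \<in> G (Suc n) \<Longrightarrow> g b w \<in> G (Suc n)"
      "\<And>c. c \<in> G (Suc n) \<Longrightarrow> card {(b, w). b \<in> G n \<and> w \<in> G (Suc n) \<and> g b w = c} = card (G n)"
      "real (card {(b, w). b \<in> G n \<and> w \<in> G (Suc n) \<and> \<not> dist b (g b w) < \<gamma> n}) \<le> (1 - \<kappa> n) * (card (G n) * card (G (Suc n)))"
      by (rule coupling_step[OF ga[of n]]) blast
    show ?thesis unfolding Q_def by (intro exI[of _ g] conjI allI impI g)
  qed
  then obtain g where Qg: "\<And>n. Q n (g n)" by metis
  have g: "\<And>n b w. b \<in> G n \<Longrightarrow> w \<in> G (Suc n) \<Longrightarrow> g n b w \<in> G (Suc n)"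
    "\<And>n c. c \<in> G (Suc n) \<Longrightarrow> card {(b, w). b \<in> G n \<and> w \<in> G (Suc n) \<and> g n b w = c} = card (G n)"
    "\<And>n. real (card {(b, w). b \<in> G n \<and> w \<in> G (Suc n) \<and> \<not> dist b (g n b w) < \<gamma> n}) \<le> (1 - \<kappa> n) * (card (G n) * card (G (Suc n)))"
    using Qg unfolding Q_def by blast+
  define M where "M n = uniform_count_measure (G n)" for n
  have Mp: "prob_space (M n)" for n unfolding M_def using fin by (intro prob_space_uniform_count_measure)
  have Msp [simp]: "space (M n) = G n" "sets (M n) = Pow (G n)" for n unfolding M_def by (auto simp: space_uniform_count_measure sets_uniform_count_measure)
  \<comment> \<open>Independent uniform points, one on each orbit, supply the randomness of all
    coupling steps.\<close>
  define \<Omega> where "\<Omega> = Pi\<^sub>M UNIV M"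
  interpret \<Omega>: prob_space \<Omega> unfolding \<Omega>_def by (rule prob_space_PiM[OF Mp])
  have sp: "space \<Omega> = (\<Pi>\<^sub>E i\<in>UNIV. G i)" unfolding \<Omega>_def by (simp add: space_PiM)
  define y where "y = rec_nat (\<lambda>\<omega>::nat \<Rightarrow> 'a. \<omega> 0) (\<lambda>n yn \<omega>. g n (yn \<omega>) (\<omega> (Suc n)))"
  have y0: "y 0 \<omega> = \<omega> 0" and yS: "y (Suc n) \<omega> = g n (y n \<omega>) (\<omega> (Suc n))" for n \<omega> unfolding y_def by auto
  have yG: "y n \<omega> \<in> G n" if "\<And>i. i \<le> n \<Longrightarrow> \<omega> i \<in> G i" for n \<omega>
    using that by (induction n) (auto simp: y0 yS intro: g(1))
  \<comment> \<open>\<open>y n\<close> depends only on the coordinates up to \<open>n\<close>, hence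
    is independent of the fresh coordinate \<open>Suc n\<close>.\<close>
  have yrestr: "y n (restrict \<omega> {..m}) = y n \<omega>" if "n \<le> m" for n m \<omega>
    using that by (induction n) (auto simp: y0 yS)
  have comp_meas: "(\<lambda>\<omega>. \<omega> i) \<in> measurable (Pi\<^sub>M {..m} M) (count_space (G i))" if "i \<le> m" for i m
    using measurable_component_singleton[of i "{..m}" M] that
    by (simp cong: measurable_cong_sets add: measurable_def)
  have ym: "y n \<in> measurable (Pi\<^sub>M {..m} M) (count_space (G n))" if "n \<le> m" for n m
    using that
  proof (induction n)
    case 0
    then show ?case using comp_meas[of 0 m] by (simp add: y0[abs_def])
  next
    case (Suc n)
    have "(\<lambda>\<omega>. (y n \<omega>, \<omega> (Suc n))) \<in> measurable (Pi\<^sub>M {..m} M) (count_space (G n) \<Otimes>\<^sub>M count_space (G (Suc n)))"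
      using Suc comp_meas[of "Suc n" m] by (intro measurable_Pair) auto
    also have "count_space (G n) \<Otimes>\<^sub>M count_space (G (Suc n)) = count_space (G n \<times> G (Suc n))"
      using fin by (intro pair_measure_count_space)
    finally have "(\<lambda>q. g n (fst q) (snd q)) \<circ> (\<lambda>\<omega>. (y n \<omega>, \<omega> (Suc n))) \<in> measurable (Pi\<^sub>M {..m} M) (count_space (G (Suc n)))"
      by (rule measurable_comp) (auto intro: g(1))
    then show ?case by (simp add: comp_def yS[abs_def])
  qed
  have rm: "(\<lambda>\<omega>. restrict \<omega> {..m}) \<in> measurable \<Omega> (Pi\<^sub>M {..m} M)" for m
    unfolding \<Omega>_def by (intro measurable_restrict_subset) simp
  have y\<Omega>: "y n \<in> measurable \<Omega> (count_space (G n))" for n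
    using measurable_compose[OF rm ym[of n n]] yrestr[of n n] by simp
  have \<omega>\<Omega>: "(\<lambda>\<omega>. \<omega> i) \<in> measurable \<Omega> (count_space (G i))" for i
    using measurable_component_singleton[of i UNIV M] unfolding \<Omega>_def by (simp cong: measurable_cong_sets add: measurable_def)
  have evm: "{\<omega>\<in>space \<Omega>. y n \<omega> = b \<and> \<omega> (Suc n) = w} \<in> sets \<Omega>" for n b w
  proof -
    have "(\<lambda>\<omega>. (y n \<omega>, \<omega> (Suc n))) \<in> measurable \<Omega> (count_space (G n) \<Otimes>\<^sub>M count_space (G (Suc n)))"
      using y\<Omega> \<omega>\<Omega> by (intro measurable_Pair)
    also have "count_space (G n) \<Otimes>\<^sub>M count_space (G (Suc n)) = count_space (G n \<times> G (Suc n))"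
      using fin by (intro pair_measure_count_space)
    finally have "(\<lambda>\<omega>. (y n \<omega>, \<omega> (Suc n))) -` ({(b, w)} \<inter> G n \<times> G (Suc n)) \<inter> space \<Omega> \<in> sets \<Omega>"
      by (rule measurable_sets) auto
    also have "(\<lambda>\<omega>. (y n \<omega>, \<omega> (Suc n))) -` ({(b, w)} \<inter> G n \<times> G (Suc n)) \<inter> space \<Omega> = {\<omega>\<in>space \<Omega>. y n \<omega> = b \<and> \<omega> (Suc n) = w}"
      using yG unfolding sp by (auto simp: PiE_iff)
    finally show ?thesis .
  qed
  have law\<omega>: "measure \<Omega> {\<omega>\<in>space \<Omega>. \<omega> i = w} = 1 / card (G i)" if "w \<in> G i" for i w
  proof -
    have "measure \<Omega> {\<omega>\<in>space \<Omega>. \<omega> i = w} = measure (distr \<Omega> (M i) (\<lambda>\<omega>. \<omega> i)) {w}"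
      unfolding \<Omega>_def using that by (subst measure_distr) (auto intro!: arg_cong[where f="measure _"])
    also have "distr \<Omega> (M i) (\<lambda>\<omega>. \<omega> i) = M i" unfolding \<Omega>_def by (rule distr_PiM_component[OF Mp]) simp
    also have "measure (M i) {w} = 1 / card (G i)" unfolding M_def using that fin by (subst measure_uniform_count_measure) auto
    finally show ?thesis .
  qed
  have indep: "\<Omega>.indep_vars M (\<lambda>i \<omega>. \<omega> i) UNIV"
  proof (subst \<Omega>.indep_vars_iff_distr_eq_PiM)
    show "(\<lambda>\<omega>. \<omega> i) \<in> measurable \<Omega> (M i)" for i unfolding \<Omega>_def by (intro measurable_component_singleton) simp
    have "distr \<Omega> (Pi\<^sub>M UNIV M) (\<lambda>x. \<lambda>i\<in>UNIV. x i) = distr \<Omega> \<Omega> (\<lambda>x. x)"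
      unfolding \<Omega>_def by (intro distr_cong) auto
    also have "\<dots> = \<Omega>" by simp
    also have "\<dots> = (\<Pi>\<^sub>M i\<in>UNIV. distr \<Omega> (M i) (\<lambda>\<omega>. \<omega> i))"
    proof -
      have "distr \<Omega> (M i) (\<lambda>\<omega>. \<omega> i) = M i" for i
        unfolding \<Omega>_def by (rule distr_PiM_component[OF Mp]) simp
      then show ?thesis unfolding \<Omega>_def by simp
    qed
    finally show "distr \<Omega> (Pi\<^sub>M UNIV M) (\<lambda>x. \<lambda>i\<in>UNIV. x i) = (\<Pi>\<^sub>M i\<in>UNIV. distr \<Omega> (M i) (\<lambda>\<omega>. \<omega> i))" .
  qed simp
  have joint: "measure \<Omega> {\<omega>\<in>space \<Omega>. y n \<omega> = b \<and> \<omega> (Suc n) = w} = measure \<Omega> {\<omega>\<in>space \<Omega>. y n \<omega> = b} * (1 / card (G (Suc n)))"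
    if bw: "b \<in> G n" "w \<in> G (Suc n)" for n b w
  proof -
    have "\<Omega>.indep_var (Pi\<^sub>M {..n} M) (\<lambda>\<omega>. restrict (\<lambda>i. \<omega> i) {..n}) (Pi\<^sub>M {Suc n} M) (\<lambda>\<omega>. restrict (\<lambda>i. \<omega> i) {Suc n})"
      by (rule \<Omega>.indep_var_restrict[OF indep]) auto
    then have "\<Omega>.indep_var (count_space (G n)) (y n \<circ> (\<lambda>\<omega>. restrict (\<lambda>i. \<omega> i) {..n}))
        (M (Suc n)) ((\<lambda>\<omega>. \<omega> (Suc n)) \<circ> (\<lambda>\<omega>. restrict (\<lambda>i. \<omega> i) {Suc n}))"
      by (rule \<Omega>.indep_var_compose) (auto intro: ym measurable_component_singleton)
    moreover have "y n \<circ> (\<lambda>\<omega>. restrict (\<lambda>i. \<omega> i) {..n}) = y n" using yrestr[of n n] by auto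
    moreover have "(\<lambda>\<omega>. \<omega> (Suc n)) \<circ> (\<lambda>\<omega>::nat \<Rightarrow> 'a. restrict (\<lambda>i. \<omega> i) {Suc n}) = (\<lambda>\<omega>. \<omega> (Suc n))" by auto
    ultimately have "\<Omega>.indep_var (count_space (G n)) (y n) (M (Suc n)) (\<lambda>\<omega>. \<omega> (Suc n))" by (simp only:)
    from \<Omega>.indep_varD[OF this, of "{b}" "{w}"] bw
    have "measure \<Omega> ((\<lambda>\<omega>. (y n \<omega>, \<omega> (Suc n))) -` ({b} \<times> {w}) \<inter> space \<Omega>)
      = measure \<Omega> (y n -` {b} \<inter> space \<Omega>) * measure \<Omega> ((\<lambda>\<omega>. \<omega> (Suc n)) -` {w} \<inter> space \<Omega>)" by simp
    moreover have "(\<lambda>\<omega>. (y n \<omega>, \<omega> (Suc n))) -` ({b} \<times> {w}) \<inter> space \<Omega> = {\<omega>\<in>space \<Omega>. y n \<omega> = b \<and> \<omega> (Suc n) = w}"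
      "y n -` {b} \<inter> space \<Omega> = {\<omega>\<in>space \<Omega>. y n \<omega> = b}"
      "(\<lambda>\<omega>. \<omega> (Suc n)) -` {w} \<inter> space \<Omega> = {\<omega>\<in>space \<Omega>. \<omega> (Suc n) = w}" by auto
    ultimately show ?thesis using law\<omega>[OF bw(2)] by simp
  qed
  have pairs: "measure \<Omega> {\<omega>\<in>space \<Omega>. (y n \<omega>, \<omega> (Suc n)) \<in> S} = card S / (card (G n) * card (G (Suc n)))"
    if S: "S \<subseteq> G n \<times> G (Suc n)" and law: "\<And>b. b \<in> G n \<Longrightarrow> measure \<Omega> {\<omega>\<in>space \<Omega>. y n \<omega> = b} = 1 / card (G n)" for n S
  proof -
    have finS: "finite S" using S fin finite_subset by (metis finite_cartesian_product)
    have "{\<omega>\<in>space \<Omega>. (y n \<omega>, \<omega> (Suc n)) \<in> S} = (\<Union>q\<in>S. {\<omega>\<in>space \<Omega>. y n \<omega> = fst q \<and> \<omega> (Suc n) = snd q})" by force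
    then have "measure \<Omega> {\<omega>\<in>space \<Omega>. (y n \<omega>, \<omega> (Suc n)) \<in> S}
      = (\<Sum>q\<in>S. measure \<Omega> {\<omega>\<in>space \<Omega>. y n \<omega> = fst q \<and> \<omega> (Suc n) = snd q})"
      using finS evm by (simp only:) (intro \<Omega>.finite_measure_finite_Union, auto simp: disjoint_family_on_def)
    also have "\<dots> = (\<Sum>q\<in>S. 1 / (card (G n) * card (G (Suc n))))"
      using S joint law by (intro sum.cong) fastforce+
    finally show ?thesis by simp
  qed
  \<comment> \<open>Induction: a uniform point and an independent fresh one form a uniform pair, and
    each target has the same number \<open>card (G n)\<close> of pairs, so the next point is
    uniform.\<close>
  have law: "b \<in> G n \<Longrightarrow> measure \<Omega> {\<omega>\<in>space \<Omega>. y n \<omega> = b} = 1 / card (G n)" for n b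
  proof (induction n arbitrary: b)
    case 0
    then show ?case using law\<omega>[of b 0] by (simp add: y0)
  next
    case (Suc n)
    define S where "S = {(b', w). b' \<in> G n \<and> w \<in> G (Suc n) \<and> g n b' w = b}"
    have "{\<omega>\<in>space \<Omega>. y (Suc n) \<omega> = b} = {\<omega>\<in>space \<Omega>. (y n \<omega>, \<omega> (Suc n)) \<in> S}"
      unfolding S_def yS using yG unfolding sp by (auto simp: PiE_iff)
    also have "measure \<Omega> \<dots> = card S / (card (G n) * card (G (Suc n)))"
      using Suc.IH by (intro pairs) (auto simp: S_def)
    also have "card S = card (G n)" unfolding S_def by (rule g(2)[OF Suc.prems])
    finally show ?case using fin by simp
  qed
  define A where "A n = {\<omega>\<in>space \<Omega>. (y n \<omega>, \<omega> (Suc n)) \<in> {(b, w). b \<in> G n \<and> w \<in> G (Suc n) \<and> \<not> dist b (g n b w) < \<gamma> n}}" for n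
  have Am: "A n \<in> sets \<Omega>" for n
  proof -
    have "A n = (\<Union>q\<in>{(b, w). b \<in> G n \<and> w \<in> G (Suc n) \<and> \<not> dist b (g n b w) < \<gamma> n}. {\<omega>\<in>space \<Omega>. y n \<omega> = fst q \<and> \<omega> (Suc n) = snd q})"
      unfolding A_def by force
    moreover have "finite {(b, w). b \<in> G n \<and> w \<in> G (Suc n) \<and> \<not> dist b (g n b w) < \<gamma> n}"
      by (rule finite_subset[of _ "G n \<times> G (Suc n)"]) (use fin in auto)
    ultimately show ?thesis using evm by (simp only:) (intro sets.finite_UN, auto)
  qed
  have mA: "measure \<Omega> (A n) \<le> 1 - \<kappa> n" for n
  proof -
    have "measure \<Omega> (A n) = card {(b, w). b \<in> G n \<and> w \<in> G (Suc n) \<and> \<not> dist b (g n b w) < \<gamma> n} / (card (G n) * card (G (Suc n)))"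
      unfolding A_def using law by (intro pairs) auto
    also have "\<dots> \<le> ((1 - \<kappa> n) * (card (G n) * card (G (Suc n)))) / (card (G n) * card (G (Suc n)))"
      using g(3)[of n] by (intro divide_right_mono) auto
    finally show ?thesis using fin by simp
  qed
  have BC: "AE \<omega> in \<Omega>. eventually (\<lambda>n. \<omega> \<in> space \<Omega> - A n) sequentially"
  proof (rule borel_cantelli_AE1[OF Am])
    show "summable (\<lambda>n. measure \<Omega> (A n))"
      by (rule summable_comparison_test[OF _ sm(2)]) (auto intro: mA)
  qed (simp add: \<Omega>.emeasure_eq_measure)
  define Good where "Good = {\<omega>\<in>space \<Omega>. \<exists>N. \<forall>n\<ge>N. \<omega> \<notin> A n}"
  have Goodm: "Good \<in> sets \<Omega>" unfolding Good_def using Am by measurable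
  have aeG: "AE \<omega> in \<Omega>. \<omega> \<in> Good"
    using BC AE_space
  proof eventually_elim
    case (elim \<omega>)
    then show ?case unfolding Good_def eventually_sequentially by auto
  qed
  have conv: "convergent (\<lambda>n. y n \<omega>)" if "\<omega> \<in> Good" for \<omega>
  proof -
    have \<omega>: "\<omega> \<in> space \<Omega>" "\<exists>N. \<forall>n\<ge>N. \<omega> \<notin> A n" using that unfolding Good_def by auto
    have "dist (y n \<omega>) (y (Suc n) \<omega>) \<le> \<gamma> n" if "\<omega> \<notin> A n" for n
      using that \<omega>(1) yG[of n \<omega>] unfolding A_def sp by (auto simp: yS PiE_iff)
    then have "eventually (\<lambda>n. dist (y n \<omega>) (y (Suc n) \<omega>) \<le> \<gamma> n) sequentially"
      using \<omega>(2) unfolding eventually_sequentially by blast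
    then have "Cauchy (\<lambda>n. y n \<omega>)" using sm(1) by (rule summable_dist_imp_Cauchy)
    then show ?thesis using compact_imp_complete[OF comp] unfolding complete_def convergent_def by blast
  qed
  \<comment> \<open>An arbitrary default on the null set where convergence is not known, so that the
    limit exists everywhere and is measurable.\<close>
  define a :: 'a where "a = undefined"
  define y' where "y' n \<omega> = (if \<omega> \<in> Good then y n \<omega> else a)" for n \<omega>
  define Y where "Y \<omega> = lim (\<lambda>n. y' n \<omega>)" for \<omega>
  have yb: "y n \<in> borel_measurable \<Omega>" for n
    using y\<Omega>[of n] by (rule measurable_compose) simp
  have y'm: "y' n \<in> borel_measurable \<Omega>" for n
    unfolding y'_def using yb Goodm by (intro measurable_If_set) (auto intro: measurable_const)
  have lim: "(\<lambda>n. y' n \<omega>) \<longlonglongrightarrow> Y \<omega>" for \<omega>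
    unfolding Y_def y'_def using conv[of \<omega>]
    by (cases "\<omega> \<in> Good") (auto simp: convergent_LIMSEQ_iff[symmetric] convergent_const)
  have Ym: "Y \<in> borel_measurable \<Omega>"
    using y'm lim by (rule borel_measurable_LIMSEQ_metric)
  define \<mu> where "\<mu> = distr \<Omega> borel Y"
  have "weak_star_limit (\<lambda>n. orbit_measure (G n)) \<mu>"
    unfolding weak_star_limit_def
  proof (intro conjI allI impI)
    show "borel_probability \<mu>" unfolding borel_probability_def \<mu>_def using Ym by (auto intro: \<Omega>.prob_space_distr)
    fix \<phi> :: "'a \<Rightarrow> real" assume \<phi>: "continuous_on UNIV \<phi>"
    have \<phi>m [measurable]: "\<phi> \<in> borel_measurable borel" using \<phi> by (rule borel_measurable_continuous_onI)
    have "bounded (range \<phi>)" using \<phi> comp compact_continuous_image compact_imp_bounded by blast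
    then obtain B where B: "\<And>x. \<bar>\<phi> x\<bar> \<le> B" unfolding bounded_real by auto
    have "(\<lambda>n. \<integral>\<omega>. \<phi> (y' n \<omega>) \<partial>\<Omega>) \<longlonglongrightarrow> (\<integral>\<omega>. \<phi> (Y \<omega>) \<partial>\<Omega>)"
    proof (rule integral_dominated_convergence[where w="\<lambda>_. B"])
      show "AE \<omega> in \<Omega>. (\<lambda>n. \<phi> (y' n \<omega>)) \<longlonglongrightarrow> \<phi> (Y \<omega>)"
      proof (rule AE_I2)
        fix \<omega>
        have "isCont \<phi> (Y \<omega>)" using \<phi> by (simp add: continuous_on_eq_continuous_at)
        then show "(\<lambda>n. \<phi> (y' n \<omega>)) \<longlonglongrightarrow> \<phi> (Y \<omega>)" using lim by (rule isCont_tendsto_compose)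
      qed
    qed (use B y'm Ym in \<open>auto intro: measurable_compose[OF _ \<phi>m]\<close>)
    also have "(\<integral>\<omega>. \<phi> (Y \<omega>) \<partial>\<Omega>) = integral\<^sup>L \<mu> \<phi>" unfolding \<mu>_def using Ym by (subst integral_distr) auto
    also have "(\<lambda>n. \<integral>\<omega>. \<phi> (y' n \<omega>) \<partial>\<Omega>) = (\<lambda>n. integral\<^sup>L (orbit_measure (G n)) \<phi>)"
    proof
      fix n
      have "(\<integral>\<omega>. \<phi> (y' n \<omega>) \<partial>\<Omega>) = (\<integral>\<omega>. \<phi> (y n \<omega>) \<partial>\<Omega>)"
      proof (rule integral_cong_AE)
        show "AE \<omega> in \<Omega>. \<phi> (y' n \<omega>) = \<phi> (y n \<omega>)" using aeG by eventually_elim (simp add: y'_def)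
      qed (use y'm yb in \<open>auto intro: measurable_compose[OF _ \<phi>m]\<close>)
      also have "\<dots> = (\<integral>\<omega>. (\<Sum>b\<in>G n. \<phi> b * indicator {\<omega>\<in>space \<Omega>. y n \<omega> = b} \<omega>) \<partial>\<Omega>)"
      proof (rule Bochner_Integration.integral_cong[OF refl])
        fix \<omega> assume \<omega>: "\<omega> \<in> space \<Omega>"
        then have yn: "y n \<omega> \<in> G n" using yG unfolding sp by (auto simp: PiE_iff)
        have "(\<Sum>b\<in>G n. \<phi> b * indicator {\<omega>\<in>space \<Omega>. y n \<omega> = b} \<omega>) = (\<Sum>b\<in>G n. if b = y n \<omega> then \<phi> b else 0)"
          using \<omega> by (intro sum.cong) (auto simp: indicator_def)
        also have "\<dots> = \<phi> (y n \<omega>)" using yn fin by simp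
        finally show "\<phi> (y n \<omega>) = (\<Sum>b\<in>G n. \<phi> b * indicator {\<omega>\<in>space \<Omega>. y n \<omega> = b} \<omega>)" by simp
      qed
      also have "\<dots> = (\<Sum>b\<in>G n. \<phi> b * measure \<Omega> {\<omega>\<in>space \<Omega>. y n \<omega> = b})"
      proof -
        have m: "{\<omega>\<in>space \<Omega>. y n \<omega> = b} \<in> sets \<Omega>" if "b \<in> G n" for b
          using measurable_sets[OF y\<Omega>[of n], of "{b}"] that by (simp add: vimage_def Int_def conj_commute)
        then show ?thesis
          by (subst Bochner_Integration.integral_sum) (auto simp: \<Omega>.emeasure_eq_measure intro!: sum.cong)
      qed
      also have "\<dots> = (\<Sum>b\<in>G n. \<phi> b / card (G n))" using law by (intro sum.cong) auto
      also have "\<dots> = integral\<^sup>L (orbit_measure (G n)) \<phi>"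
        using integral_orbit_measure[OF fin(1,2) \<phi>m] by (simp add: sum_divide_distrib)
      finally show "(\<integral>\<omega>. \<phi> (y' n \<omega>) \<partial>\<Omega>) = integral\<^sup>L (orbit_measure (G n)) \<phi>" .
    qed
    finally show "(\<lambda>n. integral\<^sup>L (orbit_measure (G n)) \<phi>) \<longlonglongrightarrow> integral\<^sup>L \<mu> \<phi>" .
  qed
  then show ?thesis by blast
qed

section \<open>Derivatives along a line field\<close>

abbreviation chart_rep :: "('m, 'e) chart \<Rightarrow> ('m, 'e) chart \<Rightarrow> ('m \<Rightarrow> 'm) \<Rightarrow> 'e \<Rightarrow> 'e" where
  "chart_rep c d f \<equiv> snd d \<circ> f \<circ> chart_inv c"

text \<open>Weaker than \<open>C1_map\<close>: pointwise differentiability passes to iterates by the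
  chain rule alone, and it is all that tangent maps of iterates require. Continuity of the
  derivative enters only for \<open>f\<close> itself.\<close>

definition chart_diff :: "('m::topological_space, 'e::euclidean_space) chart set \<Rightarrow> ('m \<Rightarrow> 'm) \<Rightarrow> bool" where
  "chart_diff \<A> f \<longleftrightarrow> continuous_on UNIV f \<and>
     (\<forall>x. \<forall>c\<in>charts_at \<A> x. \<forall>d\<in>charts_at \<A> (f x). chart_rep c d f differentiable (at (snd c x)))"

section \<open>Tangent vectors and the chain rule in charts\<close>

locale atlas =
  fixes \<A> :: "('m::topological_space, 'e::euclidean_space) chart set"
  assumes atlas: "smooth_atlas \<A>"
begin

lemma ex_chart: "\<exists>c. c \<in> charts_at \<A> x"
  using atlas unfolding smooth_atlas_def charts_at_def by blast

lemma some_chart: "(SOME c. c \<in> charts_at \<A> x) \<in> charts_at \<A> x"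
  using ex_chart by (rule someI_ex)

lemma chartD:
  assumes "c \<in> \<A>"
  shows "open (fst c)" "continuous_on (fst c) (snd c)" "continuous_on (snd c ` fst c) (chart_inv c)"
    "\<And>x. x \<in> fst c \<Longrightarrow> chart_inv c (snd c x) = x" "open (snd c ` fst c)"
  using assms atlas unfolding smooth_atlas_def is_chart_def homeomorphism_def by auto

lemma charts_atD: "c \<in> charts_at \<A> x \<Longrightarrow> c \<in> \<A> \<and> x \<in> fst c"
  unfolding charts_at_def by simp

lemma open_chart_image:
  assumes "c \<in> \<A>" "open U"
  shows "open (snd c ` (fst c \<inter> U))"
proof -
  have "snd c ` (fst c \<inter> U) = snd c ` fst c \<inter> chart_inv c -` U"
    using chartD(4)[OF assms(1)] by auto
  then show ?thesis
    using continuous_open_preimage[OF chartD(3)[OF assms(1)] chartD(5)[OF assms(1)] assms(2)] by simp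
qed

text \<open>Transition maps are representatives of the identity. Changes of chart thereby become
  instances of the chain rule for maps.\<close>

lemma chart_diff_id: "chart_diff \<A> (\<lambda>x. x)"
  unfolding chart_diff_def
proof (intro conjI allI ballI)
  fix x c d assume cd: "c \<in> charts_at \<A> x" "d \<in> charts_at \<A> x"
  then have "smooth_on (snd c ` (fst c \<inter> fst d)) (snd d \<circ> chart_inv c)"
    using atlas unfolding smooth_atlas_def charts_at_def by auto
  then have "Ck_on 1 (snd d \<circ> chart_inv c) (snd c ` (fst c \<inter> fst d))" unfolding smooth_on_def by blast
  then have "(snd d \<circ> chart_inv c) differentiable (at (snd c x))"
    using cd by (auto simp: charts_at_def)
  then show "chart_rep c d (\<lambda>x. x) differentiable (at (snd c x))" by (simp add: comp_def)
qed simp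

lemma C1_map_chart_diff:
  assumes "C1_map \<A> f"
  shows "chart_diff \<A> f"
  unfolding chart_diff_def
proof (intro conjI allI ballI)
  show "continuous_on UNIV f" using assms unfolding C1_map_def by simp
  fix x c d assume cd: "c \<in> charts_at \<A> x" "d \<in> charts_at \<A> (f x)"
  then have "Ck_on 1 (chart_rep c d f) (snd c ` (fst c \<inter> f -` fst d))"
    using assms unfolding C1_map_def charts_at_def by auto
  then show "chart_rep c d f differentiable (at (snd c x))"
    using cd by (auto simp: charts_at_def)
qed

text \<open>The composed representatives agree with the representative of the composite only where
  \<open>F\<close> lands in the domain of \<open>e\<close>; this is an open neighbourhood, which
  suffices for derivatives.\<close>

lemma chart_rep_compose:
  assumes F: "chart_diff \<A> F" and f: "chart_diff \<A> f"
    and c: "c \<in> charts_at \<A> x" and e: "e \<in> charts_at \<A> (F x)" and d: "d \<in> charts_at \<A> (f (F x))"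
  shows "(chart_rep c d (f \<circ> F) has_derivative
      frechet_derivative (chart_rep e d f) (at (snd e (F x))) \<circ> frechet_derivative (chart_rep c e F) (at (snd c x)))
    (at (snd c x))"
proof -
  have inv: "chart_inv c (snd c x) = x" using chartD(4) charts_atD[OF c] by blast
  have 1: "(chart_rep c e F has_derivative frechet_derivative (chart_rep c e F) (at (snd c x))) (at (snd c x))"
    using F c e unfolding chart_diff_def frechet_derivative_works by blast
  have 2: "(chart_rep e d f has_derivative frechet_derivative (chart_rep e d f) (at (snd e (F x)))) (at (snd e (F x)))"
    using f e d unfolding chart_diff_def frechet_derivative_works by blast
  have eq: "chart_rep c e F (snd c x) = snd e (F x)" by (simp add: inv)
  have "(chart_rep e d f \<circ> chart_rep c e F has_derivative
      frechet_derivative (chart_rep e d f) (at (snd e (F x))) \<circ> frechet_derivative (chart_rep c e F) (at (snd c x)))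
    (at (snd c x))"
    using 1 2 by (intro diff_chain_at) (simp_all only: eq)
  then show ?thesis
  proof (rule has_derivative_transform_within_open)
    have "open (fst e)" using charts_atD[OF e] chartD(1) by blast
    then have "open (F -` fst e)" using F unfolding chart_diff_def by (metis open_vimage)
    then show "open (snd c ` (fst c \<inter> F -` fst e))" using open_chart_image charts_atD[OF c] by blast
    show "snd c x \<in> snd c ` (fst c \<inter> F -` fst e)" using charts_atD[OF c] charts_atD[OF e] by auto
    fix y assume "y \<in> snd c ` (fst c \<inter> F -` fst e)"
    then obtain q where q: "y = snd c q" "q \<in> fst c" "F q \<in> fst e" by auto
    have "chart_inv c y = q" using chartD(4) charts_atD[OF c] q by blast
    moreover have "chart_inv e (snd e (F q)) = F q" using chartD(4) charts_atD[OF e] q by blast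
    ultimately show "(chart_rep e d f \<circ> chart_rep c e F) y = chart_rep c d (f \<circ> F) y" by simp
  qed
qed

lemma chart_diff_compose:
  assumes "chart_diff \<A> F" "chart_diff \<A> f"
  shows "chart_diff \<A> (f \<circ> F)"
  unfolding chart_diff_def
proof (intro conjI allI ballI)
  show "continuous_on UNIV (f \<circ> F)"
    using assms unfolding chart_diff_def by (intro continuous_on_compose) (auto intro: continuous_on_subset)
  fix x c d assume cd: "c \<in> charts_at \<A> x" "d \<in> charts_at \<A> ((f \<circ> F) x)"
  obtain e where "e \<in> charts_at \<A> (F x)" using ex_chart by blast
  then show "chart_rep c d (f \<circ> F) differentiable (at (snd c x))"
    using chart_rep_compose[OF assms cd(1)] cd(2) unfolding differentiable_def by fastforce
qed

lemma chart_diff_funpow: "chart_diff \<A> f \<Longrightarrow> chart_diff \<A> (f ^^ n)"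
proof (induction n)
  case 0
  have "f ^^ 0 = (\<lambda>x. x)" by auto
  then show ?case using chart_diff_id by simp
next
  case (Suc n)
  then show ?case unfolding funpow.simps by (intro chart_diff_compose) auto
qed

lemma frechet_chart_rep_compose:
  assumes "chart_diff \<A> F" "chart_diff \<A> f"
    "c \<in> charts_at \<A> x" "e \<in> charts_at \<A> (F x)" "d \<in> charts_at \<A> (f (F x))"
  shows "frechet_derivative (chart_rep c d (f \<circ> F)) (at (snd c x)) u =
      frechet_derivative (chart_rep e d f) (at (snd e (F x))) (frechet_derivative (chart_rep c e F) (at (snd c x)) u)"
  using frechet_derivative_at[OF chart_rep_compose[OF assms]] by (metis comp_apply)

lemma linear_chart_rep:
  assumes "chart_diff \<A> f" "c \<in> charts_at \<A> x" "d \<in> charts_at \<A> (f x)"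
  shows "linear (frechet_derivative (chart_rep c d f) (at (snd c x)))"
  using assms unfolding chart_diff_def by (simp add: linear_frechet_derivative)

lemma transition_rep: "chart_rep c d (\<lambda>x. x) = snd d \<circ> chart_inv c"
  by auto

lemma tangent_spaceD:
  assumes "v \<in> tangent_space \<A> x" "c \<in> charts_at \<A> x" "d \<in> charts_at \<A> x"
  shows "v d = frechet_derivative (chart_rep c d (\<lambda>x. x)) (at (snd c x)) (v c)"
  using assms unfolding tangent_space_def transition_rep by blast

lemma tangent_spaceI:
  assumes "\<And>c. c \<notin> charts_at \<A> x \<Longrightarrow> v c = 0"
    "\<And>c d. c \<in> charts_at \<A> x \<Longrightarrow> d \<in> charts_at \<A> x \<Longrightarrow>
       v d = frechet_derivative (chart_rep c d (\<lambda>x. x)) (at (snd c x)) (v c)"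
  shows "v \<in> tangent_space \<A> x"
  using assms unfolding tangent_space_def transition_rep by blast

lemma tangent_off: "v \<in> tangent_space \<A> x \<Longrightarrow> c \<notin> charts_at \<A> x \<Longrightarrow> v c = 0"
  unfolding tangent_space_def by blast

lemma tvec_of_in_tangent:
  assumes "c \<in> charts_at \<A> x"
  shows "tvec_of \<A> x c u \<in> tangent_space \<A> x"
proof (rule tangent_spaceI)
  fix d e assume "d \<in> charts_at \<A> x" "e \<in> charts_at \<A> x"
  then show "tvec_of \<A> x c u e = frechet_derivative (chart_rep d e (\<lambda>x. x)) (at (snd d x)) (tvec_of \<A> x c u d)"
    using frechet_chart_rep_compose[OF chart_diff_id chart_diff_id assms, of d e u]
    unfolding tvec_of_def transition_rep[symmetric] by (simp add: comp_def)
qed (simp add: tvec_of_def)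

lemma tvec_of_self:
  assumes "c \<in> charts_at \<A> x"
  shows "tvec_of \<A> x c u c = u"
proof -
  have c: "c \<in> \<A>" "x \<in> fst c" using charts_atD[OF assms] by auto
  have "((\<lambda>y. y) has_derivative (\<lambda>y. y)) (at (snd c x))" by (rule has_derivative_ident)
  then have "(snd c \<circ> chart_inv c has_derivative (\<lambda>y. y)) (at (snd c x))"
  proof (rule has_derivative_transform_within_open)
    show "open (snd c ` fst c)" using chartD(5) c by blast
    show "snd c x \<in> snd c ` fst c" using c by blast
    fix y assume "y \<in> snd c ` fst c"
    then show "y = (snd c \<circ> chart_inv c) y" using chartD(4)[OF c(1)] by auto
  qed
  from frechet_derivative_at[OF this, symmetric] show ?thesis unfolding tvec_of_def using assms by simp
qed

lemma tangent_eq_tvec_of: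
  assumes "v \<in> tangent_space \<A> x" "c \<in> charts_at \<A> x"
  shows "v = tvec_of \<A> x c (v c)"
proof
  fix d
  show "v d = tvec_of \<A> x c (v c) d"
    using tangent_spaceD[OF assms, of d] tangent_off[OF assms(1), of d] unfolding tvec_of_def transition_rep
    by (cases "d \<in> charts_at \<A> x") auto
qed

lemma tangent_nonzero:
  assumes "v \<in> tangent_space \<A> x" "c \<in> charts_at \<A> x" "v \<noteq> tvec_zero"
  shows "v c \<noteq> 0"
proof
  assume 0: "v c = 0"
  have "v d = 0" for d
  proof (cases "d \<in> charts_at \<A> x")
    case True
    have "linear (frechet_derivative (chart_rep c d (\<lambda>x. x)) (at (snd c x)))"
      using linear_chart_rep[OF chart_diff_id assms(2)] True by simp
    then show ?thesis using tangent_spaceD[OF assms(1,2) True] 0 by (simp add: linear_0)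
  qed (rule tangent_off[OF assms(1)])
  then show False using assms(3) unfolding tvec_zero_def by auto
qed

lemma tangent_scale:
  assumes "v \<in> tangent_space \<A> x"
  shows "(\<lambda>c. t *\<^sub>R v c) \<in> tangent_space \<A> x"
proof (rule tangent_spaceI)
  fix c d assume cd: "c \<in> charts_at \<A> x" "d \<in> charts_at \<A> x"
  have "linear (frechet_derivative (chart_rep c d (\<lambda>x. x)) (at (snd c x)))"
    using linear_chart_rep[OF chart_diff_id cd(1)] cd(2) by simp
  then show "t *\<^sub>R v d = frechet_derivative (chart_rep c d (\<lambda>x. x)) (at (snd c x)) (t *\<^sub>R v c)"
    using tangent_spaceD[OF assms cd] by (simp add: linear_cmul)
qed (use assms in \<open>auto simp: tangent_space_def\<close>)

text \<open>The chain rule with the identity as first factor shows that the chart chosen in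
  \<open>tangent_map\<close> is immaterial on tangent vectors.\<close>

lemma tangent_map_chart:
  assumes f: "chart_diff \<A> f" and v: "v \<in> tangent_space \<A> x" and c: "c \<in> charts_at \<A> x" and d: "d \<in> charts_at \<A> (f x)"
  shows "tangent_map \<A> f x v d = frechet_derivative (chart_rep c d f) (at (snd c x)) (v c)"
proof -
  define c0 where "c0 = (SOME c. c \<in> charts_at \<A> x)"
  have c0: "c0 \<in> charts_at \<A> x" unfolding c0_def by (rule some_chart)
  have "tangent_map \<A> f x v d = frechet_derivative (chart_rep c0 d f) (at (snd c0 x)) (v c0)"
    unfolding tangent_map_def c0_def[symmetric] Let_def using d by simp
  also have "\<dots> = frechet_derivative (chart_rep c d f) (at (snd c x)) (v c)"
    using frechet_chart_rep_compose[OF chart_diff_id f c0, of c d "v c0"] c d tangent_spaceD[OF v c0 c]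
    by (simp add: comp_def)
  finally show ?thesis .
qed

lemma tangent_map_off: "d \<notin> charts_at \<A> (f x) \<Longrightarrow> tangent_map \<A> f x v d = 0"
  unfolding tangent_map_def Let_def by simp

lemma tangent_map_in_tangent:
  assumes f: "chart_diff \<A> f" and v: "v \<in> tangent_space \<A> x"
  shows "tangent_map \<A> f x v \<in> tangent_space \<A> (f x)"
proof (rule tangent_spaceI)
  fix d e assume de: "d \<in> charts_at \<A> (f x)" "e \<in> charts_at \<A> (f x)"
  obtain c where c: "c \<in> charts_at \<A> x" using ex_chart by blast
  show "tangent_map \<A> f x v e = frechet_derivative (chart_rep d e (\<lambda>x. x)) (at (snd d (f x))) (tangent_map \<A> f x v d)"
    using frechet_chart_rep_compose[OF f chart_diff_id c de(1), of e "v c"] de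
    unfolding tangent_map_chart[OF f v c de(1)] tangent_map_chart[OF f v c de(2)] by (simp add: comp_def)
qed (rule tangent_map_off)

lemma tangent_map_compose:
  assumes F: "chart_diff \<A> F" and f: "chart_diff \<A> f" and v: "v \<in> tangent_space \<A> x"
  shows "tangent_map \<A> (f \<circ> F) x v = tangent_map \<A> f (F x) (tangent_map \<A> F x v)"
proof
  fix d
  obtain c where c: "c \<in> charts_at \<A> x" using ex_chart by blast
  obtain e where e: "e \<in> charts_at \<A> (F x)" using ex_chart by blast
  show "tangent_map \<A> (f \<circ> F) x v d = tangent_map \<A> f (F x) (tangent_map \<A> F x v) d"
  proof (cases "d \<in> charts_at \<A> (f (F x))")
    case True
    have "tangent_map \<A> (f \<circ> F) x v d = frechet_derivative (chart_rep c d (f \<circ> F)) (at (snd c x)) (v c)"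
      using tangent_map_chart[OF chart_diff_compose[OF F f] v c] True by simp
    also have "\<dots> = frechet_derivative (chart_rep e d f) (at (snd e (F x))) (tangent_map \<A> F x v e)"
      unfolding tangent_map_chart[OF F v c e] by (rule frechet_chart_rep_compose[OF F f c e True])
    also have "\<dots> = tangent_map \<A> f (F x) (tangent_map \<A> F x v) d"
      using tangent_map_chart[OF f tangent_map_in_tangent[OF F v] e True] by simp
    finally show ?thesis .
  qed (simp add: tangent_map_off)
qed

lemma tangent_map_id:
  assumes v: "v \<in> tangent_space \<A> x"
  shows "tangent_map \<A> (\<lambda>x. x) x v = v"
proof
  fix d
  obtain c where c: "c \<in> charts_at \<A> x" using ex_chart by blast
  show "tangent_map \<A> (\<lambda>x. x) x v d = v d"
  proof (cases "d \<in> charts_at \<A> x")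
    case True
    then show ?thesis using tangent_map_chart[OF chart_diff_id v c True] tangent_spaceD[OF v c True] by simp
  next
    case False
    then show ?thesis using tangent_off[OF v, of d] tangent_map_off[of d "\<lambda>x. x" x] by simp
  qed
qed

lemma tangent_map_scale:
  assumes f: "chart_diff \<A> f" and v: "v \<in> tangent_space \<A> x"
  shows "tangent_map \<A> f x (\<lambda>c. t *\<^sub>R v c) = (\<lambda>c. t *\<^sub>R tangent_map \<A> f x v c)"
proof
  fix d
  obtain c where c: "c \<in> charts_at \<A> x" using ex_chart by blast
  show "tangent_map \<A> f x (\<lambda>c. t *\<^sub>R v c) d = t *\<^sub>R tangent_map \<A> f x v d"
  proof (cases "d \<in> charts_at \<A> (f x)")
    case True
    then show ?thesis
      using tangent_map_chart[OF f tangent_scale[OF v] c True, of t] tangent_map_chart[OF f v c True]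
        linear_chart_rep[OF f c True] by (simp add: linear_cmul)
  qed (simp add: tangent_map_off)
qed

end

section \<open>Norms of tangent vectors\<close>

locale riemannian = atlas \<A> for \<A> :: "('m::topological_space, 'e::euclidean_space) chart set" +
  fixes g :: "('m, 'e) metric_tensor"
  assumes metric: "riemannian_metric \<A> g"
begin

text \<open>The metric as a bilinear form on the model space, in the coordinates of
  \<open>c\<close>.\<close>

definition gram :: "('m, 'e) chart \<Rightarrow> 'm \<Rightarrow> 'e \<Rightarrow> 'e \<Rightarrow> real" where
  "gram c x u w = g x (tvec_of \<A> x c u) (tvec_of \<A> x c w)"

lemma gram_props:
  assumes "c \<in> charts_at \<A> x"
  shows "bilinear (gram c x)" "u \<noteq> 0 \<Longrightarrow> gram c x u u > 0"
  using metric charts_atD[OF assms] unfolding riemannian_metric_def gram_def by auto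

lemma tvec_norm_gram:
  assumes "v \<in> tangent_space \<A> x" "c \<in> charts_at \<A> x"
  shows "tvec_norm g x v = sqrt (gram c x (v c) (v c))"
  using tangent_eq_tvec_of[OF assms] unfolding tvec_norm_def gram_def by simp

lemma tvec_norm_pos:
  assumes "v \<in> tangent_space \<A> x" "v \<noteq> tvec_zero"
  shows "tvec_norm g x v > 0"
proof -
  obtain c where c: "c \<in> charts_at \<A> x" using ex_chart by blast
  show ?thesis using tvec_norm_gram[OF assms(1) c] gram_props(2)[OF c tangent_nonzero[OF assms(1) c assms(2)]] by simp
qed

lemma tvec_norm_scale:
  assumes "v \<in> tangent_space \<A> x"
  shows "tvec_norm g x (\<lambda>c. t *\<^sub>R v c) = \<bar>t\<bar> * tvec_norm g x v"
proof -
  obtain c where c: "c \<in> charts_at \<A> x" using ex_chart by blast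
  have "gram c x (t *\<^sub>R v c) (t *\<^sub>R v c) = t * t * gram c x (v c) (v c)"
    using gram_props(1)[OF c] by (simp add: bilinear_lmul bilinear_rmul)
  then show ?thesis
    using tvec_norm_gram[OF assms c] tvec_norm_gram[OF tangent_scale[OF assms] c, of t]
    by (simp add: real_sqrt_mult)
qed

lemma gram_continuous_coeff:
  assumes "c \<in> \<A>"
  shows "continuous_on (fst c) (\<lambda>x. gram c x u w)"
proof -
  have "smooth_on (snd c ` fst c) (\<lambda>y. gram c (chart_inv c y) u w)"
    using metric assms unfolding riemannian_metric_def gram_def by auto
  then have "Ck_on 0 (\<lambda>y. gram c (chart_inv c y) u w) (snd c ` fst c)" unfolding smooth_on_def by blast
  then have "continuous_on (snd c ` fst c) (\<lambda>y. gram c (chart_inv c y) u w)" by simp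
  then have "continuous_on (fst c) (\<lambda>x. gram c (chart_inv c (snd c x)) u w)"
    by (rule continuous_on_compose2[OF _ chartD(2)[OF assms]]) auto
  then show ?thesis
    by (rule continuous_on_eq) (simp add: chartD(4)[OF assms])
qed

text \<open>Regularity of the metric is given for constant coordinate vectors only; expanding in the
  standard basis allows the vector to vary with the point.\<close>

lemma gram_continuous:
  assumes c: "c \<in> \<A>" and h: "continuous_on S h" "h ` S \<subseteq> fst c" and a: "continuous_on S a"
  shows "continuous_on S (\<lambda>x. gram c (h x) (a x) (a x))"
proof -
  have coeff: "continuous_on S (\<lambda>x. gram c (h x) i j)" for i j
    using continuous_on_compose2[OF gram_continuous_coeff[OF c] h(1) h(2)] by simp
  have "continuous_on S (\<lambda>x. \<Sum>(i, j)\<in>Basis \<times> Basis. (a x \<bullet> i) * ((a x \<bullet> j) * gram c (h x) i j))"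
    using coeff a by (auto intro!: continuous_intros simp: case_prod_beta)
  moreover have "gram c (h x) (a x) (a x) = (\<Sum>(i, j)\<in>Basis \<times> Basis. (a x \<bullet> i) * ((a x \<bullet> j) * gram c (h x) i j))" if "x \<in> S" for x
  proof -
    have cx: "c \<in> charts_at \<A> (h x)" using c h(2) that unfolding charts_at_def by auto
    have b: "bilinear (gram c (h x))" using gram_props(1)[OF cx] .
    have "gram c (h x) (a x) (a x) = gram c (h x) (\<Sum>i\<in>Basis. (a x \<bullet> i) *\<^sub>R i) (\<Sum>j\<in>Basis. (a x \<bullet> j) *\<^sub>R j)"
      by (simp add: euclidean_representation)
    also have "\<dots> = (\<Sum>(i, j)\<in>Basis \<times> Basis. gram c (h x) ((a x \<bullet> i) *\<^sub>R i) ((a x \<bullet> j) *\<^sub>R j))"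
      by (rule bilinear_sum[OF b])
    also have "\<dots> = (\<Sum>(i, j)\<in>Basis \<times> Basis. (a x \<bullet> i) * ((a x \<bullet> j) * gram c (h x) i j))"
      using b by (intro sum.cong) (auto simp: bilinear_lmul bilinear_rmul)
    finally show ?thesis .
  qed
  ultimately show ?thesis by (simp cong: continuous_on_cong)
qed

end

section \<open>Logarithmic expansion along an invariant line field\<close>

locale line_field = riemannian \<A> g for \<A> :: "('m::metric_space, 'e::euclidean_space) chart set" and g +
  fixes f :: "'m \<Rightarrow> 'm" and \<Xi> :: "'m set" and E :: "'m \<Rightarrow> ('m, 'e) tvec set"
  assumes C1: "C1_map \<A> f" and inv\<Xi>: "f ` \<Xi> \<subseteq> \<Xi>"
    and cont_E: "continuous_line_field \<A> \<Xi> E" and inv_E: "invariant_line_field \<A> f \<Xi> E"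
begin

lemma diff_f: "chart_diff \<A> f" using C1 by (rule C1_map_chart_diff)

lemma cont_f: "continuous_on UNIV f" using C1 unfolding C1_map_def by simp

lemma E_line: "x \<in> \<Xi> \<Longrightarrow> \<exists>v\<in>tangent_space \<A> x. v \<noteq> tvec_zero \<and> E x = tvec_line v"
  using cont_E unfolding continuous_line_field_def by blast

lemma E_tangent: "x \<in> \<Xi> \<Longrightarrow> v \<in> E x \<Longrightarrow> v \<in> tangent_space \<A> x"
  using E_line[of x] tangent_scale unfolding tvec_line_def by fastforce

lemma funpow_\<Xi>: "x \<in> \<Xi> \<Longrightarrow> (f ^^ n) x \<in> \<Xi>"
  using inv\<Xi> by (induction n) auto

lemma E_proportional:
  assumes "x \<in> \<Xi>" "v \<in> E x" "v \<noteq> tvec_zero" "w \<in> E x" "w \<noteq> tvec_zero"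
  obtains t where "t \<noteq> 0" "w = (\<lambda>c. t *\<^sub>R v c)"
proof -
  obtain v0 where v0: "E x = tvec_line v0" using E_line[OF assms(1)] by blast
  obtain a b where ab: "v = (\<lambda>c. a *\<^sub>R v0 c)" "w = (\<lambda>c. b *\<^sub>R v0 c)"
    using assms(2,4) unfolding v0 tvec_line_def by blast
  have "a \<noteq> 0" "b \<noteq> 0" using ab assms(3,5) unfolding tvec_zero_def by auto
  then show thesis using ab by (intro that[of "b / a"]) auto
qed

text \<open>Nonvanishing comes from the invariance of the field: the image of the line
  \<open>E x\<close> is all of \<open>E (f x)\<close>, which contains a nonzero vector.\<close>

lemma tangent_map_E:
  assumes "x \<in> \<Xi>" "v \<in> E x" "v \<noteq> tvec_zero"
  shows "tangent_map \<A> f x v \<in> E (f x)" "tangent_map \<A> f x v \<noteq> tvec_zero"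
proof -
  have im: "tangent_map \<A> f x ` E x = E (f x)" using inv_E assms(1) unfolding invariant_line_field_def by blast
  then show "tangent_map \<A> f x v \<in> E (f x)" using assms(2) by blast
  have "f x \<in> \<Xi>" using inv\<Xi> assms(1) by blast
  then obtain v1 where v1: "v1 \<noteq> tvec_zero" "E (f x) = tvec_line v1" using E_line by blast
  have "v1 \<in> E (f x)" unfolding v1(2) tvec_line_def by (rule range_eqI[of _ _ 1]) simp
  then have "v1 \<in> tangent_map \<A> f x ` E x" using im by simp
  then obtain w where "v1 = tangent_map \<A> f x w" and wE: "w \<in> E x" by (rule imageE)
  then have w: "w \<in> E x" "tangent_map \<A> f x w = v1" by simp_all
  have tz: "tangent_map \<A> f x (\<lambda>c. 0 *\<^sub>R v c) = (\<lambda>c. 0)"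
    using tangent_map_scale[OF diff_f E_tangent[OF assms(1,2)], of 0] by simp
  have "w \<noteq> tvec_zero" using w tz v1(1) unfolding tvec_zero_def by auto
  then obtain t where t: "w = (\<lambda>c. t *\<^sub>R v c)" using E_proportional[OF assms w(1)] by blast
  then have "v1 = (\<lambda>c. t *\<^sub>R tangent_map \<A> f x v c)"
    using w(2) tangent_map_scale[OF diff_f E_tangent[OF assms(1,2)], of t] by simp
  then show "tangent_map \<A> f x v \<noteq> tvec_zero" using v1(1) unfolding tvec_zero_def by auto
qed

text \<open>The logarithm of the factor by which the derivative stretches the line at
  \<open>x\<close>. On \<open>\<Xi>\<close> every nonzero vector of the line gives the same value,
  so the choice is harmless.\<close>

definition expansion :: "'m \<Rightarrow> real" where
  "expansion x = (let v = (SOME v. v \<in> E x \<and> v \<noteq> tvec_zero)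
     in ln (tvec_norm g (f x) (tangent_map \<A> f x v)) - ln (tvec_norm g x v))"

lemma expansion_eq:
  assumes "x \<in> \<Xi>" "v \<in> E x" "v \<noteq> tvec_zero"
  shows "expansion x = ln (tvec_norm g (f x) (tangent_map \<A> f x v)) - ln (tvec_norm g x v)"
proof -
  define w where "w = (SOME v. v \<in> E x \<and> v \<noteq> tvec_zero)"
  have w: "w \<in> E x \<and> w \<noteq> tvec_zero" unfolding w_def by (rule someI[of _ v]) (use assms in simp)
  then obtain t where t: "t \<noteq> 0" "w = (\<lambda>c. t *\<^sub>R v c)" using E_proportional[OF assms] by metis
  have vt: "v \<in> tangent_space \<A> x" using E_tangent assms by blast
  have fx: "f x \<in> \<Xi>" using inv\<Xi> assms(1) by blast
  note m = tangent_map_E[OF assms]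
  have mt: "tangent_map \<A> f x v \<in> tangent_space \<A> (f x)" using E_tangent[OF fx m(1)] .
  have 1: "tvec_norm g x w = \<bar>t\<bar> * tvec_norm g x v" unfolding t(2) by (rule tvec_norm_scale[OF vt])
  have 2: "tvec_norm g (f x) (tangent_map \<A> f x w) = \<bar>t\<bar> * tvec_norm g (f x) (tangent_map \<A> f x v)"
    unfolding t(2) tangent_map_scale[OF diff_f vt] by (rule tvec_norm_scale[OF mt])
  have pos: "tvec_norm g x v > 0" "tvec_norm g (f x) (tangent_map \<A> f x v) > 0"
    using tvec_norm_pos[OF vt assms(3)] tvec_norm_pos[OF mt m(2)] by auto
  show ?thesis
    unfolding expansion_def w_def[symmetric] Let_def 1 2 using t(1) pos by (simp add: ln_mult)
qed

lemma norm_cocycle: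
  assumes "x \<in> \<Xi>" "v \<in> E x" "v \<noteq> tvec_zero"
  shows "tangent_map \<A> (f ^^ n) x v \<in> E ((f ^^ n) x) \<and> tangent_map \<A> (f ^^ n) x v \<noteq> tvec_zero \<and>
    ln (tvec_norm g ((f ^^ n) x) (tangent_map \<A> (f ^^ n) x v)) = ln (tvec_norm g x v) + (\<Sum>j<n. expansion ((f ^^ j) x))"
proof (induction n)
  case 0
  have "f ^^ 0 = (\<lambda>x. x)" by auto
  then show ?case using tangent_map_id[OF E_tangent[OF assms(1,2)]] assms by simp
next
  case (Suc n)
  have x: "(f ^^ n) x \<in> \<Xi>" by (rule funpow_\<Xi>[OF assms(1)])
  have eq: "tangent_map \<A> (f ^^ Suc n) x v = tangent_map \<A> f ((f ^^ n) x) (tangent_map \<A> (f ^^ n) x v)"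
    using tangent_map_compose[OF chart_diff_funpow[OF diff_f] diff_f E_tangent[OF assms(1,2)], of n] by simp
  have fS: "(f ^^ Suc n) x = f ((f ^^ n) x)" by simp
  show ?case
    unfolding eq fS using tangent_map_E[OF x, of "tangent_map \<A> (f ^^ n) x v"] expansion_eq[OF x, of "tangent_map \<A> (f ^^ n) x v"] Suc by simp
qed

text \<open>By the chain rule the logarithm of the norm is a Birkhoff sum of
  \<open>expansion\<close> plus the initial term \<open>ln (tvec_norm g x v)\<close>, which
  disappears after division by \<open>n\<close>. Exponents along the field are thus limits of
  Birkhoff averages.\<close>

lemma has_exponent_iff:
  assumes "x \<in> \<Xi>" "v \<in> E x" "v \<noteq> tvec_zero"
  shows "has_exponent_at \<A> g f x v L \<longleftrightarrow> (\<lambda>n. (\<Sum>j<n. expansion ((f ^^ j) x)) / real n) \<longlonglongrightarrow> L"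
proof -
  define a where "a = ln (tvec_norm g x v)"
  have 0: "(\<lambda>n. a / real n) \<longlonglongrightarrow> 0" by (rule lim_const_over_n)
  have eq: "ln (tvec_norm g ((f ^^ n) x) (tangent_map \<A> (f ^^ n) x v)) / real n = a / real n + (\<Sum>j<n. expansion ((f ^^ j) x)) / real n" for n
    using norm_cocycle[OF assms, of n] unfolding a_def by (simp add: add_divide_distrib)
  show ?thesis
    unfolding has_exponent_at_def eq
    using tendsto_add[OF 0, of "\<lambda>n. (\<Sum>j<n. expansion ((f ^^ j) x)) / real n" L]
      tendsto_diff[OF _ 0, of "\<lambda>n. a / real n + (\<Sum>j<n. expansion ((f ^^ j) x)) / real n" L] by auto
qed

lemma ex_E: "x \<in> \<Xi> \<Longrightarrow> \<exists>v. v \<in> E x \<and> v \<noteq> tvec_zero"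
proof -
  assume "x \<in> \<Xi>"
  then obtain v where v: "v \<noteq> tvec_zero" "E x = tvec_line v" using E_line by blast
  have "v \<in> E x" unfolding v(2) tvec_line_def by (rule range_eqI[of _ _ 1]) simp
  then show ?thesis using v by blast
qed

text \<open>Near \<open>x\<close> the expansion is computed from the continuous spanning vector
  \<open>u\<close> in one chart and its image in a chart at \<open>f x\<close>; both norms are
  continuous and positive.\<close>

lemma expansion_continuous: "continuous_on \<Xi> expansion"
proof -
  have "continuous (at x within \<Xi>) expansion" if x: "x \<in> \<Xi>" for x
  proof -
    obtain c U u where c: "c \<in> charts_at \<A> x" and U: "open U" "x \<in> U" "U \<subseteq> fst c"
      and u: "continuous_on (\<Xi> \<inter> U) u" "\<forall>y\<in>\<Xi> \<inter> U. u y \<noteq> 0 \<and> E y = tvec_line (tvec_of \<A> y c (u y))"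
      using cont_E x unfolding continuous_line_field_def by blast
    obtain d where d: "d \<in> charts_at \<A> (f x)" using ex_chart by blast
    have cA: "c \<in> \<A>" and dA: "d \<in> \<A>" and fxd: "f x \<in> fst d" using charts_atD c d by auto
    define S where "S = \<Xi> \<inter> (U \<inter> f -` fst d)"
    have op: "open (U \<inter> f -` fst d)"
      using U(1) open_vimage[OF chartD(1)[OF dA] cont_f] by (rule open_Int)
    define D where "D y = frechet_derivative (chart_rep c d f) (at (snd c y))" for y
    have cS: "c \<in> charts_at \<A> y" and dS: "d \<in> charts_at \<A> (f y)" if "y \<in> S" for y
      using that U(3) cA dA unfolding S_def charts_at_def by auto
    have uS: "continuous_on S u" using u(1) unfolding S_def by (rule continuous_on_subset) auto
    have linD: "linear (D y)" if "y \<in> S" for y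
      unfolding D_def using linear_chart_rep[OF diff_f cS[OF that] dS[OF that]] .
    have Db: "continuous_on S (\<lambda>y. D y b)" for b
    proof -
      have "Ck_on 1 (chart_rep c d f) (snd c ` (fst c \<inter> f -` fst d))"
        using C1 cA dA unfolding C1_map_def by blast
      then have "continuous_on (snd c ` (fst c \<inter> f -` fst d)) (\<lambda>q. frechet_derivative (chart_rep c d f) (at q) b)" by simp
      moreover have "continuous_on S (snd c)"
        using chartD(2)[OF cA] by (rule continuous_on_subset) (use U(3) in \<open>auto simp: S_def\<close>)
      ultimately show ?thesis unfolding D_def
        by (rule continuous_on_compose2) (use U(3) in \<open>auto simp: S_def\<close>)
    qed
    \<comment> \<open>The derivative is continuous in the base point for each fixed direction; since
      \<open>u y\<close> varies, it is expanded in the basis.\<close>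
    have Du: "continuous_on S (\<lambda>y. D y (u y))"
    proof -
      have "continuous_on S (\<lambda>y. \<Sum>b\<in>Basis. (u y \<bullet> b) *\<^sub>R D y b)" using uS Db by (intro continuous_intros) auto
      moreover have "D y (u y) = (\<Sum>b\<in>Basis. (u y \<bullet> b) *\<^sub>R D y b)" if "y \<in> S" for y
      proof -
        have "D y (u y) = D y (\<Sum>b\<in>Basis. (u y \<bullet> b) *\<^sub>R b)" by (simp add: euclidean_representation)
        also have "\<dots> = (\<Sum>b\<in>Basis. (u y \<bullet> b) *\<^sub>R D y b)" using linD[OF that] by (simp add: linear_sum linear_cmul)
        finally show ?thesis .
      qed
      ultimately show ?thesis by (simp cong: continuous_on_cong)
    qed
    have eq: "expansion y = ln (sqrt (gram d (f y) (D y (u y)) (D y (u y)))) - ln (sqrt (gram c y (u y) (u y)))"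
      and pos: "gram d (f y) (D y (u y)) (D y (u y)) > 0" "gram c y (u y) (u y) > 0" if y: "y \<in> S" for y
    proof -
      have y\<Xi>: "y \<in> \<Xi>" "y \<in> \<Xi> \<inter> U" using y unfolding S_def by auto
      define v where "v = tvec_of \<A> y c (u y)"
      have vt: "v \<in> tangent_space \<A> y" unfolding v_def by (rule tvec_of_in_tangent[OF cS[OF y]])
      have vc: "v c = u y" unfolding v_def by (rule tvec_of_self[OF cS[OF y]])
      have v0: "v \<noteq> tvec_zero" using vc u(2) y\<Xi>(2) unfolding tvec_zero_def by auto
      have Ey: "E y = tvec_line v" using u(2) y\<Xi>(2) unfolding v_def by blast
      have vE: "v \<in> E y" unfolding Ey tvec_line_def by (rule range_eqI[of _ _ 1]) simp
      define w where "w = tangent_map \<A> f y v"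
      have w: "w \<in> E (f y)" "w \<noteq> tvec_zero" using tangent_map_E[OF y\<Xi>(1) vE v0] unfolding w_def by auto
      have fy: "f y \<in> \<Xi>" using inv\<Xi> y\<Xi>(1) by blast
      have wt: "w \<in> tangent_space \<A> (f y)" using E_tangent[OF fy w(1)] .
      have wd: "w d = D y (u y)" unfolding w_def D_def using tangent_map_chart[OF diff_f vt cS[OF y] dS[OF y]] vc by simp
      show "expansion y = ln (sqrt (gram d (f y) (D y (u y)) (D y (u y)))) - ln (sqrt (gram c y (u y) (u y)))"
        using expansion_eq[OF y\<Xi>(1) vE v0] tvec_norm_gram[OF wt dS[OF y]] tvec_norm_gram[OF vt cS[OF y]]
        unfolding w_def[symmetric] wd vc by simp
      show "gram d (f y) (D y (u y)) (D y (u y)) > 0" "gram c y (u y) (u y) > 0"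
        using gram_props(2)[OF dS[OF y] tangent_nonzero[OF wt dS[OF y] w(2)]]
          gram_props(2)[OF cS[OF y] tangent_nonzero[OF vt cS[OF y] v0]] unfolding wd vc by auto
    qed
    have "continuous_on S (\<lambda>y. gram d (f y) (D y (u y)) (D y (u y)))"
      by (rule gram_continuous[OF dA _ _ Du]) (use cont_f in \<open>auto simp: S_def intro: continuous_on_subset\<close>)
    moreover have "continuous_on S (\<lambda>y. gram c y (u y) (u y))"
      using gram_continuous[OF cA continuous_on_id _ uS] U(3) unfolding S_def by auto
    ultimately have "continuous_on S (\<lambda>y. ln (sqrt (gram d (f y) (D y (u y)) (D y (u y)))) - ln (sqrt (gram c y (u y) (u y))))"
      using pos by (intro continuous_on_diff continuous_on_ln continuous_on_real_sqrt) (auto simp: less_imp_neq[symmetric])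
    then have "continuous_on S expansion" using eq by (simp cong: continuous_on_cong)
    then have "continuous (at x within S) expansion"
      using x U fxd unfolding S_def continuous_on_eq_continuous_within by blast
    \<comment> \<open>\<open>S\<close> is a relatively open neighbourhood of \<open>x\<close> in
      \<open>\<Xi>\<close>, so continuity within \<open>S\<close> is continuity within
      \<open>\<Xi>\<close>.\<close>
    moreover have "at x within S = at x within \<Xi>"
      by (rule at_within_nhd[of x "U \<inter> f -` fst d"]) (use op U fxd in \<open>auto simp: S_def\<close>)
    ultimately show ?thesis by simp
  qed
  then show ?thesis by (simp add: continuous_on_eq_continuous_within)
qed

end

text \<open>The sums of \<open>h j - L\<close> are themselves periodic, hence bounded, and vanish
  after division by \<open>n\<close>.\<close>

lemma periodic_average_tendsto:
  fixes h :: "nat \<Rightarrow> real"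
  assumes p: "p > 0" and per: "\<And>n. h (n + p) = h n"
  shows "(\<lambda>n. (\<Sum>j<n. h j) / real n) \<longlonglongrightarrow> (\<Sum>j<p. h j) / real p"
proof -
  define L where "L = (\<Sum>j<p. h j) / real p"
  define s where "s n = (\<Sum>j<n. h j - L)" for n
  have sp: "s p = 0" unfolding s_def L_def using p by (simp add: sum_subtractf)
  have sper: "s (n + p) = s n" for n
  proof (induction n)
    case 0
    then show ?case using sp by (simp add: s_def)
  next
    case (Suc n)
    then show ?case using per[of n] by (simp add: s_def)
  qed
  have smod: "s n = s (n mod p)" for n
  proof (induction n rule: less_induct)
    case (less n)
    show ?case
    proof (cases "n < p")
      case False
      then have "s n = s (n - p)" using sper[of "n - p"] by simp
      also have "\<dots> = s ((n - p) mod p)" using less[of "n - p"] False p by simp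
      also have "(n - p) mod p = n mod p" using False by (simp add: le_mod_geq)
      finally show ?thesis .
    qed simp
  qed
  define B where "B = Max ((\<lambda>n. \<bar>s n\<bar>) ` {..p})"
  have B: "\<bar>s n\<bar> \<le> B" for n
  proof -
    have "\<bar>s (n mod p)\<bar> \<le> B" unfolding B_def using p by (intro Max_ge) (auto intro: less_imp_le)
    then show ?thesis using smod[of n] by simp
  qed
  have "(\<lambda>n. s n / real n) \<longlonglongrightarrow> 0"
  proof (rule tendsto_rabs_zero_cancel, rule tendsto_sandwich[of "\<lambda>_. 0"])
    show "eventually (\<lambda>n. \<bar>s n / real n\<bar> \<le> B / real n) sequentially"
      using B by (intro always_eventually) (auto simp: abs_divide intro: divide_right_mono)
    show "(\<lambda>n. B / real n) \<longlonglongrightarrow> 0" by (rule lim_const_over_n)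
  qed (auto intro: always_eventually)
  then have "(\<lambda>n. s n / real n + L) \<longlonglongrightarrow> 0 + L" by (intro tendsto_add tendsto_const)
  moreover have "eventually (\<lambda>n. s n / real n + L = (\<Sum>j<n. h j) / real n) sequentially"
    using eventually_gt_at_top[of 0]
  proof eventually_elim
    case (elim n)
    then show ?case unfolding s_def by (simp add: sum_subtractf diff_divide_distrib)
  qed
  ultimately show ?thesis unfolding L_def[symmetric] by (simp add: tendsto_cong)
qed

text \<open>The predicate inside \<open>line_exponent\<close> is not known to be measurable. Here
  singletons decide: each point of \<open>\<Gamma>\<close> is measurable and has positive
  mass.\<close>

lemma AE_orbit_measure_iff_all:
  fixes \<Gamma> :: "'a::metric_space set"
  assumes fin: "finite \<Gamma>" "\<Gamma> \<noteq> {}"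
  shows "(AE x in orbit_measure \<Gamma>. P x) \<longleftrightarrow> (\<forall>x\<in>\<Gamma>. P x)"
proof
  have G: "\<Gamma> \<in> sets borel" using fin by (intro borel_closed finite_imp_closed)
  have "AE x in orbit_measure \<Gamma>. x \<in> \<Gamma>" using AE_orbit_measure_iff[OF fin, of "\<lambda>x. x \<in> \<Gamma>"] G by simp
  then show "AE x in orbit_measure \<Gamma>. P x" if "\<forall>x\<in>\<Gamma>. P x"
    by (rule eventually_mono) (use that in blast)
  assume AE: "AE x in orbit_measure \<Gamma>. P x"
  show "\<forall>x\<in>\<Gamma>. P x"
  proof
    fix x assume x: "x \<in> \<Gamma>"
    show "P x"
    proof (rule ccontr)
      assume "\<not> P x"
      then have "AE y in orbit_measure \<Gamma>. y \<noteq> x" using AE by (auto elim: eventually_mono)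
      moreover have "{y. y \<noteq> x} = UNIV - {x}" by auto
      then have "{y. y \<noteq> x} \<in> sets borel" by auto
      ultimately show False using AE_orbit_measure_iff[OF fin, of "\<lambda>y. y \<noteq> x"] x by blast
    qed
  qed
qed

context line_field
begin

text \<open>Existence for the \<open>THE\<close> is the limit of periodic averages; uniqueness
  follows from one nonzero vector at one point of the orbit.\<close>

lemma line_exponent_orbit:
  assumes orb: "periodic_orbit f \<Gamma>" and sub: "\<Gamma> \<subseteq> \<Xi>"
  shows "line_exponent \<A> g f E (orbit_measure \<Gamma>) = sum expansion \<Gamma> / card \<Gamma>"
proof -
  have fin: "finite \<Gamma>" "card \<Gamma> > 0" using periodic_orbit_finite[OF orb] periodic_orbit_card_pos[OF orb] by auto
  then have ne: "\<Gamma> \<noteq> {}" by auto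
  have lim: "(\<lambda>n. (\<Sum>j<n. expansion ((f ^^ j) z)) / real n) \<longlonglongrightarrow> sum expansion \<Gamma> / card \<Gamma>" if z: "z \<in> \<Gamma>" for z
  proof -
    have "(f ^^ (n + card \<Gamma>)) z = (f ^^ n) z" for n
      using periodic_orbit_period[OF orb z] by (simp add: funpow_add)
    then show ?thesis
      using periodic_average_tendsto[OF fin(2), of "\<lambda>j. expansion ((f ^^ j) z)"]
        sum_periodic_orbit[OF orb z, of expansion] by simp
  qed
  show ?thesis
    unfolding line_exponent_def AE_orbit_measure_iff_all[OF fin(1) ne]
  proof (rule the_equality)
    show "\<forall>x\<in>\<Gamma>. \<forall>v\<in>E x. v \<noteq> tvec_zero \<longrightarrow> has_exponent_at \<A> g f x v (sum expansion \<Gamma> / card \<Gamma>)"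
    proof (intro ballI impI)
      fix x v assume h: "x \<in> \<Gamma>" "v \<in> E x" "v \<noteq> tvec_zero"
      then show "has_exponent_at \<A> g f x v (sum expansion \<Gamma> / card \<Gamma>)"
        using has_exponent_iff[of x v] lim[OF h(1)] sub by blast
    qed
    fix L assume L: "\<forall>x\<in>\<Gamma>. \<forall>v\<in>E x. v \<noteq> tvec_zero \<longrightarrow> has_exponent_at \<A> g f x v L"
    obtain z where z: "z \<in> \<Gamma>" using ne by blast
    then have z\<Xi>: "z \<in> \<Xi>" using sub by blast
    obtain v where v: "v \<in> E z" "v \<noteq> tvec_zero" using ex_E[OF z\<Xi>] by blast
    have "has_exponent_at \<A> g f z v L" using L z v by blast
    then have "(\<lambda>n. (\<Sum>j<n. expansion ((f ^^ j) z)) / real n) \<longlonglongrightarrow> L"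
      using has_exponent_iff[OF z\<Xi> v] by blast
    then show "L = sum expansion \<Gamma> / card \<Gamma>" using lim[OF z] by (rule LIMSEQ_unique)
  qed
qed

text \<open>Weak convergence is tested on functions continuous on the whole space, whereas the
  expansion is continuous on \<open>\<Xi>\<close> only. Tietze's theorem bridges the gap.\<close>

lemma expansion_extension:
  assumes "closed \<Xi>"
  obtains h where "continuous_on UNIV h" "\<And>x. x \<in> \<Xi> \<Longrightarrow> h x = expansion x"
proof -
  have "normal_space (euclidean :: 'm topology)"
    by (intro metrizable_imp_normal_space metrizable_space_euclidean)
  moreover have "closedin (euclidean :: 'm topology) \<Xi>" using assms by simp
  moreover have "continuous_map (subtopology euclidean \<Xi>) euclideanreal expansion"
    using expansion_continuous by simp
  ultimately obtain h where "continuous_map euclidean euclideanreal h" "\<And>x. x \<in> \<Xi> \<Longrightarrow> h x = expansion x"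
    using Tietze_extension_realinterval[of euclidean \<Xi> UNIV expansion] by auto
  then show thesis using that[of h] by simp
qed

lemma nonhyperbolic_limit:
  assumes comp: "compact (UNIV :: 'm set)" and cl: "closed \<Xi>"
    and orb: "\<And>n. n \<ge> 1 \<Longrightarrow> periodic_orbit f (\<Gamma> n)" and sub: "\<And>n. n \<ge> 1 \<Longrightarrow> \<Gamma> n \<subseteq> \<Xi>"
    and lim: "weak_star_limit (\<lambda>n. orbit_measure (\<Gamma> n)) \<mu>" and erg: "ergodic_measure f \<mu>"
    and exps: "(\<lambda>n. line_exponent \<A> g f E (orbit_measure (\<Gamma> n))) \<longlonglongrightarrow> 0"
  shows "nonhyperbolic_measure \<A> g f \<mu>"
proof -
  have \<mu>: "borel_probability \<mu>" using lim unfolding weak_star_limit_def by blast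
  interpret prob_space \<mu> using borel_probabilityD(1)[OF \<mu>] .
  note [simp] = borel_probabilityD(2-)[OF \<mu>]
  have fin: "finite (\<Gamma> n)" "\<Gamma> n \<noteq> {}" "card (\<Gamma> n) > 0" if "n \<ge> 1" for n
    using periodic_orbit_finite[OF orb[OF that]] periodic_orbit_card_pos[OF orb[OF that]] by auto
  obtain h where h: "continuous_on UNIV h" "\<And>x. x \<in> \<Xi> \<Longrightarrow> h x = expansion x"
    using expansion_extension[OF cl] by blast
  have hm: "h \<in> borel_measurable borel" using h(1) by (rule borel_measurable_continuous_onI)
  have "bounded (range h)" using h(1) comp compact_continuous_image compact_imp_bounded by blast
  then obtain B where B: "\<And>x. \<bar>h x\<bar> \<le> B" unfolding bounded_real by auto
  have eq: "integral\<^sup>L (orbit_measure (\<Gamma> n)) h = line_exponent \<A> g f E (orbit_measure (\<Gamma> n))" if n: "n \<ge> 1" for n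
  proof -
    have "sum h (\<Gamma> n) = sum expansion (\<Gamma> n)" using h(2) sub[OF n] by (intro sum.cong) auto
    then show ?thesis
      using integral_orbit_measure[OF fin(1)[OF n] fin(2)[OF n] hm] line_exponent_orbit[OF orb[OF n] sub[OF n]] by simp
  qed
  have "(\<lambda>n. integral\<^sup>L (orbit_measure (\<Gamma> n)) h) \<longlonglongrightarrow> integral\<^sup>L \<mu> h"
    using lim h(1) unfolding weak_star_limit_def by blast
  moreover have "(\<lambda>n. integral\<^sup>L (orbit_measure (\<Gamma> n)) h) \<longlonglongrightarrow> 0"
  proof (rule Lim_transform_eventually[OF exps])
    show "eventually (\<lambda>n. line_exponent \<A> g f E (orbit_measure (\<Gamma> n)) = integral\<^sup>L (orbit_measure (\<Gamma> n)) h) sequentially"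
      using eventually_ge_at_top[of 1] by eventually_elim (simp add: eq)
  qed
  ultimately have int0: "integral\<^sup>L \<mu> h = 0" by (rule LIMSEQ_unique)
  \<comment> \<open>The closed set \<open>\<Xi>\<close> carries all orbit measures and hence the
    limit, so the extension \<open>h\<close> agrees with the expansion along almost every
    orbit.\<close>
  have "measure \<mu> \<Xi> \<ge> 1"
  proof (rule weak_star_limit_closed[OF lim comp cl])
    show "eventually (\<lambda>n. borel_probability (orbit_measure (\<Gamma> n)) \<and> 1 \<le> measure (orbit_measure (\<Gamma> n)) \<Xi>) sequentially"
      using eventually_ge_at_top[of 1]
    proof eventually_elim
      case (elim n)
      have "\<Gamma> n \<inter> \<Xi> = \<Gamma> n" using sub[OF elim] by blast
      then show ?case
        using borel_probability_orbit_measure[OF fin(1)[OF elim] fin(2)[OF elim]] fin(3)[OF elim]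
          measure_orbit_measure[OF fin(1)[OF elim] fin(2)[OF elim] borel_closed[OF cl]] by simp
    qed
  qed simp
  then have "prob \<Xi> = 1" using prob_le_1[of \<Xi>] by linarith
  then have ae\<Xi>: "AE x in \<mu>. x \<in> \<Xi>" using cl by (simp add: prob_eq_1)
  have "AE x in \<mu>. \<exists>v\<in>tangent_space \<A> x. v \<noteq> tvec_zero \<and> has_exponent_at \<A> g f x v 0"
    using birkhoff_ergodic[OF erg hm B] ae\<Xi>
  proof eventually_elim
    case (elim x)
    obtain v where v: "v \<in> E x" "v \<noteq> tvec_zero" using ex_E elim(2) by blast
    have "(\<Sum>j<n. h ((f ^^ j) x)) = (\<Sum>j<n. expansion ((f ^^ j) x))" for n
      using h(2) funpow_\<Xi>[OF elim(2)] by (intro sum.cong) auto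
    then have "has_exponent_at \<A> g f x v 0" using elim(1) has_exponent_iff[OF elim(2) v] int0 by simp
    then show ?case using v E_tangent[OF elim(2) v(1)] by blast
  qed
  then show ?thesis unfolding nonhyperbolic_measure_def lyapunov_exponent_def using erg by blast
qed

end

section \<open>From the assumptions on exponents to a GIKN sequence with a limit\<close>

lemma good_approximation_exact_fraction:
  assumes "good_approximation T \<gamma> \<kappa> \<Gamma> \<Lambda>"
  shows "\<exists>\<kappa>'>0. \<kappa>' \<le> 1 \<and> \<kappa> \<le> \<kappa>' \<and> good_approximation T \<gamma> \<kappa>' \<Gamma> \<Lambda>"
proof -
  have per: "periodic_orbit T \<Gamma>" "periodic_orbit T \<Lambda>" using assms unfolding good_approximation_def by auto
  have c: "card \<Gamma> > 0" "card \<Lambda> > 0" using per periodic_orbit_card_pos by metis+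
  obtain \<Delta> \<psi> k where *: "\<Delta> \<subseteq> \<Gamma>" "\<kappa> * card \<Gamma> \<le> card \<Delta>" "\<psi> ` \<Delta> = \<Lambda>"
    "\<And>z. z \<in> \<Lambda> \<Longrightarrow> card {y\<in>\<Delta>. \<psi> y = z} = k" "card \<Delta> = k * card \<Lambda>" "k > 0"
    "\<And>y j. y \<in> \<Delta> \<Longrightarrow> j < card \<Lambda> \<Longrightarrow> dist ((T ^^ j) y) ((T ^^ j) (\<psi> y)) < \<gamma>"
    using good_approximationE[OF assms] by blast
  \<comment> \<open>The proportion supplied in (b) may fail to be positive for small indices,
    whereas a GIKN sequence asks for positive factors. The actual proportion is positive because
    \<open>\<Delta>\<close> is nonempty.\<close>
  define \<kappa>' where "\<kappa>' = card \<Delta> / card \<Gamma>"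
  have ga: "good_approximation T \<gamma> \<kappa>' \<Gamma> \<Lambda>"
    by (rule good_approximationI[OF per *(1) _ *(3,4,7)]) (use c in \<open>auto simp: \<kappa>'_def\<close>)
  have "\<kappa>' > 0" unfolding \<kappa>'_def using c *(5,6) by simp
  moreover have "\<kappa> \<le> \<kappa>'" unfolding \<kappa>'_def using *(2) c by (simp add: pos_le_divide_eq)
  ultimately show ?thesis using ga good_approximation_le_1[OF ga] by blast
qed

text \<open>Summable defects make the product converge absolutely; its limit is nonzero since no
  factor vanishes.\<close>

lemma prod_tendsto_pos:
  fixes \<kappa> :: "nat \<Rightarrow> real"
  assumes pos: "\<And>n. n \<ge> 1 \<Longrightarrow> 0 < \<kappa> n \<and> \<kappa> n \<le> 1" and sm: "summable (\<lambda>n. 1 - \<kappa> (Suc n))"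
  shows "\<exists>P>0. (\<lambda>N. \<Prod>n=1..N. \<kappa> n) \<longlonglongrightarrow> P"
proof -
  define a where "a n = \<kappa> (Suc n)" for n
  have a: "0 < a n" "a n \<le> 1" for n using pos[of "Suc n"] unfolding a_def by auto
  have "summable (\<lambda>n. norm (a n - 1))" using sm a(2) unfolding a_def[symmetric] by (simp add: abs_minus_commute)
  then have "abs_convergent_prod a" by (rule summable_imp_abs_convergent_prod)
  then have "convergent_prod a" by (rule abs_convergent_prod_imp_convergent_prod)
  then obtain P where P: "(\<lambda>n. \<Prod>i\<le>n. a i) \<longlonglongrightarrow> P" "P \<noteq> 0"
    using convergent_prod_iff_nz_lim[of a] a(1) by (metis less_irrefl)
  have "0 \<le> P" using P(1) a(1) by (intro tendsto_lowerbound[OF P(1)]) (auto intro!: always_eventually prod_pos less_imp_le)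
  moreover have "(\<lambda>n. \<Prod>i\<le>n. a i) = (\<lambda>N. \<Prod>n=1..Suc N. \<kappa> n)"
  proof
    fix N
    show "(\<Prod>i\<le>N. a i) = (\<Prod>n=1..Suc N. \<kappa> n)" unfolding a_def
      by (rule prod.reindex_bij_witness[of _ "\<lambda>n. n - 1" Suc]) auto
  qed
  ultimately show ?thesis using P LIMSEQ_imp_Suc[of "\<lambda>N. \<Prod>n=1..N. \<kappa> n" P]
    by (metis (no_types, lifting) order_le_less)
qed

text \<open>A one-point orbit has infinite \<open>min_distance\<close>, so the bound starts at an
  orbit \<open>\<Gamma> m\<close> with two points at distance \<open>D\<close>. From
  \<open>m\<close> on the infimum is at most \<open>D\<close>, and the powers of 2 give a geometric
  series.\<close>

lemma summable_of_min_distance: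
  fixes \<Gamma> :: "nat \<Rightarrow> 'a::metric_space set"
  assumes card: "filterlim (\<lambda>n. card (\<Gamma> n)) at_top sequentially" and pos: "\<And>n. n \<ge> 1 \<Longrightarrow> \<gamma> n > 0"
    and le: "\<And>n. n \<ge> 1 \<Longrightarrow> ereal (\<gamma> n) < (INF i\<in>{1..n}. min_distance (\<Gamma> i)) / ereal (3 * 2 ^ n)"
  shows "summable (\<lambda>n. \<gamma> (Suc n))"
proof -
  have "eventually (\<lambda>n. card (\<Gamma> n) \<ge> 2 \<and> n \<ge> 1) sequentially"
    using card eventually_ge_at_top[of 1] unfolding filterlim_at_top by (intro eventually_conj) auto
  then obtain m where m: "card (\<Gamma> m) \<ge> 2" "m \<ge> 1" unfolding eventually_sequentially by auto
  have "\<not> (\<exists>x. \<Gamma> m \<subseteq> {x})"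
  proof
    assume "\<exists>x. \<Gamma> m \<subseteq> {x}"
    then obtain x where "\<Gamma> m \<subseteq> {x}" by blast
    then have "card (\<Gamma> m) \<le> card {x}" by (intro card_mono) auto
    then show False using m by simp
  qed
  moreover have "\<Gamma> m \<noteq> {}" using m by auto
  ultimately obtain x y where xy: "x \<in> \<Gamma> m" "y \<in> \<Gamma> m" "x \<noteq> y" by (metis all_not_in_conv insertCI subsetI singletonD)
  define D where "D = dist x y"
  have mD: "min_distance (\<Gamma> m) \<le> ereal D"
    unfolding min_distance_def D_def by (rule Inf_lower) (use xy in blast)
  have bound: "\<gamma> n \<le> D * (1 / 2) ^ n" if n: "n \<ge> m" for n
  proof -
    have "(INF i\<in>{1..n}. min_distance (\<Gamma> i)) \<le> min_distance (\<Gamma> m)" using m n by (intro INF_lower) auto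
    also note mD
    finally have "(INF i\<in>{1..n}. min_distance (\<Gamma> i)) / ereal (3 * 2 ^ n) \<le> ereal D / ereal (3 * 2 ^ n)"
      by (intro ereal_divide_right_mono) auto
    then have "ereal (\<gamma> n) < ereal D / ereal (3 * 2 ^ n)" using le[of n] m n by (meson le_trans less_le_trans)
    then have "\<gamma> n < D / (3 * 2 ^ n)" by simp
    also have "\<dots> \<le> D / 2 ^ n" unfolding D_def by (intro divide_left_mono) auto
    finally show ?thesis by (simp add: power_one_over)
  qed
  have "summable \<gamma>"
  proof (rule summable_comparison_test')
    show "summable (\<lambda>n. D * (1 / 2) ^ n)" by (intro summable_mult summable_geometric) simp
    show "norm (\<gamma> n) \<le> D * (1 / 2) ^ n" if "n \<ge> m" for n using bound[OF that] pos[of n] m that by simp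
  qed
  then show ?thesis by (simp add: summable_Suc_iff)
qed

lemma royal_imp_gikn_limit:
  fixes T :: "'a::metric_space \<Rightarrow> 'a"
  assumes "compact (UNIV :: 'a set)" "continuous_on UNIV T" "royal_measure_of T \<Gamma> \<mu>"
  shows "gikn_limit T \<Gamma> \<mu>"
proof -
  have g: "gikn_sequence T \<Gamma>" and l: "weak_star_limit (\<lambda>n. orbit_measure (\<Gamma> n)) \<mu>"
    using assms(3) unfolding royal_measure_of_def by auto
  have "orbit_sequence T \<Gamma>" using g unfolding gikn_sequence_def by blast
  then show ?thesis
    using assms(1,2) gikn_sequence_tail[OF g] l by unfold_locales
qed

lemma contracting_exponents:
  fixes s :: "nat \<Rightarrow> real"
  assumes \<alpha>: "0 < \<alpha>" "\<alpha> < 1" and c: "\<And>n. n \<ge> 1 \<Longrightarrow> \<bar>s (Suc n)\<bar> < \<alpha> * \<bar>s n\<bar>"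
  shows "s \<longlonglongrightarrow> 0" "summable (\<lambda>n. \<bar>s (Suc n)\<bar>)"
proof -
  have b: "\<bar>s (Suc n)\<bar> \<le> \<bar>s 1\<bar> * \<alpha> ^ n" for n
  proof (induction n)
    case (Suc n)
    have "\<bar>s (Suc (Suc n))\<bar> \<le> \<alpha> * \<bar>s (Suc n)\<bar>" using c[of "Suc n"] by simp
    also have "\<dots> \<le> \<alpha> * (\<bar>s 1\<bar> * \<alpha> ^ n)" using Suc \<alpha> by (intro mult_left_mono) auto
    finally show ?case by (simp add: algebra_simps)
  qed simp
  show sm: "summable (\<lambda>n. \<bar>s (Suc n)\<bar>)"
    by (rule summable_comparison_test'[where g="\<lambda>n. \<bar>s 1\<bar> * \<alpha> ^ n" and N=0])
      (use b \<alpha> in \<open>auto intro!: summable_mult summable_geometric\<close>)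
  have "(\<lambda>n. \<bar>s (Suc n)\<bar>) \<longlonglongrightarrow> 0" using sm by (rule summable_LIMSEQ_zero)
  then have "(\<lambda>n. s (Suc n)) \<longlonglongrightarrow> 0" by (rule tendsto_rabs_zero_cancel)
  then show "s \<longlonglongrightarrow> 0" by (simp add: filterlim_sequentially_Suc)
qed

lemma royal_measure_exists:
  fixes T :: "'a::metric_space \<Rightarrow> 'a"
  assumes comp: "compact (UNIV :: 'a set)" and orb: "orbit_sequence T \<Gamma>"
    and ga: "\<And>n. n \<ge> 1 \<Longrightarrow> \<gamma> n > 0 \<and> good_approximation T (\<gamma> n) (\<kappa> n) (\<Gamma> (Suc n)) (\<Gamma> n)"
    and sm: "summable (\<lambda>n. \<gamma> (Suc n))" "\<And>n. 1 - \<kappa> (Suc n) \<le> b n" "summable b"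
  shows "\<exists>\<mu>. royal_measure_of T \<Gamma> \<mu>"
proof -
  have "\<forall>n. \<exists>\<kappa>'. n \<ge> 1 \<longrightarrow> \<kappa>' > 0 \<and> \<kappa>' \<le> 1 \<and> \<kappa> n \<le> \<kappa>' \<and> good_approximation T (\<gamma> n) \<kappa>' (\<Gamma> (Suc n)) (\<Gamma> n)"
    using good_approximation_exact_fraction ga by metis
  then obtain \<kappa>' where \<kappa>': "\<And>n. n \<ge> 1 \<Longrightarrow> \<kappa>' n > 0 \<and> \<kappa>' n \<le> 1 \<and> \<kappa> n \<le> \<kappa>' n \<and> good_approximation T (\<gamma> n) (\<kappa>' n) (\<Gamma> (Suc n)) (\<Gamma> n)"
    by metis
  have sm': "summable (\<lambda>n. 1 - \<kappa>' (Suc n))"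
  proof (rule summable_comparison_test'[OF sm(3), where N=0])
    fix n :: nat
    show "norm (1 - \<kappa>' (Suc n)) \<le> b n" using \<kappa>'[of "Suc n"] sm(2)[of n] by simp
  qed
  have prod: "\<exists>P>0. (\<lambda>N. \<Prod>n=1..N. \<kappa>' n) \<longlonglongrightarrow> P" using \<kappa>' sm' by (intro prod_tendsto_pos) auto
  have gikn: "gikn_sequence T \<Gamma>"
    unfolding gikn_sequence_def
  proof (rule conjI[OF orb], rule exI[of _ \<gamma>], rule exI[of _ \<kappa>'], intro conjI)
    show "\<forall>n\<ge>1. \<gamma> n > 0 \<and> \<kappa>' n > 0 \<and> good_approximation T (\<gamma> n) (\<kappa>' n) (\<Gamma> (Suc n)) (\<Gamma> n)"
      using ga \<kappa>' by blast
  qed (fact sm(1), fact prod)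
  \<comment> \<open>The existence lemma counts from 0 and the orbits count from 1; the shift does
    not affect the limit.\<close>
  obtain \<mu> where \<mu>: "weak_star_limit (\<lambda>n. orbit_measure (\<Gamma> (Suc n))) \<mu>"
    using weak_star_limit_exists[OF comp, of T "\<lambda>n. \<gamma> (Suc n)" "\<lambda>n. \<kappa>' (Suc n)" "\<lambda>n. \<Gamma> (Suc n)"] \<kappa>' sm(1) sm' by auto
  then have "weak_star_limit (\<lambda>n. orbit_measure (\<Gamma> n)) \<mu>"
    unfolding weak_star_limit_def by (simp add: filterlim_sequentially_Suc[of "\<lambda>n. integral\<^sup>L (orbit_measure (\<Gamma> n)) _"])
  then show ?thesis unfolding royal_measure_of_def using gikn by blast
qed

theorem theorem9p4:
  shows
   "(\<forall>(T::'x::metric_space \<Rightarrow> 'x) \<Gamma> \<mu>.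
       compact (UNIV::'x set) \<and> continuous_on UNIV T \<and>
       royal_measure_of T \<Gamma> \<mu> \<and> aperiodic_measure T \<mu> \<longrightarrow>
         loosely_kronecker T \<mu> \<and>
         measure_support \<mu> = (\<Inter>k\<in>{1..}. closure (\<Union>n\<in>{k..}. \<Gamma> n)))
    \<and>
    (\<forall>(\<A>::('m::metric_space, 'e::euclidean_space) chart set) g f \<Xi> E \<Gamma> (\<gamma>::nat \<Rightarrow> real) C \<alpha>.
       compact (UNIV::'m set) \<and> riemannian_manifold \<A> g \<and> C1_diffeomorphism \<A> f \<and>
       closed \<Xi> \<and> f ` \<Xi> \<subseteq> \<Xi> \<and>
       continuous_line_field \<A> \<Xi> E \<and> invariant_line_field \<A> f \<Xi> E \<and>
       orbit_sequence f \<Gamma> \<and> (\<forall>n\<ge>1. \<Gamma> n \<subseteq> \<Xi>) \<and>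
       (\<forall>n\<ge>1. \<gamma> n > 0 \<and>
          good_approximation f (\<gamma> n)
            (1 - C * \<bar>line_exponent \<A> g f E (orbit_measure (\<Gamma> n))\<bar>) (\<Gamma> (Suc n)) (\<Gamma> n)) \<and>
       0 < \<alpha> \<and> \<alpha> < 1 \<and>
       (\<forall>n\<ge>1. \<bar>line_exponent \<A> g f E (orbit_measure (\<Gamma> (Suc n)))\<bar>
                < \<alpha> * \<bar>line_exponent \<A> g f E (orbit_measure (\<Gamma> n))\<bar>) \<and>
       (\<forall>n\<ge>1. ereal (\<gamma> n) < (INF i\<in>{1..n}. min_distance (\<Gamma> i)) / ereal (3 * 2 ^ n)) \<longrightarrow>
         (\<exists>\<mu>. royal_measure_of f \<Gamma> \<mu>) \<and>
         (\<forall>\<mu>. royal_measure_of f \<Gamma> \<mu> \<longrightarrow>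
            (nonhyperbolic_measure \<A> g f \<mu> \<and> periodic_measure f \<mu> \<or>
             nonhyperbolic_measure \<A> g f \<mu> \<and> loosely_kronecker f \<mu>) \<and>
            ergodic_measure f \<mu> \<and> ks_entropy f \<mu> = 0 \<and>
            measure_support \<mu> = (\<Inter>k\<in>{1..}. closure (\<Union>n\<in>{k..}. \<Gamma> n))))"
proof (rule conjI; intro allI impI; elim conjE)
  fix T :: "'x \<Rightarrow> 'x" and \<Gamma> \<mu>
  assume h: "compact (UNIV::'x set)" "continuous_on UNIV T" "royal_measure_of T \<Gamma> \<mu>" "aperiodic_measure T \<mu>"
  interpret gikn_limit T \<Gamma> \<mu> using royal_imp_gikn_limit[OF h(1-3)] .
  show "loosely_kronecker T \<mu> \<and> measure_support \<mu> = (\<Inter>k\<in>{1..}. closure (\<Union>n\<in>{k..}. \<Gamma> n))"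
    using loosely_kronecker[OF aperiodic_imp_no_atom[OF ergodic h(4)]] support by blast
next
  fix \<A> :: "('m, 'e) chart set" and g f \<Xi> E and \<Gamma> :: "nat \<Rightarrow> 'm set" and \<gamma> :: "nat \<Rightarrow> real" and C \<alpha>
  let ?L = "\<lambda>n. line_exponent \<A> g f E (orbit_measure (\<Gamma> n))"
  assume comp: "compact (UNIV::'m set)" and man: "riemannian_manifold \<A> g" and diffeo: "C1_diffeomorphism \<A> f"
    and cl: "closed \<Xi>" and inv: "f ` \<Xi> \<subseteq> \<Xi>" and E: "continuous_line_field \<A> \<Xi> E" "invariant_line_field \<A> f \<Xi> E"
    and orb: "orbit_sequence f \<Gamma>" and sub: "\<forall>n\<ge>1. \<Gamma> n \<subseteq> \<Xi>"
    and ga: "\<forall>n\<ge>1. \<gamma> n > 0 \<and> good_approximation f (\<gamma> n) (1 - C * \<bar>?L n\<bar>) (\<Gamma> (Suc n)) (\<Gamma> n)"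
    and \<alpha>: "0 < \<alpha>" "\<alpha> < 1" and con: "\<forall>n\<ge>1. \<bar>?L (Suc n)\<bar> < \<alpha> * \<bar>?L n\<bar>"
    and md: "\<forall>n\<ge>1. ereal (\<gamma> n) < (INF i\<in>{1..n}. min_distance (\<Gamma> i)) / ereal (3 * 2 ^ n)"
  interpret line_field \<A> g f \<Xi> E
    using man diffeo inv E unfolding riemannian_manifold_def C1_diffeomorphism_def by unfold_locales auto
  have exps: "?L \<longlonglongrightarrow> 0" "summable (\<lambda>n. \<bar>?L (Suc n)\<bar>)"
    using contracting_exponents[OF \<alpha>, of ?L] con by auto
  have sm: "summable (\<lambda>n. \<gamma> (Suc n))"
    using orb ga md unfolding orbit_sequence_def by (intro summable_of_min_distance[of \<Gamma>]) auto
  have "\<exists>\<mu>. royal_measure_of f \<Gamma> \<mu>"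
    by (rule royal_measure_exists[OF comp orb _ sm, where b="\<lambda>n. C * \<bar>?L (Suc n)\<bar>"])
      (use ga exps(2) in \<open>auto intro: summable_mult\<close>)
  moreover have "(nonhyperbolic_measure \<A> g f \<mu> \<and> periodic_measure f \<mu> \<or>
             nonhyperbolic_measure \<A> g f \<mu> \<and> loosely_kronecker f \<mu>) \<and>
            ergodic_measure f \<mu> \<and> ks_entropy f \<mu> = 0 \<and>
            measure_support \<mu> = (\<Inter>k\<in>{1..}. closure (\<Union>n\<in>{k..}. \<Gamma> n))" if royal: "royal_measure_of f \<Gamma> \<mu>" for \<mu>
  proof -
    interpret L: gikn_limit f \<Gamma> \<mu> using royal_imp_gikn_limit[OF comp cont_f royal] .
    have "nonhyperbolic_measure \<A> g f \<mu>"
      using sub by (intro nonhyperbolic_limit[OF comp cl L.per _ L.lim L.ergodic exps(1)]) auto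
    \<comment> \<open>The dichotomy is whether the ergodic measure has an atom.\<close>
    moreover have "periodic_measure f \<mu> \<or> loosely_kronecker f \<mu>"
      using L.loosely_kronecker ergodic_atom_imp_periodic(1)[OF L.ergodic] by blast
    ultimately show ?thesis using L.ergodic L.ks_entropy_zero L.support by blast
  qed
  ultimately show "(\<exists>\<mu>. royal_measure_of f \<Gamma> \<mu>) \<and>
         (\<forall>\<mu>. royal_measure_of f \<Gamma> \<mu> \<longrightarrow>
            (nonhyperbolic_measure \<A> g f \<mu> \<and> periodic_measure f \<mu> \<or>
             nonhyperbolic_measure \<A> g f \<mu> \<and> loosely_kronecker f \<mu>) \<and>
            ergodic_measure f \<mu> \<and> ks_entropy f \<mu> = 0 \<and>
            measure_support \<mu> = (\<Inter>k\<in>{1..}. closure (\<Union>n\<in>{k..}. \<Gamma> n)))" by blast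
qed

end
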